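(* Let $0<q<1$, $c>0$ and $\alpha>-1$. The functions $M_p^{(\alpha;c)}(\cdot;q)$, $p\in\mathbb{Z}$, together with the $q$-Laguerre polynomials $L_n^{(\alpha)}(\cdot;q)$, $n\in\mathbb{Z}_{\ge 0}$, form an orthogonal basis of the Hilbert space $L^2(\mu^{(\alpha;c)})$. Explicitly, for all $n,m\in\mathbb{Z}_{\ge0}$ and all $p,r\in\mathbb{Z}$, $$\mathcal{L}\bigl(L_n^{(\alpha)}(\cdot;q)\,L_m^{(\alpha)}(\cdot;q)\bigr)=\delta_{n,m}\,q^{-n}\,\frac{(q^{\alpha+1};q)_n}{(q;q)_n}\,\frac{(q,-cq^{\alpha+1},-q^{-\alpha}/c;q)_\infty}{(q^{\alpha+1},-c,-q/c;q)_\infty},$$ $$\mathcal{L}\bigl(M_p^{(\alpha;c)}(\cdot;q)\,M_r^{(\alpha;c)}(\cdot;q)\bigr)=\delta_{p,r}\,c\,q^{\alpha}q^{-p}\,\frac{(-q^{p+1}/c,-q^{-\alpha}/c;q)_\infty}{(-q^{p+1-\alpha}/c,-cq^{\alpha+1};q)_\infty}\,\frac{1}{(-c,-q/c;q)_\infty},$$ $$\mathcal{L}\bigl(M_p^{(\alpha;c)}(\cdot;q)\,L_n^{(\alpha)}(\cdot;q)\bigr)=0.$$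
   Context: Notation: $(a;q)_n=\prod_{i=0}^{n-1}(1-aq^i)$, $(a;q)_\infty=\prod_{i\ge0}(1-aq^i)$, $(a_1,\dots,a_m;q)_n=\prod_j (a_j;q)_n$ for $n\in\mathbb{Z}_{\ge0}\cup\{\infty\}$, and $${}_1\varphi_1\left({a\atop b};q,z\right)=\sum_{j=0}^\infty\frac{(a;q)_j}{(b;q)_j(q;q)_j}(-1)^jq^{j(j-1)/2}z^j .$$ $L^2(\mu^{(\alpha;c)})$ is the Hilbert space of functions $f$ on the set $\{cq^k\mid k\in\mathbb{Z}\}$ that are square integrable with respect to the discrete measure with positive mass $q^{k(\alpha+1)}/(-cq^k;q)_\infty$ at $cq^k$, $k\in\mathbb{Z}$. The functional $\mathcal{L}$ is integration against this measure: $$\mathcal{L}(f)=\sum_{k=-\infty}^\infty \frac{q^{k(\alpha+1)}}{(-cq^k;q)_\infty}\,f(cq^k),$$ so that $f\in L^2(\mu^{(\alpha;c)})$ if and only if $\mathcal{L}(|f|^2)<\infty$. The $q$-Laguerre polynomials are $$L_n^{(\alpha)}(x;q)=\frac{(q^{\alpha+1};q)_n}{(q;q)_n}\,{}_1\varphi_1\left({q^{-n}\atop q^{\alpha+1}};q,-xq^{n+\alpha+1}\right),\qquad n\in\mathbb{Z}_{\ge0},$$ and $$M_p^{(\alpha;c)}(x;q)=\frac{(q^{\alpha+1};q)_\infty}{(q,-cq^{\alpha+1};q)_\infty}\,{}_1\varphi_1\left({-cq^{\alpha-p}\atop q^{\alpha+1}};q,\frac{xq^{p+1}}{c}\right),\qquad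 p\in\mathbb{Z}.$$ An orthogonal basis of a Hilbert space is a family of nonzero, pairwise orthogonal vectors with dense linear span. *)

theory Defs
  imports "HOL-Analysis.Analysis"
begin

definition qpoch :: "real \<Rightarrow> real \<Rightarrow> nat \<Rightarrow> real" where
  "qpoch a q n = (\<Prod>i<n. 1 - a * q ^ i)"

definition qpoch_inf :: "real \<Rightarrow> real \<Rightarrow> real" where
  "qpoch_inf a q = (\<Prod>i. 1 - a * q ^ i)"

definition phi11 :: "real \<Rightarrow> real \<Rightarrow> real \<Rightarrow> real \<Rightarrow> real" where
  "phi11 a b q z =
     (\<Sum>j. qpoch a q j / (qpoch b q j * qpoch q q j) * (- 1) ^ j * q ^ (j * (j - 1) div 2) * z ^ j)"

definition qLaguerre :: "real \<Rightarrow> real \<Rightarrow> nat \<Rightarrow> real \<Rightarrow> real" where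
  "qLaguerre q \<alpha> n x =
     qpoch (q powr (\<alpha> + 1)) q n / qpoch q q n
       * phi11 (q powi (- int n)) (q powr (\<alpha> + 1)) q (- (x * q powr (real n + \<alpha> + 1)))"

definition qM :: "real \<Rightarrow> real \<Rightarrow> real \<Rightarrow> int \<Rightarrow> real \<Rightarrow> real" where
  "qM q \<alpha> c p x =
     qpoch_inf (q powr (\<alpha> + 1)) q / (qpoch_inf q q * qpoch_inf (- c * q powr (\<alpha> + 1)) q)
       * phi11 (- c * q powr (\<alpha> - of_int p)) (q powr (\<alpha> + 1)) q (x * q powi (p + 1) / c)"

definition qlag_mass :: "real \<Rightarrow> real \<Rightarrow> real \<Rightarrow> int \<Rightarrow> real" where
  "qlag_mass q \<alpha> c k = q powr (of_int k * (\<alpha> + 1)) / qpoch_inf (- c * q powi k) q"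

definition qlag_measure :: "real \<Rightarrow> real \<Rightarrow> real \<Rightarrow> real measure" where
  "qlag_measure q \<alpha> c =
     distr (point_measure UNIV (\<lambda>k. ennreal (qlag_mass q \<alpha> c k)))
       (count_space (range (\<lambda>k::int. c * q powi k))) (\<lambda>k. c * q powi k)"

definition qlag_functional ::
    "real \<Rightarrow> real \<Rightarrow> real \<Rightarrow> (real \<Rightarrow> 'b::{banach, second_countable_topology}) \<Rightarrow> 'b" where
  "qlag_functional q \<alpha> c f = (LINT x|qlag_measure q \<alpha> c. f x)"

lemma qpoch_inf_pos:
  assumes "0 < q" "q < 1" "a \<le> 0"
  shows "qpoch_inf a q > 0"
proof -
  have nz: "1 - a * q ^ i > 0" for i
    using assms by (smt (verit) mult_nonpos_nonneg zero_le_power)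
  have "summable (\<lambda>i. norm a * q ^ i)"
    using assms by (intro summable_mult summable_geometric) auto
  moreover have "norm (1 - a * q ^ i - 1) = norm a * q ^ i" for i
    using assms by (simp add: abs_mult)
  ultimately have "abs_convergent_prod (\<lambda>i. 1 - a * q ^ i)"
    by (intro summable_imp_abs_convergent_prod) simp
  then have "convergent_prod (\<lambda>i. 1 - a * q ^ i)"
    by (rule abs_convergent_prod_imp_convergent_prod)
  then show ?thesis
    unfolding qpoch_inf_def using nz by (intro less_0_prodinf) auto
qed

lemma qlag_mass_pos:
  assumes "0 < q" "q < 1" "0 < c"
  shows "qlag_mass q \<alpha> c k > 0"
  unfolding qlag_mass_def using assms by (intro divide_pos_pos qpoch_inf_pos) auto

lemma integrable_qlag_measure_iff:
  fixes f :: "real \<Rightarrow> 'b::{banach, second_countable_topology}"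
  assumes "0 < q" "q < 1" "0 < c"
  shows "integrable (qlag_measure q \<alpha> c) f \<longleftrightarrow>
    (\<lambda>k::int. norm (qlag_mass q \<alpha> c k *\<^sub>R f (c * q powi k))) summable_on UNIV"
proof -
  have "integrable (qlag_measure q \<alpha> c) f \<longleftrightarrow>
      integrable (count_space UNIV) (\<lambda>k::int. qlag_mass q \<alpha> c k *\<^sub>R f (c * q powi k))"
    unfolding qlag_measure_def point_measure_def
    using qlag_mass_pos[OF assms, of \<alpha>]
    by (subst integrable_distr_eq) (auto simp: integrable_density less_imp_le)
  then show ?thesis
    by (simp only: abs_summable_equivalent abs_summable_on_def)
qed

lemma qlag_functional_eq_infsum:
  fixes f :: "real \<Rightarrow> 'b::{banach, second_countable_topology}"
  assumes "0 < q" "q < 1" "0 < c" and "integrable (qlag_measure q \<alpha> c) f"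
  shows "qlag_functional q \<alpha> c f =
    (\<Sum>\<^sub>\<infinity>k::int. qlag_mass q \<alpha> c k *\<^sub>R f (c * q powi k))"
proof -
  have "qlag_functional q \<alpha> c f =
      (LINT k|count_space UNIV. qlag_mass q \<alpha> c k *\<^sub>R f (c * q powi k))"
    unfolding qlag_functional_def qlag_measure_def point_measure_def
    using qlag_mass_pos[OF assms(1-3), of \<alpha>]
    by (subst integral_distr) (auto simp: integral_density less_imp_le)
  also have "\<dots> = (\<Sum>\<^sub>\<infinity>k::int. qlag_mass q \<alpha> c k *\<^sub>R f (c * q powi k))"
    unfolding infsetsum_def[symmetric]
    using integrable_qlag_measure_iff[OF assms(1-3), of \<alpha> f] assms(4)
    by (intro infsetsum_infsum) (simp only: abs_summable_equivalent)
  finally show ?thesis .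
qed

text \<open>
  Elements of the Hilbert space are represented by complex-valued functions on the reals,
  identified if they agree almost everywhere; for \<^const>\<open>qlag_measure\<close> this
  means that they agree at every point \<open>c * q powi k\<close>.
\<close>

definition sq_integrable :: "'a measure \<Rightarrow> ('a \<Rightarrow> complex) set" where
  "sq_integrable N = {f \<in> borel_measurable N. integrable N (\<lambda>x. (cmod (f x))\<^sup>2)}"

definition l2_inner :: "'a measure \<Rightarrow> ('a \<Rightarrow> complex) \<Rightarrow> ('a \<Rightarrow> complex) \<Rightarrow> complex" where
  "l2_inner N f g = (LINT x|N. f x * cnj (g x))"

definition l2_norm :: "'a measure \<Rightarrow> ('a \<Rightarrow> complex) \<Rightarrow> real" where
  "l2_norm N f = sqrt (LINT x|N. (cmod (f x))\<^sup>2)"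

definition l2_orthogonal_basis :: "'a measure \<Rightarrow> ('i \<Rightarrow> 'a \<Rightarrow> complex) \<Rightarrow> bool" where
  "l2_orthogonal_basis N e \<longleftrightarrow>
     (\<forall>i. e i \<in> sq_integrable N \<and> l2_norm N (e i) \<noteq> 0) \<and>
     (\<forall>i j. i \<noteq> j \<longrightarrow> l2_inner N (e i) (e j) = 0) \<and>
     (\<forall>f \<in> sq_integrable N. \<forall>\<epsilon>>0. \<exists>J a. finite J \<and>
        l2_norm N (\<lambda>x. f x - (\<Sum>j\<in>J. a j * e j x)) < \<epsilon>)"

end

(*
  With s = 1/a the polynomials L_n and the functions M_p are, up to constant factors, values at
  s = q^n and s = -q^(p-alpha)/c of one function phi(x; s) that is entire in both variables.  It
  satisfies second order q-difference equations in x and in s.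

  Summing the equation in s by parts over the two geometric progressions shows that the rows
  phi(c q^k; .) are pairwise orthogonal with respect to the weight |s| (qs; q)_inf / (bs; q)_inf,
  where b = q^(alpha+1): the boundary terms at s = 0 cancel, the one at s = 1 vanishes, and
  phi(c q^k; s) decays superexponentially along the negative progression.  The recurrence in k shows that the squared
  norms are a constant divided by the masses.  Hence the normalised matrix of values has orthonormal
  columns.  A Casoratian argument in k makes its rows orthogonal, and Bessel's inequality for rows
  and columns then makes it unitary, which is norm formula and completeness at once.  The
  one remaining constant is the total mass, given by Ramanujan's bilateral summation formula.
*)
theory Submission
  imports Defs
begin

section \<open>The \<open>q\<close>-binomial theorem\<close>

text \<open>The polynomials alone are not dense here, since every \<open>qM\<close> is a nonzero
  element orthogonal to all of them; completeness therefore has to come from the spectral side. The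
  cancellation at s = 0 puts no constraint on where the negative progression starts. Its starting
  point -q/(cb) is dictated by the decay: then -b s c q^k is an integer power of q, and a
  transformation of phi into a series in \<open>qpoch_inf\<close> of integer powers of q loses an
  initial segment that grows along the progression. The column relations come first because Bessel's
  inequality for them shows that the functions in k are square summable. This is what removes the
  boundary term of the Casoratian as k tends to minus infinity, where no asymptotics of phi are at
  hand. At the other end the Casoratian is controlled by phi(0; s) = 1 for all s. The total mass
  fixes the remaining constant because the function belonging to s = 1 is identically 1.\<close>

lemma sums_drop_0:
  fixes f :: "nat \<Rightarrow> real"
  shows "f sums S \<Longrightarrow> f 0 = 0 \<Longrightarrow> (\<lambda>n. f (Suc n)) sums S"
  by (simp add: sums_Suc_iff)

lemma summable_ratio_tendsto:
  fixes f r :: "nat \<Rightarrow> real"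
  assumes "\<And>n. f (Suc n) = r n * f n" "r \<longlonglongrightarrow> l" "\<bar>l\<bar> < 1"
  shows "summable (\<lambda>n. \<bar>f n\<bar>)"
proof -
  obtain u where u: "\<bar>l\<bar> < u" "u < 1"
    using assms(3) dense by blast
  have "(\<lambda>n. \<bar>r n\<bar>) \<longlonglongrightarrow> \<bar>l\<bar>"
    by (intro tendsto_intros assms)
  then have "\<forall>\<^sub>F n in sequentially. \<bar>r n\<bar> < u"
    using u(1) by (rule order_tendstoD)
  then obtain N where N: "\<And>n. n \<ge> N \<Longrightarrow> \<bar>r n\<bar> < u"
    by (auto simp: eventually_sequentially)
  show ?thesis
  proof (rule summable_ratio_test[OF u(2)])
    fix n assume "n \<ge> N"
    then show "norm \<bar>f (Suc n)\<bar> \<le> u * norm \<bar>f n\<bar>"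
      using N[of n] by (auto simp: assms(1) abs_mult intro!: mult_right_mono)
  qed
qed

lemma triangle_Suc: "Suc n * (Suc n - 1) div 2 = n + n * (n - 1) div 2"
proof (cases n)
  case (Suc m)
  have "Suc n * (Suc n - 1) = 2 * n + n * (n - 1)"
    by (simp add: Suc algebra_simps)
  then show ?thesis by simp
qed simp

lemma qpoch_0 [simp]: "qpoch a q 0 = 1"
  by (simp add: qpoch_def)

lemma qpoch_Suc: "qpoch a q (Suc n) = qpoch a q n * (1 - a * q ^ n)"
  by (simp add: qpoch_def)

lemma qpoch_Suc_shift: "qpoch a q (Suc n) = (1 - a) * qpoch (a * q) q n"
  by (induction n) (simp_all add: qpoch_Suc)

locale q_param =
  fixes q :: real
  assumes q_pos: "0 < q" and q_less_1: "q < 1"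
begin

lemma q_power_tendsto_0: "(\<lambda>n. q ^ n) \<longlonglongrightarrow> 0"
  using q_pos q_less_1 by (intro LIMSEQ_realpow_zero) auto

lemma convergent_prod_qpoch: "convergent_prod (\<lambda>i. 1 - a * q ^ i)"
proof -
  have "summable (\<lambda>i. norm a * q ^ i)"
    using q_pos q_less_1 by (intro summable_mult summable_geometric) auto
  moreover have "norm (1 - a * q ^ i - 1) = norm a * q ^ i" for i
    using q_pos by (simp add: abs_mult)
  ultimately have "abs_convergent_prod (\<lambda>i. 1 - a * q ^ i)"
    by (intro summable_imp_abs_convergent_prod) simp
  then show ?thesis
    by (rule abs_convergent_prod_imp_convergent_prod)
qed

lemma qpoch_tendsto: "qpoch a q \<longlonglongrightarrow> qpoch_inf a q"
proof -
  have "(\<lambda>n. \<Prod>i\<le>n. 1 - a * q ^ i) \<longlonglongrightarrow> qpoch_inf a q"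
    unfolding qpoch_inf_def by (intro convergent_prod_LIMSEQ convergent_prod_qpoch)
  then have "(\<lambda>n. qpoch a q (Suc n)) \<longlonglongrightarrow> qpoch_inf a q"
    by (simp add: qpoch_def lessThan_Suc_atMost)
  then show ?thesis
    by (rule LIMSEQ_imp_Suc)
qed

lemma qpoch_inf_rec: "qpoch_inf a q = (1 - a) * qpoch_inf (a * q) q"
proof (rule LIMSEQ_unique)
  show "(\<lambda>n. qpoch a q (Suc n)) \<longlonglongrightarrow> qpoch_inf a q"
    by (rule LIMSEQ_Suc[OF qpoch_tendsto])
  show "(\<lambda>n. qpoch a q (Suc n)) \<longlonglongrightarrow> (1 - a) * qpoch_inf (a * q) q"
    unfolding qpoch_Suc_shift by (intro tendsto_intros qpoch_tendsto)
qed

lemma qpoch_inf_split: "qpoch_inf a q = qpoch a q n * qpoch_inf (a * q ^ n) q"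
proof (induction n)
  case (Suc n)
  then show ?case
    using qpoch_inf_rec[of "a * q ^ n"] by (simp add: qpoch_Suc mult_ac)
qed simp

lemma qpoch_inf_1 [simp]: "qpoch_inf 1 q = 0"
  by (subst qpoch_inf_rec) simp

lemma qpoch_inf_pos':
  assumes "a < 1"
  shows "qpoch_inf a q > 0"
proof -
  have "a * q ^ i < 1" for i
  proof (cases "a \<le> 0")
    case True
    then show ?thesis using q_pos
      by (smt (verit) mult_nonpos_nonneg zero_le_power)
  next
    case False
    have "q ^ i \<le> 1" using q_pos q_less_1 by (simp add: power_le_one)
    then have "a * q ^ i \<le> a * 1"
      using False by (intro mult_left_mono) auto
    then show ?thesis using assms by simp
  qed
  then show ?thesis
    unfolding qpoch_inf_def using convergent_prod_qpoch
    by (intro less_0_prodinf) auto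
qed

lemma qpoch_pos:
  assumes "a < 1"
  shows "qpoch a q n > 0"
proof -
  have "qpoch a q n * qpoch_inf (a * q ^ n) q > 0"
    using qpoch_inf_split[of a n] qpoch_inf_pos'[OF assms] by simp
  moreover have "a * q ^ n < 1"
  proof (cases "a \<le> 0")
    case True
    then show ?thesis using q_pos
      by (smt (verit) mult_nonpos_nonneg zero_le_power)
  next
    case False
    have "q ^ n \<le> 1" using q_pos q_less_1 by (simp add: power_le_one)
    then have "a * q ^ n \<le> a * 1"
      using False by (intro mult_left_mono) auto
    then show ?thesis using assms by simp
  qed
  ultimately show ?thesis
    using qpoch_inf_pos'[of "a * q ^ n"] by (simp add: zero_less_mult_iff)
qed

lemma qpoch_le_1:
  assumes "0 \<le> a" "a < 1"
  shows "qpoch a q n \<le> 1"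
proof -
  have "a * q ^ i \<le> 1" for i
    using assms q_pos q_less_1 by (intro mult_le_one power_le_one) auto
  then show ?thesis
    unfolding qpoch_def using assms q_pos by (intro prod_le_1) auto
qed

lemma qpoch_inf_le_1:
  assumes "0 \<le> a" "a < 1"
  shows "qpoch_inf a q \<le> 1"
  by (rule LIMSEQ_le_const2[OF qpoch_tendsto]) (use assms qpoch_le_1 in blast)

lemma qpoch_inf_le_qpoch:
  assumes "0 \<le> a" "a < 1"
  shows "qpoch_inf a q \<le> qpoch a q n"
proof -
  have "a * q ^ n < 1"
    using assms q_pos q_less_1 power_le_one[of q n] mult_left_le[of "q ^ n" a] by linarith
  then have "qpoch_inf (a * q ^ n) q \<le> 1"
    using assms q_pos by (intro qpoch_inf_le_1) auto
  then show ?thesis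
    using qpoch_pos[OF assms(2), of n] by (subst qpoch_inf_split[of a n]) (simp add: mult_left_le)
qed

text \<open>For nonzero \<open>a\<close> this is (b/a; q)_n a^n / (q; q)_n. The homogeneous form
  also makes sense at \<open>a = 0\<close>, where it yields Euler's expansion, and scaling both
  parameters by \<open>t\<close> multiplies it by \<open>t ^ n\<close>.\<close>

definition qbin_term :: "real \<Rightarrow> real \<Rightarrow> nat \<Rightarrow> real" where
  "qbin_term a b n = (\<Prod>i<n. a - b * q ^ i) / qpoch q q n"

lemma qbin_term_0 [simp]: "qbin_term a b 0 = 1"
  by (simp add: qbin_term_def)

lemma qpoch_q_nz: "qpoch q q n \<noteq> 0"
  using qpoch_pos[OF q_less_1, of n] by simp

lemma one_minus_q_power_nz: "1 - q * q ^ n \<noteq> 0"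
proof -
  have "q * q ^ n < 1"
    using q_pos q_less_1 power_le_one[of q n] mult_left_le[of "q ^ n" q] by linarith
  then show ?thesis by simp
qed

lemma qbin_term_Suc: "qbin_term a b (Suc n) = (a - b * q ^ n) / (1 - q * q ^ n) * qbin_term a b n"
  by (simp add: qbin_term_def qpoch_Suc mult.commute)

lemma qbin_term_scale: "qbin_term (a * t) (b * t) n = qbin_term a b n * t ^ n"
  by (induction n) (simp_all add: qbin_term_Suc divide_simps, simp add: algebra_simps)

lemma summable_qbin_term:
  assumes "\<bar>a\<bar> < 1"
  shows "summable (\<lambda>n. \<bar>qbin_term a b n\<bar>)"
proof (rule summable_ratio_tendsto)
  show "qbin_term a b (Suc n) = (a - b * q ^ n) / (1 - q * q ^ n) * qbin_term a b n" for n
    by (rule qbin_term_Suc)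
  have "(\<lambda>n. (a - b * q ^ n) / (1 - q * q ^ n)) \<longlonglongrightarrow> (a - b * 0) / (1 - q * 0)"
    by (intro tendsto_intros q_power_tendsto_0) simp
  then show "(\<lambda>n. (a - b * q ^ n) / (1 - q * q ^ n)) \<longlonglongrightarrow> a"
    by simp
qed (use assms in simp)

lemma summable_qbin_term':
  assumes "\<bar>a\<bar> < 1"
  shows "summable (qbin_term a b)"
  using summable_qbin_term[OF assms, of b] by (rule summable_rabs_cancel)

lemma abs_mult_q_less_1:
  assumes "\<bar>a\<bar> < 1"
  shows "\<bar>a * q\<bar> < 1"
  using assms q_pos q_less_1 mult_left_le[of q "\<bar>a\<bar>"] by (simp add: abs_mult)

text \<open>Scaling both parameters by \<open>q\<close> multiplies term \<open>n\<close> by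
  \<open>q ^ n\<close>. In the difference of the two series the factor \<open>1 - q ^ n\<close>
  cancels the newest denominator and leaves a combination of the same two series.\<close>

lemma qbinomial_step:
  assumes "\<bar>a\<bar> < 1"
  shows "(1 - a) * suminf (qbin_term a b) = (1 - b) * suminf (qbin_term (a * q) (b * q))"
proof -
  let ?A = "qbin_term a b" and ?B = "qbin_term (a * q) (b * q)"
  have sA: "summable ?A" and sB: "summable ?B"
    using assms abs_mult_q_less_1[OF assms] summable_qbin_term' by blast+
  have B: "?B n = ?A n * q ^ n" for n
    by (rule qbin_term_scale)
  have rec: "?A (Suc n) - ?B (Suc n) = a * ?A n - b * ?B n" for n
  proof -
    have "?A (Suc n) - ?B (Suc n) = ?A (Suc n) * (1 - q * q ^ n)"
      by (simp add: B algebra_simps)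
    also have "\<dots> = (a - b * q ^ n) * ?A n"
      unfolding qbin_term_Suc using one_minus_q_power_nz[of n] by simp
    finally show ?thesis by (simp add: B algebra_simps)
  qed
  have "suminf ?A - suminf ?B = (\<Sum>n. ?A n - ?B n)"
    by (rule suminf_diff[OF sA sB])
  also have "\<dots> = (\<Sum>n. ?A (Suc n) - ?B (Suc n))"
    using suminf_split_head[OF summable_diff[OF sA sB]] by simp
  also have "\<dots> = (\<Sum>n. a * ?A n - b * ?B n)"
    by (simp only: rec)
  also have "\<dots> = a * suminf ?A - b * suminf ?B"
    using sA sB by (subst suminf_diff[symmetric]) (auto intro: summable_mult simp: suminf_mult)
  finally show ?thesis by (simp add: algebra_simps)
qed

text \<open>Iterating \<open>qbinomial_step\<close> relates \<open>F 0\<close> to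
  \<open>F n\<close>; the latter is a power series evaluated at \<open>q ^ n\<close>, so it tends to
  its constant term 1.\<close>

theorem qbinomial:
  assumes "\<bar>a\<bar> < 1"
  shows "suminf (qbin_term a b) = qpoch_inf b q / qpoch_inf a q"
proof -
  define F where "F n = suminf (qbin_term (a * q ^ n) (b * q ^ n))" for n
  have small: "\<bar>a * q ^ n\<bar> < 1" for n
  proof (induction n)
    case (Suc n)
    then show ?case
      using abs_mult_q_less_1[of "a * q ^ n"] by (simp only: power_Suc2 mult.assoc)
  qed (use assms in simp)
  have step: "qpoch a q n * F 0 = qpoch b q n * F n" for n
  proof (induction n)
    case (Suc n)
    have "qpoch a q (Suc n) * F 0 = qpoch b q n * ((1 - a * q ^ n) * F n)"
      using Suc by (simp add: qpoch_Suc mult_ac)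
    also have "(1 - a * q ^ n) * F n = (1 - b * q ^ n) * F (Suc n)"
      unfolding F_def using qbinomial_step[OF small, of n "b * q ^ n"] by (simp add: mult_ac)
    finally show ?case by (simp add: qpoch_Suc mult_ac)
  qed simp
  have "isCont (\<lambda>t. \<Sum>n. qbin_term a b n * t ^ n) 0"
    using isCont_powser[of "qbin_term a b" 1 0] summable_qbin_term'[OF assms] by simp
  then have "(\<lambda>m. \<Sum>n. qbin_term a b n * (q ^ m) ^ n) \<longlonglongrightarrow> (\<Sum>n. qbin_term a b n * 0 ^ n)"
    by (rule isCont_tendsto_compose[OF _ q_power_tendsto_0])
  then have "F \<longlonglongrightarrow> 1"
    unfolding F_def qbin_term_scale using powser_zero[of "qbin_term a b"] by simp
  then have "(\<lambda>n. qpoch b q n * F n) \<longlonglongrightarrow> qpoch_inf b q * 1"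
    by (intro tendsto_intros qpoch_tendsto)
  moreover have "(\<lambda>n. qpoch a q n * F 0) \<longlonglongrightarrow> qpoch_inf a q * F 0"
    by (intro tendsto_intros qpoch_tendsto)
  ultimately have "qpoch_inf a q * F 0 = qpoch_inf b q"
    unfolding step using LIMSEQ_unique by force
  moreover have "qpoch_inf a q > 0"
    using assms by (intro qpoch_inf_pos') auto
  ultimately show ?thesis
    by (simp add: F_def field_simps)
qed

section \<open>Euler's expansion and continuity of the infinite product\<close>

definition euler_coeff :: "nat \<Rightarrow> real" where
  "euler_coeff n = q ^ (n * (n - 1) div 2) / qpoch q q n"

lemma qbin_term_euler: "qbin_term 0 (- t) n = euler_coeff n * t ^ n"
proof (induction n)
  case (Suc n)
  then show ?case
    unfolding qbin_term_Suc euler_coeff_def triangle_Suc qpoch_Suc power_add by (simp add: mult_ac)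
qed (simp add: euler_coeff_def)

lemma euler_summable: "summable (\<lambda>n. \<bar>euler_coeff n * t ^ n\<bar>)"
  unfolding qbin_term_euler[symmetric] by (rule summable_qbin_term) simp

lemma qpoch_inf_0 [simp]: "qpoch_inf 0 q = 1"
  by (simp add: qpoch_inf_def)

lemma euler_sums: "(\<lambda>n. euler_coeff n * t ^ n) sums qpoch_inf (- t) q"
  using qbinomial[of 0 "- t"] summable_qbin_term'[of 0 "- t"]
  by (simp add: sums_iff flip: qbin_term_euler)

text \<open>Euler's expansion is an everywhere convergent power series, which gives continuity in
  the base parameter without uniform estimates on the product.\<close>

lemma isCont_qpoch_inf: "isCont (\<lambda>a. qpoch_inf a q) x"
proof -
  have "isCont (\<lambda>t. \<Sum>n. euler_coeff n * t ^ n) y" for y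
    using euler_sums by (intro isCont_powser_converges_everywhere) (auto simp: sums_iff)
  then have "isCont (\<lambda>t. qpoch_inf (- t) q) y" for y
    using euler_sums by (simp add: sums_iff)
  then have "isCont (\<lambda>t. qpoch_inf (- (- t)) q) x"
    by (rule isCont_o2[rotated]) (intro continuous_intros)
  then show ?thesis by simp
qed

lemma tendsto_qpoch_inf [tendsto_intros]:
  "(f \<longlongrightarrow> l) F \<Longrightarrow> ((\<lambda>x. qpoch_inf (f x) q) \<longlongrightarrow> qpoch_inf l q) F"
  by (rule isCont_tendsto_compose[OF isCont_qpoch_inf])

end

section \<open>Bilateral sums and Ramanujan's summation\<close>

lemma has_sum_diff:
  fixes f g :: "'a \<Rightarrow> real"
  assumes "(f has_sum S) A" "(g has_sum T) A"
  shows "((\<lambda>x. f x - g x) has_sum (S - T)) A"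
  using has_sum_add[OF assms(1), of "\<lambda>x. - g x" "- T"] assms(2)
  by (simp add: has_sum_uminus)

lemma has_sum_int_split:
  fixes f :: "int \<Rightarrow> real"
  assumes "((\<lambda>n. f (int n)) has_sum A) UNIV" "((\<lambda>n. f (- int (Suc n))) has_sum B) UNIV"
  shows "(f has_sum (A + B)) UNIV"
proof -
  have 1: "(f has_sum A) {0..}"
    using assms(1) by (subst has_sum_reindex_bij_witness[of _ int nat]) auto
  have 2: "(f has_sum B) {..<0}"
    using assms(2)
    by (subst has_sum_reindex_bij_witness[of _ "\<lambda>n. - int (Suc n)" "\<lambda>k. nat (- k - 1)"]) auto
  have "{0..} \<inter> {..<0} = ({} :: int set)" by auto
  from has_sum_Un_disjoint[OF 1 2 this] have "(f has_sum (A + B)) ({0..} \<union> {..<0})" .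
  moreover have "{0..} \<union> {..<0} = (UNIV :: int set)" by auto
  ultimately show ?thesis by (simp only:)
qed

lemma summable_on_nat_iff_abs:
  fixes f :: "nat \<Rightarrow> real"
  shows "f summable_on UNIV \<longleftrightarrow> summable (\<lambda>n. \<bar>f n\<bar>)"
proof -
  have "f summable_on UNIV \<longleftrightarrow> (\<lambda>n. \<bar>f n\<bar>) summable_on UNIV"
    by (subst summable_on_iff_abs_summable_on_real) simp
  also have "\<dots> \<longleftrightarrow> summable (\<lambda>n. \<bar>f n\<bar>)"
    by (rule summable_on_UNIV_nonneg_real_iff) simp
  finally show ?thesis .
qed

lemma summable_on_int_iff:
  fixes f :: "int \<Rightarrow> real"
  shows "f summable_on UNIV \<longleftrightarrow>
    summable (\<lambda>n. \<bar>f (int n)\<bar>) \<and> summable (\<lambda>n. \<bar>f (- int (Suc n))\<bar>)"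
    (is "_ \<longleftrightarrow> ?R")
proof
  assume f: "f summable_on UNIV"
  have "f summable_on range int" "f summable_on range (\<lambda>n. - int (Suc n))"
    by (rule summable_on_subset[OF f]; simp)+
  then have "(\<lambda>n. f (int n)) summable_on UNIV" "(\<lambda>n. f (- int (Suc n))) summable_on UNIV"
    by (subst (asm) summable_on_reindex; auto intro: inj_onI simp: o_def)+
  then show ?R
    by (simp only: summable_on_nat_iff_abs)
next
  assume ?R
  then show "f summable_on UNIV"
    unfolding summable_on_nat_iff_abs[symmetric]
    using has_sum_imp_summable[OF has_sum_int_split[OF has_sum_infsum has_sum_infsum]] by blast
qed

lemma summable_on_int_tendsto_0:
  fixes f :: "int \<Rightarrow> real"
  assumes "f summable_on UNIV"
  shows "(\<lambda>n. f (int n)) \<longlonglongrightarrow> 0" "(\<lambda>n. f (- int n)) \<longlonglongrightarrow> 0"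
proof -
  have *: "summable (\<lambda>n. \<bar>f (int n)\<bar>)" "summable (\<lambda>n. \<bar>f (- int (Suc n))\<bar>)"
    using assms by (simp_all only: summable_on_int_iff)
  have "(\<lambda>n. f (- int (Suc n))) \<longlonglongrightarrow> 0"
    by (rule summable_LIMSEQ_zero[OF summable_rabs_cancel[OF *(2)]])
  then show "(\<lambda>n. f (- int n)) \<longlonglongrightarrow> 0"
    by (rule LIMSEQ_imp_Suc)
  show "(\<lambda>n. f (int n)) \<longlonglongrightarrow> 0"
    by (rule summable_LIMSEQ_zero[OF summable_rabs_cancel[OF *(1)]])
qed

lemma has_sum_telescope_int:
  fixes Z :: "int \<Rightarrow> real"
  assumes "(\<lambda>k. Z (k + 1) - Z k) summable_on UNIV"
    and "(\<lambda>n. Z (int n)) \<longlonglongrightarrow> A" "(\<lambda>n. Z (- int n)) \<longlonglongrightarrow> B"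
  shows "((\<lambda>k. Z (k + 1) - Z k) has_sum (A - B)) UNIV"
proof -
  let ?f = "\<lambda>k. Z (k + 1) - Z k"
  have abs: "summable (\<lambda>n. norm (?f (int n)))" "summable (\<lambda>n. norm (?f (- int (Suc n))))"
    using assms(1) by (simp_all add: summable_on_int_iff)
  have "(\<lambda>n. Z (int (Suc n)) - Z (int n)) sums (A - Z (int 0))"
    by (rule telescope_sums[OF assms(2)])
  then have "(\<lambda>n. ?f (int n)) sums (A - Z 0)"
    by (simp add: add.commute)
  then have 1: "((\<lambda>n. ?f (int n)) has_sum (A - Z 0)) UNIV"
    by (rule norm_summable_imp_has_sum[OF abs(1)])
  have "(\<lambda>n. Z (- int n) - Z (- int (Suc n))) sums (Z (- int 0) - B)"
    by (rule telescope_sums'[OF assms(3)])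
  then have "(\<lambda>n. ?f (- int (Suc n))) sums (Z 0 - B)"
    by simp
  then have 2: "((\<lambda>n. ?f (- int (Suc n))) has_sum (Z 0 - B)) UNIV"
    by (rule norm_summable_imp_has_sum[OF abs(2)])
  show ?thesis
    using has_sum_int_split[OF 1 2] by simp
qed

lemma has_sum_int_shift:
  "((\<lambda>k::int. f (k + m)) has_sum S) UNIV \<longleftrightarrow> (f has_sum S) UNIV"
  by (rule has_sum_reindex_bij_witness[of _ "\<lambda>k. k - m" "\<lambda>k. k + m"]) auto

lemma has_sum_product:
  fixes X Y :: "_ \<Rightarrow> real"
  assumes "(X has_sum S) A" "(Y has_sum T) B"
  shows "((\<lambda>(k, j). X k * Y j) has_sum (S * T)) (A \<times> B)"
proof -
  have "(\<lambda>k. norm (X k)) summable_on A" "(\<lambda>j. norm (Y j)) summable_on B"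
    using assms has_sum_imp_summable summable_on_iff_abs_summable_on_real by blast+
  then have "(\<lambda>p. norm ((\<lambda>(k, j). X k * Y j) p)) summable_on A \<times> B"
    by (intro Infinite_Sum.abs_summable_on_Sigma_iff[THEN iffD2])
      (auto simp: abs_mult infsum_cmult_right' intro!: summable_on_cmult_left
          summable_on_cmult_right)
  then have "(\<lambda>(k, j). X k * Y j) summable_on A \<times> B"
    by (rule Infinite_Sum.abs_summable_summable)
  then show ?thesis
    by (rule has_sum_SigmaI[rotated 2])
      (use assms in \<open>auto intro!: has_sum_cmult_right has_sum_cmult_left\<close>)
qed

text \<open>Cauchy product of bilateral series: the absolutely convergent double sum is regrouped
  along \<open>n = k + j\<close>. It multiplies Laurent expansions below.\<close>

lemma has_sum_int_convolution:
  fixes X Y :: "int \<Rightarrow> real"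
  assumes "(X has_sum S) UNIV" "(Y has_sum T) UNIV"
  shows "(\<lambda>j. X (n - j) * Y j) summable_on UNIV"
    and "((\<lambda>n. \<Sum>\<^sub>\<infinity>j. X (n - j) * Y j) has_sum (S * T)) UNIV"
proof -
  have *: "((\<lambda>(n, j). X (n - j) * Y j) has_sum (S * T)) (UNIV \<times> UNIV)"
    using has_sum_product[OF assms]
    by (subst has_sum_reindex_bij_witness[of _ "\<lambda>(k, j). (k + j, j)" "\<lambda>(n, j). (n - j, j)"]) auto
  show s: "(\<lambda>j. X (n - j) * Y j) summable_on UNIV" for n
    using has_sum_imp_summable[OF *] by (rule summable_on_SigmaD1) simp
  show "((\<lambda>n. \<Sum>\<^sub>\<infinity>j. X (n - j) * Y j) has_sum (S * T)) UNIV"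
    using * by (rule has_sum_SigmaD) (use s in auto)
qed

section \<open>Laurent coefficients of the theta product\<close>

context q_param
begin

text \<open>Extension by zero to all integers lets bilateral sums be shifted freely;
  \<open>eul_rec\<close> then holds for every \<open>j\<close>, both sides being 0 at
  \<open>j = 0\<close>.\<close>

definition eul :: "int \<Rightarrow> real" where
  "eul j = (if j < 0 then 0 else euler_coeff (nat j))"

lemma q_nz: "q \<noteq> 0"
  using q_pos by simp

lemma euler_coeff_Suc: "euler_coeff (Suc n) * (1 - q * q ^ n) = q ^ n * euler_coeff n"
  unfolding euler_coeff_def triangle_Suc qpoch_Suc power_add
  using one_minus_q_power_nz[of n] by simp

lemma euler_coeff_nonneg: "euler_coeff n \<ge> 0"
  unfolding euler_coeff_def using q_pos qpoch_pos[OF q_less_1, of n] by simp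

lemma eul_nonneg: "eul j \<ge> 0"
  by (simp add: eul_def euler_coeff_nonneg)

lemma eul_rec: "eul j * (1 - q powi j) = q powi (j - 1) * eul (j - 1)"
proof (cases "j \<ge> 1")
  case True
  define n where "n = nat (j - 1)"
  have j: "j = int (Suc n)" "j - 1 = int n" using True by (auto simp: n_def)
  show ?thesis
    unfolding j(2) unfolding j(1) power_int_of_nat using euler_coeff_Suc[of n]
    by (simp add: eul_def del: of_nat_Suc)
next
  case False
  then have "j < 0 \<or> j = 0" by auto
  then show ?thesis by (auto simp: eul_def)
qed

lemma eul_has_sum: "((\<lambda>j. eul j * t powi j) has_sum qpoch_inf (- t) q) UNIV"
proof -
  have "((\<lambda>n. euler_coeff n * t ^ n) has_sum qpoch_inf (- t) q) UNIV"
    using euler_summable[of t] euler_sums by (intro norm_summable_imp_has_sum) auto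
  then have "((\<lambda>n. eul (int n) * t powi int n) has_sum qpoch_inf (- t) q) UNIV"
    by (simp add: eul_def)
  moreover have "((\<lambda>n. eul (- int (Suc n)) * t powi (- int (Suc n))) has_sum 0) UNIV"
    by (simp add: eul_def)
  ultimately show ?thesis
    using has_sum_int_split by fastforce
qed

text \<open>The Laurent coefficients of \<open>(-z, -q/z; q)\<^sub>\<infinity>\<close>; only their recurrence is needed, not their value.\<close>

definition theta_coeff :: "int \<Rightarrow> real" where
  "theta_coeff n = (\<Sum>\<^sub>\<infinity>j. eul (n + j) * eul j * q powi j)"

lemma eul_reflect_has_sum:
  "((\<lambda>j. eul (- j) * u powi j) has_sum qpoch_inf (- (1 / u)) q) UNIV"
  using eul_has_sum[of "1 / u"]
  by (subst has_sum_reindex_bij_witness[of _ uminus uminus])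
     (auto simp: power_int_minus power_int_divide_distrib field_simps)

lemma summable_eul_product:
  assumes "u \<noteq> 0"
  shows "(\<lambda>j. eul (n + j) * eul j * u powi j) summable_on UNIV"
proof -
  have "(\<lambda>j. eul (n - j) * 1 powi (n - j) * (eul (- j) * (1 / u) powi j)) summable_on UNIV"
    by (rule has_sum_int_convolution(1)[OF eul_has_sum eul_reflect_has_sum])
  then show ?thesis
    by (subst summable_on_reindex_bij_witness[of _ uminus uminus])
       (auto simp: power_int_minus power_int_divide_distrib field_simps)
qed

lemma theta_coeff_sum:
  assumes "z \<noteq> 0"
  shows "((\<lambda>n. z powi n * theta_coeff n) has_sum (qpoch_inf (- z) q
      * qpoch_inf (- (q / z)) q)) UNIV"
proof -
  have "((\<lambda>n. \<Sum>\<^sub>\<infinity>j. eul (n - j) * z powi (n - j) * (eul (- j) * (z / q) powi j))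
      has_sum (qpoch_inf (- z) q * qpoch_inf (- (1 / (z / q))) q)) UNIV"
    by (rule has_sum_int_convolution(2)[OF eul_has_sum eul_reflect_has_sum])
  moreover have "(\<Sum>\<^sub>\<infinity>j. eul (n - j) * z powi (n - j) * (eul (- j) * (z / q) powi j))
      = z powi n * theta_coeff n" for n
  proof -
    have "(\<Sum>\<^sub>\<infinity>j. eul (n - j) * z powi (n - j) * (eul (- j) * (z / q) powi j))
      = (\<Sum>\<^sub>\<infinity>j. z powi n * (eul (n + j) * eul j * q powi j))"
      using assms q_nz
      by (intro infsum_reindex_bij_witness[of _ uminus uminus])
         (auto simp: power_int_minus power_int_divide_distrib power_int_diff power_int_add
             field_simps)
    then show ?thesis
      unfolding theta_coeff_def by (simp add: infsum_cmult_right')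
  qed
  ultimately show ?thesis by simp
qed

text \<open>Coefficient form of theta(qz) = theta(z)/z for theta(z) = (-z, -q/z; q)_inf. It results
  from applying \<open>eul_rec\<close> to each of the two Euler factors in turn.\<close>

lemma theta_coeff_rec: "theta_coeff (n + 1) = q powi n * theta_coeff n"
proof -
  define T1 where "T1 j = q powi n * (eul (n + j) * eul j * (q * q) powi j)" for j
  define T2 where "T2 j = q powi (n + 1) * (eul (n + 1 + j) * eul j * (q * q) powi j)" for j
  have sT: "T1 summable_on UNIV" "T2 summable_on UNIV"
    unfolding T1_def T2_def using q_nz by (intro summable_on_cmult_right summable_eul_product; simp)+
  have pow: "(q * q) powi j = q powi j * q powi j" for j
    by (simp add: power_int_mult_distrib)
  have 1: "eul (n + 1 + j) * eul j * q powi j = T1 j + T2 j" for j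
  proof -
    have "eul (n + 1 + j) = q powi (n + j) * eul (n + j) + q powi (n + 1 + j) * eul (n + 1 + j)"
      using eul_rec[of "n + 1 + j"] by (simp add: algebra_simps)
    then have "eul (n + 1 + j) * eul j * q powi j =
       (q powi (n + j) * eul (n + j) + q powi (n + 1 + j) * eul (n + 1 + j)) * (eul j * q powi j)"
      by (metis mult.assoc)
    also have "\<dots> = T1 j + T2 j"
      using q_nz by (simp add: T1_def T2_def pow power_int_add algebra_simps)
    finally show ?thesis .
  qed
  \<comment> \<open>Shifting \<open>j\<close> by one lets \<open>eul_rec\<close> act on the second
    factor; the \<open>T1\<close> that is left over cancels the one produced by the first
    factor.\<close>
  have 2: "T2 (j + - 1) = q powi n * (eul (n + j) * eul j * q powi j) - T1 j" for j
  proof -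
    have "T2 (j + - 1) = q powi n * q powi j * eul (n + j) * (q powi (j - 1) * eul (j - 1))"
      using q_nz by (simp add: T2_def pow power_int_add power_int_diff field_simps)
    also have "\<dots> = q powi n * q powi j * eul (n + j) * (eul j * (1 - q powi j))"
      using eul_rec[of j] by simp
    finally show ?thesis
      by (simp add: T1_def pow algebra_simps)
  qed
  have "(T2 has_sum infsum T2 UNIV) UNIV"
    using sT by simp
  then have "((\<lambda>j. T2 (j + - 1)) has_sum infsum T2 UNIV) UNIV"
    by (simp only: has_sum_int_shift)
  moreover have "((\<lambda>j. T2 (j + - 1)) has_sum (q powi n * theta_coeff n - infsum T1 UNIV)) UNIV"
    unfolding 2 theta_coeff_def using sT summable_eul_product[OF q_nz, of n]
    by (intro has_sum_diff has_sum_cmult_right) auto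
  ultimately have "infsum T2 UNIV = q powi n * theta_coeff n - infsum T1 UNIV"
    by (rule has_sum_unique)
  moreover have "theta_coeff (n + 1) = infsum T1 UNIV + infsum T2 UNIV"
    unfolding theta_coeff_def 1 using sT by (rule infsum_add)
  ultimately show ?thesis by simp
qed

text \<open>All terms are nonnegative and the one at \<open>j = 0\<close> is 1. Positivity permits
  the division by \<open>theta_coeff 0\<close> in Ramanujan's sum.\<close>

lemma theta_coeff_pos: "theta_coeff 0 > 0"
proof -
  have "(\<Sum>j\<in>{0}. eul (0 + j) * eul j * q powi j) \<le> theta_coeff 0"
    unfolding theta_coeff_def using summable_eul_product[OF q_nz, of 0] q_pos
    by (intro finite_sum_le_infsum) (auto simp: eul_nonneg)
  then show ?thesis
    by (simp add: eul_def euler_coeff_def)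
qed

section \<open>Ramanujan's summation with lower parameter zero\<close>

context
  fixes c :: real
  assumes c_pos: "c > 0"
begin

private definition g :: "int \<Rightarrow> real" where
  "g k = 1 / qpoch_inf (- c * q powi k) q"

private lemma q_powi_pos: "q powi k > 0"
  using q_pos by simp

private lemma g_rec: "g (k + 1) = (1 + c * q powi k) * g k"
proof -
  have "1 + c * q powi k > 0"
    using c_pos q_powi_pos[of k] by (simp add: add_pos_pos)
  moreover have "qpoch_inf (- c * q powi k) q
      = (1 + c * q powi k) * qpoch_inf (- c * q powi (k + 1)) q"
    using qpoch_inf_rec[of "- c * q powi k"] q_nz by (simp add: power_int_add mult_ac)
  ultimately show ?thesis
    by (simp add: g_def)
qed

private lemma powi_Suc: "z powi int (Suc n) = z * z powi int n"
  by (simp only: power_int_of_nat power_Suc)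

private lemma g_tendsto_1: "(\<lambda>n. g (int n)) \<longlonglongrightarrow> 1"
proof -
  have "(\<lambda>n. 1 / qpoch_inf (- c * q ^ n) q) \<longlonglongrightarrow> 1 / qpoch_inf (- c * 0) q"
    by (intro tendsto_intros q_power_tendsto_0) simp
  then show ?thesis by (simp add: g_def)
qed

text \<open>To the right \<open>g\<close> tends to 1, so the ratio of terms tends to
  \<open>z\<close>; to the left the ratio is of order \<open>q ^ n\<close>, whatever
  \<open>z\<close> is.\<close>

private lemma g_summable:
  assumes "0 < z" "z < 1"
  shows "(\<lambda>k. z powi k * g k) summable_on UNIV"
  unfolding summable_on_int_iff
proof
  show "summable (\<lambda>n. \<bar>z powi int n * g (int n)\<bar>)"
  proof (rule summable_ratio_tendsto)
    show "z powi int (Suc n) * g (int (Suc n))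
        = (z * (1 + c * q ^ n)) * (z powi int n * g (int n))" for n
      using g_rec[of "int n"] unfolding powi_Suc by (simp add: mult_ac add.commute)
    have "(\<lambda>n. z * (1 + c * q ^ n)) \<longlonglongrightarrow> z * (1 + c * 0)"
      by (intro tendsto_intros q_power_tendsto_0)
    then show "(\<lambda>n. z * (1 + c * q ^ n)) \<longlonglongrightarrow> z" by simp
  qed (use assms in auto)
  show "summable (\<lambda>n. \<bar>z powi (- int (Suc n)) * g (- int (Suc n))\<bar>)"
  proof (rule summable_ratio_tendsto)
    fix n
    have *: "- int (Suc (Suc n)) + 1 = - int (Suc n)" by simp
    have 1: "g (- int (Suc n)) = (1 + c / (q * q * q ^ n)) * g (- int (Suc (Suc n)))"
      using g_rec[of "- int (Suc (Suc n))"] unfolding * power_int_minus power_int_of_nat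
      by (simp add: field_simps del: of_nat_Suc)
    have pos: "c + q * q * q ^ n > 0"
      using c_pos q_pos by (simp add: add_pos_pos)
    have "z powi (- int (Suc (Suc n))) = z powi (- int (Suc n)) / z"
      using assms unfolding power_int_minus power_int_of_nat by (simp add: divide_simps)
    moreover have "g (- int (Suc (Suc n))) = q * q * q ^ n / (c + q * q * q ^ n)
        * g (- int (Suc n))"
    proof -
      have "Q / (c + Q) * ((1 + c / Q) * G) = G" if "Q > 0" "c + Q > 0" for Q G :: real
      proof -
        have "1 + c / Q = (c + Q) / Q"
          using that by (simp add: add_divide_distrib)
        then show ?thesis using that by simp
      qed
      from this[of "q * q * q ^ n"] show ?thesis
        unfolding 1 using pos q_pos by simp
    qed
    ultimately show "z powi (- int (Suc (Suc n))) * g (- int (Suc (Suc n))) =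
        (1 / z * (q * q * q ^ n / (c + q * q * q ^ n))) * (z powi (- int (Suc n))
            * g (- int (Suc n)))"
      by simp
  next
    have "(\<lambda>n. 1 / z * (q * q * q ^ n / (c + q * q * q ^ n)))
        \<longlonglongrightarrow> 1 / z * (q * q * 0 / (c + q * q * 0))"
      using c_pos by (intro tendsto_intros q_power_tendsto_0) auto
    then show "(\<lambda>n. 1 / z * (q * q * q ^ n / (c + q * q * q ^ n))) \<longlonglongrightarrow> 0" by simp
  qed simp
qed

private lemma g_sum_q: "((\<lambda>k. q powi k * g k) has_sum (1 / c)) UNIV"
proof -
  have diff: "g (k + 1) - g k = c * (q powi k * g k)" for k
    unfolding g_rec by (simp add: algebra_simps)
  have s: "(\<lambda>k. q powi k * g k) summable_on UNIV"
    using q_pos q_less_1 by (rule g_summable)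
  have "(\<lambda>n. q ^ n * (q powi (- int n) * g (- int n))) \<longlonglongrightarrow> 0 * 0"
    by (intro tendsto_mult q_power_tendsto_0 summable_on_int_tendsto_0(2)[OF s])
  then have "(\<lambda>n. g (- int n)) \<longlonglongrightarrow> 0"
    using q_nz by (simp add: power_int_minus field_simps)
  then have "((\<lambda>k. g (k + 1) - g k) has_sum (1 - 0)) UNIV"
    using s g_tendsto_1
    by (intro has_sum_telescope_int) (auto simp: diff intro: summable_on_cmult_right)
  then have "((\<lambda>k. c * (q powi k * g k)) has_sum 1) UNIV"
    by (simp add: diff)
  from has_sum_cmult_right[OF this, of "1 / c"] show ?thesis
    using c_pos by simp
qed

text \<open>Laurent coefficients of (z; q)_inf times the series of \<open>z powi k * g k\<close>;
  the product clears the factor (z; q)_inf from the denominator of the closed form.\<close>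

private definition h :: "int \<Rightarrow> real" where
  "h n = (\<Sum>\<^sub>\<infinity>j. eul j * (- 1) powi j * g (n - j))"

private lemma conv_eq:
  assumes "z \<noteq> 0"
  shows "z powi (n - j) * g (n - j) * (eul j * (- z) powi j)
      = z powi n * (eul j * (- 1) powi j * g (n - j))"
proof -
  have "(- z) powi j = (- 1) powi j * z powi j"
    using power_int_mult_distrib[of "-1" z j] by simp
  then show ?thesis
    using assms by (simp add: power_int_diff)
qed

private lemma h_summable: "(\<lambda>j. eul j * (- 1) powi j * g (n - j)) summable_on UNIV"
proof -
  have "(\<lambda>j. q powi (n - j) * g (n - j) * (eul j * (- q) powi j)) summable_on UNIV"
    by (rule has_sum_int_convolution(1)[OF has_sum_infsum[OF g_summable[OF q_pos q_less_1]]
        eul_has_sum])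
  then show ?thesis
    unfolding conv_eq[OF q_nz] using q_nz by (simp add: summable_on_cmult_right')
qed

private lemma h_sum:
  assumes "0 < z" "z < 1"
  shows "((\<lambda>n. z powi n * h n) has_sum (infsum (\<lambda>k. z powi k * g k) UNIV * qpoch_inf z q)) UNIV"
proof -
  have "z \<noteq> 0" using assms by simp
  have "((\<lambda>n. \<Sum>\<^sub>\<infinity>j. z powi (n - j) * g (n - j) * (eul j * (- z) powi j)) has_sum
     (infsum (\<lambda>k. z powi k * g k) UNIV * qpoch_inf (- (- z)) q)) UNIV"
    using g_summable[OF assms] by (intro has_sum_int_convolution(2)[OF _ eul_has_sum]) auto
  then show ?thesis
    unfolding conv_eq[OF \<open>z \<noteq> 0\<close>] by (simp add: h_def infsum_cmult_right')
qed

text \<open>Coefficient form of F(z) = c z F(qz), which the theta product at \<open>c z\<close>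
  satisfies too. The recurrence of \<open>g\<close> yields it only up to a factor 1 - z, that is, as
  \<open>D n = D (n - 1)\<close>; a constant sequence \<open>D\<close> has to be excluded
  separately.\<close>

private lemma h_rec: "h (n + 1) = c * q powi n * h n"
proof -
  define D where "D n = h (n + 1) - c * q powi n * h n" for n
  have step: "D n = D (n - 1)" for n
  proof -
    define a where "a n j = eul j * (- 1) powi j * g (n - j)" for n j
    have hs: "(a n has_sum h n) UNIV" for n
      unfolding a_def h_def using h_summable by simp
    \<comment> \<open>By \<open>eul_rec\<close>,
      \<open>eul j / q powi j = eul j + eul (j - 1) / q\<close>. This turns the inverse power coming
      from \<open>g_rec\<close> into an index shift, and the alternating sign makes it a
      difference.\<close>
    have "a (n + 1) j = a n j + c * q powi n * (a n j - 1 / q * a (n - 1) (j + - 1))" for j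
    proof -
      have e: "eul (j - 1) = q * (eul j * (1 - q powi j)) / q powi j"
        using q_nz by (simp add: eul_rec power_int_diff)
      have m: "(- 1) powi (j - 1) = - ((- 1) powi j :: real)"
        by (simp add: power_int_diff)
      have g: "g (n + 1 - j) = (1 + c * (q powi n / q powi j)) * g (n - j)"
        using g_rec[of "n - j"] q_nz by (simp add: power_int_diff algebra_simps)
      have n: "n - 1 - (j + - 1) = n - j" "j + - 1 = j - 1" by auto
      have "a (n + 1) j = eul j * (- 1) powi j * (1 + c * (q powi n / q powi j)) * g (n - j)"
        unfolding a_def g by (simp only: mult.assoc)
      also have "\<dots> = a n j + c * q powi n * (a n j - 1 / q * a (n - 1) (j + - 1))"
        unfolding a_def n e m using q_nz by (simp add: field_simps)
      finally show ?thesis .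
    qed
    moreover have "((\<lambda>j. a n j + c * q powi n * (a n j - 1 / q * a (n - 1) (j + - 1))) has_sum
        (h n + c * q powi n * (h n - 1 / q * h (n - 1)))) UNIV"
      by (intro has_sum_add has_sum_cmult_right has_sum_diff hs has_sum_int_shift[THEN iffD2])
    ultimately have "h (n + 1) = h n + c * q powi n * (h n - 1 / q * h (n - 1))"
      using has_sum_unique[OF hs[of "n + 1"]] by presburger
    then show ?thesis
      unfolding D_def using q_nz by (simp add: power_int_diff field_simps)
  qed
  have const: "D n = D 0" for n
  proof (induction n rule: int_induct[where k = 0])
    case (step1 i)
    then show ?case using step[of "i + 1"] by simp
  next
    case (step2 i)
    then show ?case using step[of i] by simp
  qed simp
  have s: "(\<lambda>n. q powi n * h n) summable_on UNIV"
    using h_sum[OF q_pos q_less_1] by (rule has_sum_imp_summable)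
  \<comment> \<open>Convergence of the Laurent series at \<open>z = q\<close> forces the constant \<open>D\<close> to vanish at \<open>-\<infinity>\<close>.\<close>
  have "(\<lambda>n. q ^ n * (q powi (- int n) * h (- int n)) - c * (1 / q) * (q powi (- int (Suc n))
      * h (- int (Suc n))) * q)
     \<longlonglongrightarrow> 0 * 0 - c * (1 / q) * 0 * q"
    using s by (intro tendsto_intros q_power_tendsto_0 summable_on_int_tendsto_0(2)
        LIMSEQ_Suc[OF summable_on_int_tendsto_0(2)])
  moreover have "q ^ n * (q powi (- int n) * h (- int n)) - c * (1 / q) * (q powi (- int (Suc n))
      * h (- int (Suc n))) * q
      = D (- int (Suc n))" for n
    unfolding D_def using q_nz by (simp add: power_int_minus)
  ultimately have "(\<lambda>n. D (- int (Suc n))) \<longlonglongrightarrow> 0"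
    by simp
  moreover have "(\<lambda>n. D (- int (Suc n))) = (\<lambda>_. D n)"
    using const by metis
  ultimately have "D n = 0"
    by (simp only: LIMSEQ_const_iff)
  then show ?thesis
    unfolding D_def by (rule eq_iff_diff_eq_0[THEN iffD2])
qed

private lemma h_theta: "theta_coeff 0 * h n = h 0 * c powi n * theta_coeff n"
proof (induction n rule: int_induct[where k = 0])
  case (step1 i)
  then show ?case
    using c_pos by (simp add: h_rec theta_coeff_rec power_int_add)
next
  case (step2 i)
  have nz: "q powi (i - 1) \<noteq> 0" "c \<noteq> 0" using q_nz c_pos by auto
  have 1: "h i = c * q powi (i - 1) * h (i - 1)" "theta_coeff i
      = q powi (i - 1) * theta_coeff (i - 1)"
      "c powi i = c * c powi (i - 1)"
    using h_rec[of "i - 1"] theta_coeff_rec[of "i - 1"] nz by (auto simp: power_int_diff)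
  have "(c * q powi (i - 1)) * (theta_coeff 0 * h (i - 1)) =
      (c * q powi (i - 1)) * (h 0 * c powi (i - 1) * theta_coeff (i - 1))"
    using step2.IH unfolding 1 by (simp only: mult_ac)
  then show ?case
    using nz by (subst (asm) mult_left_cancel) auto
qed simp

text \<open>Since 1/(-c q^k; q)_inf = (-c; q)_k / (-c; q)_inf, this is the 1psi1 sum with lower
  parameter 0. By \<open>h_theta\<close> the series times (z; q)_inf is a multiple of the theta
  product at \<open>c z\<close>, so only the multiple has to be found.\<close>

theorem ramanujan_1psi1:
  assumes "0 < z" "z < 1"
  shows "((\<lambda>k. z powi k / qpoch_inf (- c * q powi k) q) has_sum
    (qpoch_inf q q * qpoch_inf (- c * z) q * qpoch_inf (- (q / (c * z))) q /
     (qpoch_inf z q * qpoch_inf (- c) q * qpoch_inf (- (q / c)) q))) UNIV"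
proof -
  define f where "f z = infsum (\<lambda>k. z powi k * g k) UNIV" for z
  have key: "theta_coeff 0 * (f z * qpoch_inf z q) =
      h 0 * (qpoch_inf (- (c * z)) q * qpoch_inf (- (q / (c * z))) q)" if "0 < z" "z < 1" for z
  proof (rule has_sum_unique)
    show "((\<lambda>n. theta_coeff 0 * (z powi n * h n))
        has_sum (theta_coeff 0 * (f z * qpoch_inf z q))) UNIV"
      unfolding f_def by (intro has_sum_cmult_right h_sum that)
    have "theta_coeff 0 * (z powi n * h n) = h 0 * ((c * z) powi n * theta_coeff n)" for n
      using h_theta[of n] by (simp add: power_int_mult_distrib)
    then show "((\<lambda>n. theta_coeff 0 * (z powi n * h n)) has_sum
       (h 0 * (qpoch_inf (- (c * z)) q * qpoch_inf (- (q / (c * z))) q))) UNIV"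
      using has_sum_cmult_right[OF theta_coeff_sum[of "c * z"], of "h 0"] c_pos that by simp
  qed
  \<comment> \<open>The constant is found at \<open>z = q\<close>, where the series telescopes.\<close>
  have fq: "f q = 1 / c"
    unfolding f_def using g_sum_q by (rule infsumI)
  have 1: "qpoch_inf (- (1 / c)) q = (1 + 1 / c) * qpoch_inf (- (q / c)) q"
    by (subst qpoch_inf_rec) simp
  have 2: "qpoch_inf (- c) q = (1 + c) * qpoch_inf (- (c * q)) q"
    by (subst qpoch_inf_rec) simp
  have 3: "q / (c * q) = 1 / c"
    using q_nz by simp
  have P: "qpoch_inf (- (c * q)) q * qpoch_inf (- (q / (c * q))) q =
      qpoch_inf (- c) q * qpoch_inf (- (q / c)) q / c"
    unfolding 1 2 3 using c_pos by (simp add: field_simps)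
  have pos: "qpoch_inf (- c) q > 0" "qpoch_inf (- (q / c)) q > 0" "qpoch_inf z q > 0"
    using c_pos q_pos assms divide_pos_pos[of q c] by (intro qpoch_inf_pos'; linarith)+
  have "theta_coeff 0 * qpoch_inf q q = h 0 * (qpoch_inf (- c) q * qpoch_inf (- (q / c)) q)"
    using key[OF q_pos q_less_1] c_pos unfolding P fq by (simp add: field_simps)
  then have h0: "h 0 = theta_coeff 0 * qpoch_inf q q / (qpoch_inf (- c) q
      * qpoch_inf (- (q / c)) q)"
    using pos by (intro nonzero_eq_divide_eq[THEN iffD2]) auto
  have "f z = qpoch_inf q q * qpoch_inf (- c * z) q * qpoch_inf (- (q / (c * z))) q /
     (qpoch_inf z q * qpoch_inf (- c) q * qpoch_inf (- (q / c)) q)"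
    using key[OF assms] theta_coeff_pos pos unfolding h0 by (simp add: divide_simps mult_ac)
  moreover have "((\<lambda>k. z powi k * g k) has_sum f z) UNIV"
    unfolding f_def using g_summable[OF assms] by simp
  ultimately show ?thesis
    by (simp add: g_def)
qed

end
end

section \<open>Eigenfunctions as entire functions of the spectral parameter\<close>

text \<open>
  Here \<open>b\<close> stands for \<open>q powr (\<alpha> + 1)\<close>, so that \<open>b / q\<close> is \<open>q powr \<alpha>\<close>. Substituting \<open>a = 1 / s\<close>
  turns \<open>phi11 a b q (- x * b / a)\<close> into \<open>phi x s\<close>, a Newton series in \<open>s\<close> with nodes \<open>q ^ i\<close>
  that is entire in \<open>s\<close>.
\<close>

locale qlag_param = q_param +
  fixes b c :: real
  assumes b_pos: "0 < b" and b_less_1: "b < 1" and c_pos: "0 < c"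
begin

definition newton :: "nat \<Rightarrow> real \<Rightarrow> real" where
  "newton j s = (\<Prod>i<j. s - q ^ i)"

definition phi_coeff :: "nat \<Rightarrow> real" where
  "phi_coeff j = q ^ (j * (j - 1) div 2) * b ^ j / (qpoch b q j * qpoch q q j)"

definition nseries :: "(nat \<Rightarrow> real) \<Rightarrow> real \<Rightarrow> real" where
  "nseries \<kappa> s = (\<Sum>j. \<kappa> j * newton j s)"

text \<open>Although stated for powers of \<open>y\<close>, the condition also controls Newton
  series, because \<open>newton_bound\<close> dominates \<open>newton j s\<close> by a
  power.\<close>

definition entire_coeff :: "(nat \<Rightarrow> real) \<Rightarrow> bool" where
  "entire_coeff \<kappa> \<longleftrightarrow> (\<forall>y. summable (\<lambda>j. \<bar>\<kappa> j * y ^ j\<bar>))"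

definition phi :: "real \<Rightarrow> real \<Rightarrow> real" where
  "phi x = nseries (\<lambda>j. phi_coeff j * x ^ j)"

text \<open>The \<open>q\<close>-derivative of \<open>phi x\<close> in the spectral parameter, see \<open>phi_diff\<close>.\<close>

definition dphi :: "real \<Rightarrow> real \<Rightarrow> real" where
  "dphi x = nseries (\<lambda>j. phi_coeff j * (q ^ j * b * x / (1 - b * q ^ j)) * x ^ j)"

lemma newton_0 [simp]: "newton 0 s = 1"
  by (simp add: newton_def)

lemma newton_Suc: "newton (Suc j) s = newton j s * (s - q ^ j)"
  by (simp add: newton_def)

text \<open>The nodes are geometric, so q s - q^(i+1) = q (s - q^i): scaling moves every node but
  the first to its predecessor.\<close>

lemma newton_Suc_scale: "newton (Suc j) (q * s) = (q * s - 1) * q ^ j * newton j s"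
proof (induction j)
  case (Suc j)
  have "newton (Suc (Suc j)) (q * s) = newton (Suc j) (q * s) * (q * s - q ^ Suc j)"
    by (rule newton_Suc)
  also have "\<dots> = (q * s - 1) * q ^ Suc j * (newton j s * (s - q ^ j))"
    unfolding Suc by (simp add: algebra_simps)
  finally show ?case by (simp add: newton_Suc)
qed (simp add: newton_Suc)

lemma newton_bound: "\<bar>newton j s\<bar> \<le> (1 + \<bar>s\<bar>) ^ j"
proof (induction j)
  case (Suc j)
  have "q ^ j \<le> 1" "q ^ j \<ge> 0"
    using q_pos q_less_1 by (auto intro: power_le_one)
  then have "\<bar>s - q ^ j\<bar> \<le> 1 + \<bar>s\<bar>" by linarith
  then have "\<bar>newton j s\<bar> * \<bar>s - q ^ j\<bar> \<le> (1 + \<bar>s\<bar>) ^ j * (1 + \<bar>s\<bar>)"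
    using Suc by (intro mult_mono) auto
  then show ?case by (simp add: newton_Suc abs_mult mult.commute)
qed simp

lemma one_minus_bq_pos: "1 - b * q ^ j > 0"
proof -
  have "b * q ^ j \<le> b"
    using b_pos q_pos q_less_1 by (simp add: mult_left_le power_le_one)
  then show ?thesis using b_less_1 by simp
qed

lemma phi_coeff_0 [simp]: "phi_coeff 0 = 1"
  by (simp add: phi_coeff_def)

lemma phi_coeff_Suc: "phi_coeff (Suc j) = q ^ j * b / ((1 - b * q ^ j) * (1 - q * q ^ j))
    * phi_coeff j"
  unfolding phi_coeff_def triangle_Suc qpoch_Suc power_add by (simp add: mult_ac)

lemma phi_coeff_ratio_tendsto: "(\<lambda>j. q ^ j * b / ((1 - b * q ^ j) * (1 - q * q ^ j)) * y) \<longlonglongrightarrow> 0"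
proof -
  have "(\<lambda>j. q ^ j * b / ((1 - b * q ^ j) * (1 - q * q ^ j)) * y)
      \<longlonglongrightarrow> 0 * b / ((1 - b * 0) * (1 - q * 0)) * y"
    by (intro tendsto_intros q_power_tendsto_0) simp
  then show ?thesis by simp
qed

lemma entire_phi_coeff: "entire_coeff phi_coeff"
  unfolding entire_coeff_def
proof
  fix y
  show "summable (\<lambda>j. \<bar>phi_coeff j * y ^ j\<bar>)"
    by (rule summable_ratio_tendsto[OF _ phi_coeff_ratio_tendsto[of y]]) (simp_all add:
        phi_coeff_Suc)
qed

lemma entire_coeff_scale:
  assumes "entire_coeff \<kappa>"
  shows "entire_coeff (\<lambda>j. \<kappa> j * x ^ j)"
  unfolding entire_coeff_def
proof
  fix y
  show "summable (\<lambda>j. \<bar>\<kappa> j * x ^ j * y ^ j\<bar>)"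
    using assms[unfolded entire_coeff_def, rule_format, of "x * y"]
        by (simp add: power_mult_distrib mult_ac)
qed

lemma entire_coeff_bounded_mult:
  assumes "entire_coeff \<kappa>" "\<And>j. \<bar>m j\<bar> \<le> M"
  shows "entire_coeff (\<lambda>j. \<kappa> j * m j)"
  unfolding entire_coeff_def
proof
  fix y
  show "summable (\<lambda>j. \<bar>\<kappa> j * m j * y ^ j\<bar>)"
  proof (rule summable_comparison_test')
    show "summable (\<lambda>j. M * \<bar>\<kappa> j * y ^ j\<bar>)"
      using assms(1) by (intro summable_mult) (simp add: entire_coeff_def)
    show "norm \<bar>\<kappa> j * m j * y ^ j\<bar> \<le> M * \<bar>\<kappa> j * y ^ j\<bar>" for j
      using mult_right_mono[OF assms(2)[of j], of "\<bar>\<kappa> j * y ^ j\<bar>"] by (simp add: abs_mult mult_ac)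
  qed
qed

lemma nseries_summable:
  assumes "entire_coeff \<kappa>"
  shows "summable (\<lambda>j. \<bar>\<kappa> j * newton j s\<bar>)"
proof (rule summable_comparison_test')
  show "summable (\<lambda>j. \<bar>\<kappa> j * (1 + \<bar>s\<bar>) ^ j\<bar>)"
    using assms by (simp add: entire_coeff_def)
  show "norm \<bar>\<kappa> j * newton j s\<bar> \<le> \<bar>\<kappa> j * (1 + \<bar>s\<bar>) ^ j\<bar>" for j
    using mult_left_mono[OF newton_bound[of j s], of "\<bar>\<kappa> j\<bar>"] by (simp add: abs_mult)
qed

lemma nseries_sums: "entire_coeff \<kappa> \<Longrightarrow> (\<lambda>j. \<kappa> j * newton j s) sums nseries \<kappa> s"
  unfolding nseries_def by (rule summable_sums[OF summable_rabs_cancel[OF nseries_summable]])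

lemma isCont_nseries:
  assumes "entire_coeff \<kappa>"
  shows "isCont (nseries \<kappa>) s"
proof -
  let ?R = "1 + \<bar>s\<bar>"
  have "uniform_limit (cball 0 ?R) (\<lambda>n s. \<Sum>j<n. \<kappa> j * newton j s) (\<lambda>s. \<Sum>j. \<kappa> j
      * newton j s) sequentially"
  proof (rule Weierstrass_m_test)
    show "norm (\<kappa> j * newton j s) \<le> \<bar>\<kappa> j * (1 + ?R) ^ j\<bar>" if "s \<in> cball 0 ?R" for j s
    proof -
      have "\<bar>newton j s\<bar> \<le> (1 + \<bar>s\<bar>) ^ j" by (rule newton_bound)
      also have "\<dots> \<le> (1 + ?R) ^ j" using that by (intro power_mono) auto
      finally have "\<bar>\<kappa> j\<bar> * \<bar>newton j s\<bar> \<le> \<bar>\<kappa> j\<bar> * (1 + ?R) ^ j"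
        by (intro mult_left_mono) auto
      then show ?thesis by (simp add: abs_mult)
    qed
    show "summable (\<lambda>j. \<bar>\<kappa> j * (1 + ?R) ^ j\<bar>)"
      using assms by (simp add: entire_coeff_def)
  qed
  then have "continuous_on (cball 0 ?R) (nseries \<kappa>)"
    unfolding nseries_def newton_def
    by (rule uniform_limit_theorem[rotated]) (auto intro!: always_eventually continuous_intros)
  then show ?thesis
    by (rule continuous_on_interior) (simp add: dist_norm)
qed

lemma entire_coeff_phi: "entire_coeff (\<lambda>j. phi_coeff j * x ^ j)"
  by (rule entire_coeff_scale[OF entire_phi_coeff])

lemma entire_coeff_dphi: "entire_coeff (\<lambda>j. phi_coeff j * (q ^ j * b * x / (1 - b * q ^ j)) * x ^ j)"
proof (intro entire_coeff_scale entire_coeff_bounded_mult[where M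
    = "\<bar>x\<bar> * b / (1 - b)"] entire_phi_coeff)
  fix j
  have q1: "q ^ j \<le> 1" "q ^ j \<ge> 0"
    using q_pos q_less_1 by (auto intro: power_le_one)
  have "b * q ^ j \<le> b"
    using q1 b_pos by (simp add: mult_left_le)
  then have "1 / (1 - b * q ^ j) \<le> 1 / (1 - b)"
    using b_less_1 by (intro divide_left_mono) auto
  then have "(\<bar>x\<bar> * b * q ^ j) * (1 / (1 - b * q ^ j)) \<le> (\<bar>x\<bar> * b * 1) * (1 / (1 - b))"
    using q1 b_pos one_minus_bq_pos[of j] by (intro mult_mono mult_left_mono) auto
  then show "\<bar>q ^ j * b * x / (1 - b * q ^ j)\<bar> \<le> \<bar>x\<bar> * b / (1 - b)"
    using q_pos b_pos one_minus_bq_pos[of j] by (simp add: abs_mult mult_ac)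
qed

lemmas phi_sums = nseries_sums[OF entire_coeff_phi, folded phi_def]
lemmas dphi_sums = nseries_sums[OF entire_coeff_dphi, folded dphi_def]
lemmas isCont_phi = isCont_nseries[OF entire_coeff_phi, folded phi_def]
lemmas isCont_dphi = isCont_nseries[OF entire_coeff_dphi, folded dphi_def]

text \<open>Each Newton polynomial satisfies \<open>newton (Suc j) s - newton (Suc j) (q * s) = (1 -
  q ^ Suc j) * s * newton j s\<close>, and \<open>1 - q ^ Suc j\<close> cancels in
  \<open>phi_coeff (Suc j)\<close>.\<close>

lemma phi_diff: "phi x s - phi x (q * s) = s * dphi x s"
proof (rule sums_unique2)
  have "(\<lambda>j. phi_coeff j * x ^ j * newton j s - phi_coeff j * x ^ j * newton j (q * s))
      sums (phi x s - phi x (q * s))"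
    by (intro sums_diff phi_sums)
  then show "(\<lambda>j. phi_coeff (Suc j) * x ^ Suc j * newton (Suc j) s - phi_coeff (Suc j) * x ^ Suc j
      * newton (Suc j) (q * s))
     sums (phi x s - phi x (q * s))"
    by (rule sums_drop_0) simp
  have "phi_coeff (Suc j) * x ^ Suc j * newton (Suc j) s - phi_coeff (Suc j) * x ^ Suc j
      * newton (Suc j) (q * s) =
     s * (phi_coeff j * (q ^ j * b * x / (1 - b * q ^ j)) * x ^ j * newton j s)" for j
  proof -
    have "phi_coeff (Suc j) * x ^ Suc j * newton (Suc j) s - phi_coeff (Suc j) * x ^ Suc j
        * newton (Suc j) (q * s) =
       phi_coeff (Suc j) * (1 - q * q ^ j) * x ^ Suc j * s * newton j s"
      unfolding newton_Suc_scale unfolding newton_Suc by (simp add: algebra_simps)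
    also have "phi_coeff (Suc j) * (1 - q * q ^ j) = phi_coeff j * (q ^ j * b / (1 - b * q ^ j))"
      unfolding phi_coeff_Suc using one_minus_q_power_nz[of j] by simp
    finally show ?thesis by simp
  qed
  then show "(\<lambda>j. phi_coeff (Suc j) * x ^ Suc j * newton (Suc j) s - phi_coeff (Suc j) * x ^ Suc j
      * newton (Suc j) (q * s))
     sums (s * dphi x s)"
    using sums_mult[OF dphi_sums, of s] by simp
qed

text \<open>With \<open>phi_diff\<close> this is the second order equation in \<open>s\<close> as a
  first order system. It holds term by term, since
  \<open>(s - 1) * newton j (s / q) = (s / q ^ j - 1) * newton j s\<close>.\<close>

lemma dphi_diff: "(s - 1) * dphi x (s / q) + (1 - b * s) * dphi x s = s * (b * x * phi x s)"
proof (rule sums_unique2)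
  let ?k = "\<lambda>j. phi_coeff j * (q ^ j * b * x / (1 - b * q ^ j)) * x ^ j"
  show "(\<lambda>j. (s - 1) * (?k j * newton j (s / q)) + (1 - b * s) * (?k j * newton j s)) sums
     ((s - 1) * dphi x (s / q) + (1 - b * s) * dphi x s)"
    by (intro sums_add sums_mult dphi_sums)
  have "(s - 1) * (?k j * newton j (s / q)) + (1 - b * s) * (?k j * newton j s)
      = s * (b * x * (phi_coeff j * x ^ j * newton j s))" for j
  proof -
    have "q * (s / q) = s"
      using q_nz by simp
    then have "newton j s * (s - q ^ j) = (s - 1) * q ^ j * newton j (s / q)"
      using newton_Suc_scale[of j "s / q"] by (simp only: newton_Suc)
    then have "(s - 1) * newton j (s / q) = newton j s * (s - q ^ j) / q ^ j"
      using q_nz by simp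
    also have "\<dots> = (s / q ^ j - 1) * newton j s"
      using q_nz by (simp add: field_simps)
    finally have *: "(s - 1) * newton j (s / q) = (s / q ^ j - 1) * newton j s" .
    have "(s - 1) * (?k j * newton j (s / q)) = ?k j * ((s / q ^ j - 1) * newton j s)"
      by (simp only: mult.left_commute[of "s - 1"] *)
    then have "(s - 1) * (?k j * newton j (s / q)) + (1 - b * s) * (?k j * newton j s) =
       ?k j * ((s / q ^ j - 1) * newton j s) + (1 - b * s) * (?k j * newton j s)"
      by simp
    also have "\<dots> = ?k j * (1 - b * q ^ j) / q ^ j * s * newton j s"
    proof -
      have "K * ((s / T - 1) * E) + (1 - b * s) * (K * E) = K * (1 - b * T) / T * s * E"
        if "T \<noteq> 0" for K T E :: real
        using that by (simp add: field_simps)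
      from this[OF power_not_zero[OF q_nz]] show ?thesis .
    qed
    also have "?k j * (1 - b * q ^ j) / q ^ j = b * x * (phi_coeff j * x ^ j)"
      using one_minus_bq_pos[of j] q_nz by simp
    finally show ?thesis by simp
  qed
  then show "(\<lambda>j. (s - 1) * (?k j * newton j (s / q)) + (1 - b * s) * (?k j * newton j s)) sums
     (s * (b * x * phi x s))"
    using sums_mult[OF sums_mult[OF phi_sums], of s "b * x"] by simp
qed

text \<open>With \<open>1 + x\<close> replaced by 1, the left side multiplies \<open>x ^ j\<close>
  by \<open>(1 / q ^ j - 1) * (1 - b / q * q ^ j)\<close>. At \<open>Suc j\<close> this cancels the
  new denominators of \<open>phi_coeff (Suc j)\<close>, so the series shifts by one index; the
  remaining part with \<open>x\<close> is moved over at the end.\<close>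

lemma phi_recurrence:
  "phi (x / q) s - phi x s + b / q * (1 + x) * (phi (q * x) s - phi x s)
      = - (b / q) * (1 - s) * x * phi x s"
proof -
  let ?f = "\<lambda>j. phi_coeff j * newton j s"
  have ps: "(\<lambda>j. ?f j * x ^ j) sums phi x s" for x
    using phi_sums[of x s] by (simp add: mult_ac)
  have 1: "(\<lambda>j. ?f j * x ^ j * ((1 / q ^ j - 1) * (1 - b / q * q ^ j))) sums
     (phi (x / q) s - phi x s + b / q * (phi (q * x) s - phi x s))"
  proof -
    have "(\<lambda>j. ?f j * (x / q) ^ j - ?f j * x ^ j + b / q * (?f j * (q * x) ^ j - ?f j * x ^ j)) sums
      (phi (x / q) s - phi x s + b / q * (phi (q * x) s - phi x s))"
      by (intro sums_add sums_diff sums_mult ps)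
    moreover have "?f j * (x / q) ^ j - ?f j * x ^ j + b / q * (?f j * (q * x) ^ j - ?f j * x ^ j) =
        ?f j * x ^ j * ((1 / q ^ j - 1) * (1 - b / q * q ^ j))" for j
      using q_nz by (simp add: power_divide power_mult_distrib field_simps)
    ultimately show ?thesis by simp
  qed
  have 2: "(\<lambda>j. - (b / q) * x * (?f j * x ^ j * (q ^ j - s))) sums
     (phi (x / q) s - phi x s + b / q * (phi (q * x) s - phi x s))"
  proof -
    have "?f (Suc j) * x ^ Suc j * ((1 / q ^ Suc j - 1) * (1 - b / q * q ^ Suc j)) =
       - (b / q) * x * (?f j * x ^ j * (q ^ j - s))" for j
    proof -
      have "phi_coeff (Suc j) * (1 - b * q ^ j) * (1 - q * q ^ j) = q ^ j * b * phi_coeff j"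
        unfolding phi_coeff_Suc using one_minus_bq_pos[of j] one_minus_q_power_nz[of j] by simp
      then have "phi_coeff (Suc j) * (1 - b * q ^ j) * (1 - q * q ^ j) * (newton (Suc j) s
          * x ^ Suc j / q ^ Suc j) =
         q ^ j * b * phi_coeff j * (newton (Suc j) s * x ^ Suc j / q ^ Suc j)"
        by simp
      moreover have "?f (Suc j) * x ^ Suc j * ((1 / q ^ Suc j - 1) * (1 - b / q * q ^ Suc j)) =
        phi_coeff (Suc j) * (1 - b * q ^ j) * (1 - q * q ^ j) * (newton (Suc j) s
            * x ^ Suc j / q ^ Suc j)"
        using q_nz by (simp add: field_simps)
      moreover have "q ^ j * b * phi_coeff j * (newton (Suc j) s * x ^ Suc j / q ^ Suc j) =
        - (b / q) * x * (?f j * x ^ j * (q ^ j - s))"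
        using q_nz by (simp add: newton_Suc field_simps)
      ultimately show ?thesis by simp
    qed
    \<comment> \<open>The term of index 0 carries the factor \<open>1 / q ^ 0 - 1\<close>, which is
      0.\<close>
    then show ?thesis
      using sums_drop_0[OF 1] by simp
  qed
  have "(\<lambda>j. - (b / q) * x * (?f j * (q * x) ^ j - s * (?f j * x ^ j))) sums
     (- (b / q) * x * (phi (q * x) s - s * phi x s))"
    by (intro sums_mult sums_diff ps)
  moreover have "?f j * (q * x) ^ j - s * (?f j * x ^ j) = ?f j * x ^ j * (q ^ j - s)" for j
    by (simp add: power_mult_distrib algebra_simps)
  ultimately have "- (b / q) * x * (phi (q * x) s - s * phi x s) =
     phi (x / q) s - phi x s + b / q * (phi (q * x) s - phi x s)"
    using 2 sums_unique2 by (metis (no_types, lifting) sums_cong)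
  then show ?thesis
    by (simp add: algebra_simps add_divide_distrib diff_divide_distrib)
qed

lemma qpoch_inverse_power: "s \<noteq> 0 \<Longrightarrow> qpoch (1 / s) q j * s ^ j = newton j s"
  by (induction j) (simp_all add: qpoch_Suc newton_Suc field_simps)

lemma phi11_eq_phi:
  assumes "s \<noteq> 0"
  shows "phi11 (1 / s) b q (- (x * b * s)) = phi x s"
proof -
  have "qpoch (1 / s) q j / (qpoch b q j * qpoch q q j) * (- 1) ^ j * q ^ (j * (j - 1) div 2)
      * (- (x * b * s)) ^ j
      = phi_coeff j * x ^ j * newton j s" for j
  proof -
    have "(- (x * b * s)) ^ j = (- 1) ^ j * (x ^ j * b ^ j * s ^ j)"
      by (metis mult_minus1 power_mult_distrib)
    moreover have "(- 1) ^ j * (- 1 :: real) ^ j = 1"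
      by (simp flip: power_mult_distrib)
    ultimately show ?thesis
      unfolding phi_coeff_def qpoch_inverse_power[OF assms, symmetric] by (simp add: field_simps)
  qed
  then show ?thesis
    unfolding phi11_def phi_def nseries_def by simp
qed

lemma phi_deriv_0: "((\<lambda>x. phi x s) has_field_derivative phi_coeff 1 * newton 1 s) (at 0)"
proof -
  have "((\<lambda>x. \<Sum>j. (phi_coeff j * newton j s) * x ^ j) has_field_derivative (\<Sum>j. diffs (\<lambda>j.
      phi_coeff j * newton j s) j * 0 ^ j)) (at 0)"
  proof (rule termdiffs_strong_converges_everywhere)
    show "summable (\<lambda>j. phi_coeff j * newton j s * y ^ j)" for y
      using phi_sums[of y s] by (simp add: sums_iff mult_ac)
  qed
  then show ?thesis
    unfolding powser_zero by (simp add: phi_def nseries_def diffs_def mult_ac)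
qed

lemma phi_0 [simp]: "phi 0 s = 1"
proof -
  have "phi 0 s = (\<Sum>j. (phi_coeff j * newton j s) * 0 ^ j)"
    by (simp add: phi_def nseries_def mult_ac)
  then show ?thesis
    unfolding powser_zero by simp
qed

end

section \<open>Decay along the negative spectrum\<close>

context q_param
begin

text \<open>For \<open>i \<le> 0\<close> the product contains the factor \<open>1 - q ^ 0\<close>;
  for positive \<open>i\<close> all its factors lie between 0 and 1.\<close>

lemma qpoch_inf_powi_bounds: "qpoch_inf (q powi i) q \<in> {0..1}"
  and qpoch_inf_powi_eq_0: "i \<le> 0 \<Longrightarrow> qpoch_inf (q powi i) q = 0"
proof -
  show 0: "qpoch_inf (q powi i) q = 0" if "i \<le> 0" for i
  proof -
    have "q powi i * q ^ nat (- i) = 1"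
      using that q_nz by (simp add: power_int_def field_simps)
    then show ?thesis
      using qpoch_inf_split[of "q powi i" "nat (- i)"] by simp
  qed
  show "qpoch_inf (q powi i) q \<in> {0..1}"
  proof (cases "i \<le> 0")
    case False
    then have "q powi i = q ^ Suc (nat (i - 1))"
      by (simp add: power_int_def nat_diff_distrib flip: power_Suc)
    then have "0 \<le> q powi i" "q powi i < 1"
      using q_pos q_less_1 power_Suc_less_one[of q "nat (i - 1)"] by auto
    then show ?thesis
      using qpoch_inf_le_1 qpoch_inf_pos' less_imp_le by auto
  qed (simp add: 0)
qed

end

context qlag_param
begin

text \<open>
  At the lattice and spectral points the argument of \<open>qpoch_inf\<close> below is an integer power of \<open>q\<close>,
  so that all terms of small index vanish; this is where the decay of \<open>phi\<close> comes from.
\<close>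

lemma phi_transform:
  assumes "s \<noteq> 0" "\<bar>1 / s\<bar> < 1"
  shows "((\<lambda>n. qbin_term (1 / s) b n * qpoch_inf (- (x * b * s) * q ^ n) q)
    has_sum (qpoch_inf b q / qpoch_inf (1 / s) q * phi x s)) UNIV"
proof -
  define a where "a = 1 / s"
  define t where "t = x * b * s"
  have a1: "\<bar>a\<bar> < 1" using assms(2) by (simp add: a_def)
  then have "a < 1" by (simp add: abs_less_iff)
  note a = a1 this
  \<comment> \<open>Summed over \<open>j\<close> first, this double series gives Euler's expansion
    of the infinite product in the claim; summed over \<open>n\<close> first, it gives the
    q-binomial theorem at \<open>a * q ^ j\<close> and \<open>b * q ^ j\<close>. Absolute
    convergence permits the exchange.\<close>
  define F where "F = (\<lambda>(n, j). qbin_term a b n * (euler_coeff j * (t * q ^ n) ^ j))"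
  have hs_nat: "(f has_sum suminf f) UNIV" if "summable (\<lambda>n. \<bar>f n\<bar>)" for f :: "nat \<Rightarrow> real"
    using norm_summable_imp_has_sum[OF _ summable_sums[OF summable_rabs_cancel[OF that]]] that by simp
  have F: "F summable_on UNIV \<times> UNIV"
  proof (rule Infinite_Sum.abs_summable_summable, rule Infinite_Sum.abs_summable_on_comparison_test)
    have "(\<lambda>(n, j). qbin_term a b n * (euler_coeff j * t ^ j)) summable_on UNIV \<times> UNIV"
      using has_sum_product[OF hs_nat[OF summable_qbin_term[OF a(1)]] hs_nat[OF euler_summable]]
      by (rule has_sum_imp_summable)
    then show "(\<lambda>p. norm ((\<lambda>(n, j). qbin_term a b n * (euler_coeff j * t ^ j)) p))
        summable_on UNIV \<times> UNIV"
      by (rule summable_on_iff_abs_summable_on_real[THEN iffD1])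
    show "norm (F p) \<le> norm ((\<lambda>(n, j). qbin_term a b n * (euler_coeff j * t ^ j)) p)" for p
    proof -
      obtain n j where p: "p = (n, j)" by force
      have "(q ^ n) ^ j \<le> 1"
        using q_pos q_less_1 by (intro power_le_one) auto
      then have "\<bar>qbin_term a b n * (euler_coeff j * t ^ j)\<bar> * (q ^ n) ^ j \<le>
          \<bar>qbin_term a b n * (euler_coeff j * t ^ j)\<bar> * 1"
        by (intro mult_left_mono) auto
      then show ?thesis
        using q_pos unfolding p F_def by (simp add: abs_mult power_mult_distrib mult_ac)
    qed
  qed
  then obtain S where S: "(F has_sum S) (UNIV \<times> UNIV)"
    by (auto simp: summable_on_def)
  have 1: "((\<lambda>n. qbin_term a b n * qpoch_inf (- t * q ^ n) q) has_sum S) UNIV"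
  proof (rule has_sum_SigmaD[OF S])
    fix n
    have "((\<lambda>j. euler_coeff j * (t * q ^ n) ^ j) has_sum qpoch_inf (- (t * q ^ n)) q) UNIV"
      using euler_summable euler_sums by (intro norm_summable_imp_has_sum) auto
    then show "((\<lambda>j. F (n, j)) has_sum qbin_term a b n * qpoch_inf (- t * q ^ n) q) UNIV"
      unfolding F_def by (simp add: has_sum_cmult_right)
  qed
  have "((\<lambda>j. qpoch_inf b q / qpoch_inf a q * (phi_coeff j * x ^ j * newton j s)) has_sum S) UNIV"
  proof (rule has_sum_SigmaD[OF S[THEN has_sum_swap[THEN iffD1]]])
    fix j
    have small: "\<bar>a * q ^ j\<bar> < 1"
    proof -
      have "\<bar>a\<bar> * q ^ j \<le> \<bar>a\<bar>"
        using q_pos q_less_1 by (intro mult_left_le power_le_one) auto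
      then show ?thesis using a q_pos by (simp add: abs_mult)
    qed
    have "(qbin_term (a * q ^ j) (b * q ^ j) has_sum (qpoch_inf (b * q ^ j) q / qpoch_inf (a
        * q ^ j) q)) UNIV"
      using hs_nat[OF summable_qbin_term[OF small]] qbinomial[OF small] by simp
    then have "((\<lambda>n. qbin_term a b n * (q ^ j) ^ n)
        has_sum (qpoch_inf (b * q ^ j) q / qpoch_inf (a * q ^ j) q)) UNIV"
      by (rule has_sum_cong[THEN iffD1, rotated]) (rule qbin_term_scale)
    then have "((\<lambda>n. euler_coeff j * t ^ j * (qbin_term a b n * (q ^ j) ^ n)) has_sum
        euler_coeff j * t ^ j * (qpoch_inf (b * q ^ j) q / qpoch_inf (a * q ^ j) q)) UNIV"
      by (rule has_sum_cmult_right)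
    moreover have "euler_coeff j * t ^ j * (qbin_term a b n * (q ^ j) ^ n)
        = (case (j, n) of (j, n) \<Rightarrow> F (n, j))" for n
      by (simp add: F_def power_mult_distrib power_mult[symmetric] mult_ac)
    moreover have "euler_coeff j * t ^ j * (qpoch_inf (b * q ^ j) q / qpoch_inf (a * q ^ j) q) =
        qpoch_inf b q / qpoch_inf a q * (phi_coeff j * x ^ j * newton j s)"
    proof -
      have "qpoch_inf (b * q ^ j) q = qpoch_inf b q / qpoch b q j"
        using qpoch_inf_split[of b j] qpoch_pos[OF b_less_1, of j] by simp
      moreover have "qpoch_inf (a * q ^ j) q = qpoch_inf a q / qpoch a q j"
        using qpoch_inf_split[of a j] qpoch_pos[OF a(2), of j] by simp
      moreover have "phi_coeff j * x ^ j * newton j s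
          = euler_coeff j * t ^ j * qpoch a q j / qpoch b q j"
        unfolding phi_coeff_def euler_coeff_def t_def a_def
        using qpoch_inverse_power[OF assms(1), of j, symmetric]
            by (simp add: power_mult_distrib mult_ac)
      ultimately show ?thesis by (simp add: mult_ac)
    qed
    ultimately show "((\<lambda>n. case (j, n) of (j, n) \<Rightarrow> F (n, j)) has_sum
        qpoch_inf b q / qpoch_inf a q * (phi_coeff j * x ^ j * newton j s)) UNIV"
      by simp
  qed
  moreover have "((\<lambda>j. phi_coeff j * x ^ j * newton j s) has_sum phi x s) UNIV"
    using phi_sums nseries_summable[OF entire_coeff_phi]
    by (intro norm_summable_imp_has_sum) auto
  ultimately have "S = qpoch_inf b q / qpoch_inf a q * phi x s"
    by (intro has_sum_unique[OF _ has_sum_cmult_right])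
  then show ?thesis
    using 1 by (simp add: a_def t_def)
qed

definition xk :: "int \<Rightarrow> real" where "xk k = c * q powi k"

text \<open>Chosen so that \<open>- (xk k * b * (s0 * q powi p))\<close> equals
  \<open>q powi (k + p + 1)\<close>. For b = q^(\<alpha>+1) its reciprocal is -c q^\<alpha>, the
  upper parameter in \<open>qM\<close> of index 0.\<close>

definition s0 :: real where "s0 = - (q / (c * b))"

lemma s0_neg: "s0 < 0"
  unfolding s0_def using c_pos b_pos q_pos by simp

lemma xk_pos: "xk k > 0"
  unfolding xk_def using c_pos q_pos by simp

lemma xk_Suc: "xk (k + 1) = q * xk k"
  unfolding xk_def using q_nz by (simp add: power_int_add)

text \<open>Only the first \<open>m\<close> factors may exceed \<open>r\<close>, and each of them
  costs one extra \<open>K\<close>.\<close>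

lemma prod_geometric_bound:
  fixes f :: "nat \<Rightarrow> real"
  assumes "\<And>i. i < m \<Longrightarrow> \<bar>f i\<bar> \<le> K * r" "\<And>i. i \<ge> m \<Longrightarrow> \<bar>f i\<bar> \<le> r" "K \<ge> 1" "r \<ge> 0"
  shows "\<bar>\<Prod>i<n. f i\<bar> \<le> K ^ m * r ^ n"
proof -
  have "\<bar>\<Prod>i<n. f i\<bar> \<le> K ^ (min n m) * r ^ n"
  proof (induction n)
    case (Suc n)
    have "\<bar>\<Prod>i<Suc n. f i\<bar> = \<bar>\<Prod>i<n. f i\<bar> * \<bar>f n\<bar>"
      by (simp add: abs_mult)
    also have "\<dots> \<le> K ^ min n m * r ^ n * (if n < m then K * r else r)"
      using Suc assms by (intro mult_mono) auto
    also have "\<dots> = K ^ min (Suc n) m * r ^ Suc n"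
      by (auto simp: min_def Suc_le_eq le_less_Suc_eq)
    finally show ?case .
  qed simp
  also have "\<dots> \<le> K ^ m * r ^ n"
    using assms by (intro mult_right_mono power_increasing) auto
  finally show ?thesis .
qed

text \<open>At \<open>s0 / q ^ P\<close> the transformed series has no terms below index P - k. A
  surviving \<open>qbin_term\<close> is a product of at least that many factors, all but a number
  independent of \<open>P\<close> below \<open>\<rho> / 2\<close>. Hence every geometric rate is
  reached.\<close>

lemma phi_decay_bound:
  assumes "0 < \<rho>" "\<rho> \<le> 1"
  shows "\<exists>C. \<forall>\<^sub>F P in sequentially. \<bar>phi (xk k) (s0 / q ^ P)\<bar> \<le> C * \<rho> ^ P"
proof -
  define a where "a P = 1 / (s0 / q ^ P)" for P
  have a_eq: "a P = - (c * b / q * q ^ P)" for P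
    unfolding a_def s0_def using q_nz by simp
  have a_lim: "a \<longlonglongrightarrow> 0"
  proof -
    have "(\<lambda>P. - (c * b / q * q ^ P)) \<longlonglongrightarrow> - (c * b / q * 0)"
      by (intro tendsto_intros q_power_tendsto_0)
    then show ?thesis by (simp add: a_eq[abs_def])
  qed
  have "(\<lambda>P. qpoch_inf (a P) q) \<longlonglongrightarrow> qpoch_inf 0 q"
    by (intro tendsto_intros a_lim)
  then have ev1: "\<forall>\<^sub>F P in sequentially. qpoch_inf (a P) q < 2"
    by (rule order_tendstoD) simp
  have "(\<lambda>P. \<bar>a P\<bar>) \<longlonglongrightarrow> \<bar>0\<bar>"
    by (intro tendsto_intros a_lim)
  then have ev2: "\<forall>\<^sub>F P in sequentially. \<bar>a P\<bar> < 1"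
    by (rule order_tendstoD) simp
  \<comment> \<open>Because \<open>r ^ n = \<rho> ^ n * (1 / 2) ^ n\<close>, the half makes the
    surviving terms summable while \<open>\<rho>\<close> supplies the decay.\<close>
  define r where "r = \<rho> / 2"
  define K where "K = c * b * q powi (k - 1) + b"
  have K: "K > 0" unfolding K_def using b_pos c_pos q_pos by (simp add: add_pos_pos)
  have r: "r > 0" using assms by (simp add: r_def)
  have "(\<lambda>m. K * q ^ m) \<longlonglongrightarrow> K * 0"
    by (intro tendsto_intros q_power_tendsto_0)
  then have "\<forall>\<^sub>F m in sequentially. K * q ^ m < r"
    using r by (intro order_tendstoD) auto
  \<comment> \<open>This \<open>m\<close> is independent of \<open>P\<close>: once \<open>i\<close>
    and \<open>N\<close> are at least \<open>m\<close>, the factor of index \<open>i\<close> is at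
    most \<open>K * q ^ m\<close>.\<close>
  then obtain m where m: "K * q ^ m < r"
    by (auto simp: eventually_sequentially)
  define L where "L = max 1 (K / r)"
  have Lr: "K \<le> L * r" "L \<ge> 1"
    unfolding L_def using r by (auto simp: max_def field_simps)
  define M where "M = L ^ m / qpoch_inf q q * \<rho> powi (- k)"
  have bound: "\<bar>qbin_term (a P) b n * qpoch_inf (- (xk k * b * (s0 / q ^ P)) * q ^ n) q\<bar>
      \<le> M * \<rho> ^ P * (1 / 2) ^ n"
    if P: "int P - k \<ge> int m" for P n
  proof -
    define N where "N = nat (int P - k)"
    have N: "int N = int P - k" "N \<ge> m" using P by (auto simp: N_def)
    have arg: "- (xk k * b * (s0 / q ^ P)) * q ^ n = q powi (int n + 1 - int N)"
      unfolding xk_def s0_def N using q_nz c_pos b_pos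
      by (simp add: power_int_add power_int_diff field_simps)
    show ?thesis
    proof (cases "n < N")
      case True
      then have "qpoch_inf (- (xk k * b * (s0 / q ^ P)) * q ^ n) q = 0"
        unfolding arg by (intro qpoch_inf_powi_eq_0) auto
      moreover have "M \<ge> 0"
        unfolding M_def using Lr assms qpoch_inf_pos'[OF q_less_1] by auto
      ultimately show ?thesis using assms by simp
    next
      case False
      have qP: "q ^ P = q * q powi (k - 1) * q ^ N"
      proof -
        have "q powi int P = q powi (1 + (k - 1) + int N)" using N by simp
        then show ?thesis using q_nz by (simp add: power_int_add power_int_diff)
      qed
      have fac: "\<bar>a P - b * q ^ i\<bar> = c * b * q powi (k - 1) * q ^ N + b * q ^ i" for i
      proof -
        have "a P = - (c * b * q powi (k - 1) * q ^ N)"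
          unfolding a_eq qP using q_nz by simp
        moreover have "c * b * q powi (k - 1) * q ^ N \<ge> 0" "b * q ^ i \<ge> 0"
          using c_pos b_pos q_pos by auto
        ultimately show ?thesis by linarith
      qed
      have fac': "\<bar>a P - b * q ^ i\<bar> \<le> K * q ^ j" if "j \<le> i" "j \<le> N" for i j
      proof -
        have "q ^ i \<le> q ^ j" "q ^ N \<le> q ^ j"
          using that q_pos q_less_1 by (auto intro: power_decreasing)
        then have "c * b * q powi (k - 1) * q ^ N + b * q ^ i
            \<le> c * b * q powi (k - 1) * q ^ j + b * q ^ j"
          using c_pos b_pos q_pos by (intro add_mono mult_left_mono) auto
        then show ?thesis unfolding fac K_def by (simp add: algebra_simps)
      qed
      have "\<bar>\<Prod>i<n. a P - b * q ^ i\<bar> \<le> L ^ m * r ^ n"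
      proof (rule prod_geometric_bound)
        show "\<bar>a P - b * q ^ i\<bar> \<le> L * r" for i
          using fac'[of 0 i] Lr by simp
        show "\<bar>a P - b * q ^ i\<bar> \<le> r" if "i \<ge> m" for i
          using fac'[of m i] that N m by simp
      qed (use Lr r in auto)
      moreover have "1 / qpoch q q n \<le> 1 / qpoch_inf q q"
        using qpoch_inf_le_qpoch[of q n] q_pos q_less_1 qpoch_inf_pos'[OF q_less_1]
        by (intro divide_left_mono) (auto simp: qpoch_pos)
      ultimately have "\<bar>qbin_term (a P) b n\<bar> \<le> (L ^ m * r ^ n) * (1 / qpoch_inf q q)"
        unfolding qbin_term_def abs_divide using qpoch_pos[OF q_less_1, of n] Lr r
        by (subst divide_inverse, intro mult_mono) (auto simp: divide_inverse)
      moreover have "\<rho> ^ n \<le> \<rho> ^ N"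
        using False assms by (intro power_decreasing) auto
      then have "r ^ n \<le> \<rho> ^ P * \<rho> powi (- k) * (1 / 2) ^ n"
      proof -
        have "\<rho> powi int N = \<rho> powi (int P + (- k))"
          using N by simp
        then have "\<rho> ^ N = \<rho> ^ P * \<rho> powi (- k)"
          using assms(1) by (subst (asm) power_int_add) auto
        moreover have "r ^ n = \<rho> ^ n * (1 / 2) ^ n"
          unfolding r_def by (simp add: power_divide)
        ultimately show ?thesis using \<open>\<rho> ^ n \<le> \<rho> ^ N\<close> by simp
      qed
      then have "(L ^ m * r ^ n) * (1 / qpoch_inf q q) \<le>
          (L ^ m * (\<rho> ^ P * \<rho> powi (- k) * (1 / 2) ^ n)) * (1 / qpoch_inf q q)"
        using Lr qpoch_inf_pos'[OF q_less_1] by (intro mult_right_mono mult_left_mono) auto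
      ultimately have "\<bar>qbin_term (a P) b n\<bar> \<le> M * \<rho> ^ P * (1 / 2) ^ n"
        unfolding M_def by (simp add: mult_ac)
      moreover have "\<bar>qpoch_inf (- (xk k * b * (s0 / q ^ P)) * q ^ n) q\<bar> \<le> 1"
        unfolding arg using qpoch_inf_powi_bounds[of "int n + 1 - int N"] by simp
      ultimately have "\<bar>qbin_term (a P) b n\<bar> * \<bar>qpoch_inf (- (xk k * b * (s0 / q ^ P)) * q ^ n) q\<bar>
         \<le> (M * \<rho> ^ P * (1 / 2) ^ n) * 1"
        by (intro mult_mono) auto
      then show ?thesis by (simp add: abs_mult)
    qed
  qed
  have ev3: "\<forall>\<^sub>F P in sequentially. int P - k \<ge> int m"
    using eventually_ge_at_top[of "nat (k + int m)"] by eventually_elim linarith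
  \<comment> \<open>The 4 is 2 from the geometric series times the bound 2 on
    \<open>qpoch_inf (a P) q\<close>.\<close>
  have "\<forall>\<^sub>F P in sequentially. \<bar>phi (xk k) (s0 / q ^ P)\<bar> \<le> (4 * M / qpoch_inf b q) * \<rho> ^ P"
    using ev1 ev2 ev3
  proof eventually_elim
    case (elim P)
    let ?f = "\<lambda>n. qbin_term (a P) b n * qpoch_inf (- (xk k * b * (s0 / q ^ P)) * q ^ n) q"
    have "(?f has_sum (qpoch_inf b q / qpoch_inf (a P) q * phi (xk k) (s0 / q ^ P))) UNIV"
      unfolding a_def using elim(2) s0_neg q_nz by (intro phi_transform) (auto simp: a_def)
    then have "?f sums (qpoch_inf b q / qpoch_inf (a P) q * phi (xk k) (s0 / q ^ P))"
      by (rule has_sum_imp_sums)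
    then have *: "suminf ?f = qpoch_inf b q / qpoch_inf (a P) q * phi (xk k) (s0 / q ^ P)"
      by (simp add: sums_iff)
    have g: "(\<lambda>n. M * \<rho> ^ P * (1 / 2) ^ n) sums (M * \<rho> ^ P * (1 / (1 - 1 / 2)))"
      by (intro sums_mult geometric_sums) simp
    have b': "norm (?f n) \<le> M * \<rho> ^ P * (1 / 2) ^ n" for n
      using bound[OF elim(3), of n] by simp
    have "norm (suminf ?f) \<le> (\<Sum>n. M * \<rho> ^ P * (1 / 2) ^ n)"
      using b' g by (intro norm_suminf_le) (auto simp: sums_iff)
    then have le: "\<bar>qpoch_inf b q / qpoch_inf (a P) q * phi (xk k) (s0 / q ^ P)\<bar> \<le> 2 * M * \<rho> ^ P"
      using g unfolding * by (simp add: sums_iff mult_ac)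
    have pos: "qpoch_inf b q > 0" "qpoch_inf (a P) q > 0"
      using qpoch_inf_pos'[OF b_less_1] qpoch_inf_pos'[of "a P"] elim(2) by auto
    have "\<bar>phi (xk k) (s0 / q ^ P)\<bar> = qpoch_inf (a P) q / qpoch_inf b q *
        \<bar>qpoch_inf b q / qpoch_inf (a P) q * phi (xk k) (s0 / q ^ P)\<bar>"
      using pos by (simp add: abs_mult)
    also have "\<dots> \<le> 2 / qpoch_inf b q * (2 * M * \<rho> ^ P)"
      using pos elim(1) le by (intro mult_mono divide_right_mono) auto
    finally show ?case by (simp add: mult_ac)
  qed
  then show ?thesis by blast
qed

lemma phi_decay: "(\<lambda>P. phi (xk k) (s0 / q ^ P) * R ^ P) \<longlonglongrightarrow> 0"
proof -
  define \<rho> where "\<rho> = 1 / (2 * (1 + \<bar>R\<bar>))"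
  have \<rho>: "0 < \<rho>" "\<rho> \<le> 1" "\<rho> * \<bar>R\<bar> < 1"
    unfolding \<rho>_def by (auto simp: divide_simps)
  obtain C where C: "\<forall>\<^sub>F P in sequentially. \<bar>phi (xk k) (s0 / q ^ P)\<bar> \<le> C * \<rho> ^ P"
    using phi_decay_bound[OF \<rho>(1,2)] by blast
  show ?thesis
  proof (rule Lim_null_comparison)
    show "\<forall>\<^sub>F P in sequentially. norm (phi (xk k) (s0 / q ^ P) * R ^ P) \<le> C * (\<rho> * \<bar>R\<bar>) ^ P"
      using C
    proof eventually_elim
      case (elim P)
      then have "\<bar>phi (xk k) (s0 / q ^ P)\<bar> * \<bar>R\<bar> ^ P \<le> C * \<rho> ^ P * \<bar>R\<bar> ^ P"
        by (intro mult_right_mono) auto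
      then show ?case by (simp add: abs_mult power_abs power_mult_distrib)
    qed
    have "(\<lambda>P. C * (\<rho> * \<bar>R\<bar>) ^ P) \<longlonglongrightarrow> C * 0"
      using \<rho> by (intro tendsto_intros LIMSEQ_realpow_zero) auto
    then show "(\<lambda>P. C * (\<rho> * \<bar>R\<bar>) ^ P) \<longlonglongrightarrow> 0" by simp
  qed
qed

end

section \<open>Dual orthogonality\<close>

lemma has_sum_Plus_UNIV:
  fixes f :: "'a + 'b \<Rightarrow> real"
  assumes "((\<lambda>x. f (Inl x)) has_sum A) UNIV" "((\<lambda>x. f (Inr x)) has_sum B) UNIV"
  shows "(f has_sum (A + B)) UNIV"
proof -
  have "(f has_sum A) (range Inl)" "(f has_sum B) (range Inr)"
    using assms by (simp_all add: has_sum_reindex o_def)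
  then have "(f has_sum (A + B)) (range Inl \<union> range Inr)"
    by (rule has_sum_Un_disjoint) auto
  then show ?thesis
    by (simp only: UNIV_sum)
qed

context qlag_param
begin

text \<open>A solution of the Pearson equation \<open>dual_density_scale\<close>, which makes the
  second order equation in \<open>s\<close> symmetric.\<close>

definition dual_density :: "real \<Rightarrow> real" where
  "dual_density s = qpoch_inf (q * s) q / qpoch_inf (b * s) q"

text \<open>For nonzero \<open>s\<close>, \<open>phi_diff\<close> makes this a multiple of the
  Casorati determinant of \<open>phi x\<close> and \<open>phi y\<close> at \<open>s / q\<close> and
  \<open>s\<close>. Written with \<open>dphi\<close> it stays continuous at \<open>s = 0\<close>,
  where the two branches meet; \<open>1 - s\<close> closes the positive branch at its top
  point.\<close>

definition dual_wronskian :: "real \<Rightarrow> real \<Rightarrow> real \<Rightarrow> real" where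
  "dual_wronskian x y s = (1 - s) * dual_density s * (phi y s * dphi x (s / q) - phi x s
      * dphi y (s / q))"

definition dual_term :: "real \<Rightarrow> real \<Rightarrow> real \<Rightarrow> real" where
  "dual_term x y s = s * (dual_density s * phi x s * phi y s)"

lemma dual_density_scale:
  assumes "b * s < 1"
  shows "(1 - q * s) * dual_density (q * s) = (1 - b * s) * dual_density s"
proof -
  have 1: "qpoch_inf (q * s) q = (1 - q * s) * qpoch_inf (q * (q * s)) q"
    using qpoch_inf_rec[of "q * s"] by (simp only: mult_ac)
  have 2: "qpoch_inf (b * s) q = (1 - b * s) * qpoch_inf (b * (q * s)) q"
    using qpoch_inf_rec[of "b * s"] by (simp only: mult_ac)
  have "qpoch_inf (b * s) q > 0"
    using assms by (rule qpoch_inf_pos')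
  then have "(1 - b * s) * qpoch_inf (b * (q * s)) q \<noteq> 0"
    unfolding 2 by (metis less_irrefl)
  then show ?thesis
    unfolding dual_density_def 1 2 by simp
qed

lemma dual_density_pos:
  assumes "b * s < 1" "q * s < 1"
  shows "dual_density s > 0"
  unfolding dual_density_def using assms by (intro divide_pos_pos qpoch_inf_pos')

text \<open>A discrete Green identity: the products of two \<open>dphi\<close> cancel, and the
  Pearson equation brings both determinants to the same weight.\<close>

lemma dual_wronskian_step:
  assumes "b * s < 1"
  shows "b * (x - y) * dual_term x y s = dual_wronskian x y (q * s) - dual_wronskian x y s"
proof -
  have phi: "phi z (q * s) = phi z s - s * dphi z s" for z
    using phi_diff[of z s] by simp
  have dphi: "(1 - s) * dphi z (s / q) = (1 - b * s) * dphi z s - s * (b * z * phi z s)" for z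
    using dphi_diff[of s z] by (simp add: algebra_simps)
  have "dual_wronskian x y (q * s) = (1 - b * s) * dual_density s * (phi y (q * s) * dphi x s
      - phi x (q * s) * dphi y s)"
    unfolding dual_wronskian_def dual_density_scale[OF assms] using q_nz by simp
  also have "\<dots> = (1 - b * s) * dual_density s * (phi y s * dphi x s - phi x s * dphi y s)"
    unfolding phi by (simp add: algebra_simps)
  finally have 1: "dual_wronskian x y (q * s)
      = (1 - b * s) * dual_density s * (phi y s * dphi x s - phi x s * dphi y s)" .
  have "dual_wronskian x y s = dual_density s * (phi y s * ((1 - s) * dphi x (s / q)) - phi x s
      * ((1 - s) * dphi y (s / q)))"
    unfolding dual_wronskian_def by (simp add: algebra_simps)
  also have "\<dots> = dual_density s * (phi y s * ((1 - b * s) * dphi x s - s * (b * x * phi x s)) -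
      phi x s * ((1 - b * s) * dphi y s - s * (b * y * phi y s)))"
    unfolding dphi ..
  finally show ?thesis
    unfolding 1 dual_term_def by (simp add: algebra_simps)
qed

lemma dual_wronskian_1 [simp]: "dual_wronskian x y 1 = 0"
  by (simp add: dual_wronskian_def)

lemma isCont_dual_density_0: "isCont dual_density 0"
  unfolding dual_density_def isCont_def by (intro tendsto_intros) auto

lemma isCont_dual_wronskian_0: "isCont (dual_wronskian x y) 0"
  unfolding dual_wronskian_def
  by (intro continuous_intros isCont_dual_density_0 isCont_o2[OF _ isCont_phi] isCont_o2[OF _ isCont_dphi])
     (use q_nz in auto)

lemma summable_near_0:
  assumes "isCont T 0"
  shows "summable (\<lambda>n. \<bar>t * q ^ n * T (t * q ^ n)\<bar>)"
proof -
  have "(\<lambda>n. t * q ^ n) \<longlonglongrightarrow> t * 0"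
    by (intro tendsto_intros q_power_tendsto_0)
  then have "(\<lambda>n. T (t * q ^ n)) \<longlonglongrightarrow> T 0"
    using isCont_tendsto_compose[OF assms] by simp
  then have "Bseq (\<lambda>n. T (t * q ^ n))"
    by (rule convergent_imp_Bseq[OF convergentI])
  then obtain K where K: "\<And>n. \<bar>T (t * q ^ n)\<bar> \<le> K"
    by (auto simp: Bseq_def)
  show ?thesis
  proof (rule summable_comparison_test')
    show "summable (\<lambda>n. \<bar>t\<bar> * K * q ^ n)"
      using q_pos q_less_1 by (intro summable_mult summable_geometric) auto
    show "norm \<bar>t * q ^ n * T (t * q ^ n)\<bar> \<le> \<bar>t\<bar> * K * q ^ n" for n
      using mult_left_mono[OF K[of n], of "\<bar>t * q ^ n\<bar>"] q_pos by (simp add: abs_mult mult_ac)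
  qed
qed

lemma dual_term_summable_near_0: "summable (\<lambda>n. \<bar>dual_term x y (t * q ^ n)\<bar>)"
  unfolding dual_term_def
  by (rule summable_near_0) (intro continuous_intros isCont_dual_density_0 isCont_phi)

section \<open>Sums and boundary terms along the negative branch\<close>

definition sneg :: "nat \<Rightarrow> real" where "sneg n = s0 / q ^ n"

lemma sneg_neg: "sneg n < 0"
  unfolding sneg_def using s0_neg q_pos by (simp add: divide_neg_pos)

lemma dual_density_sneg_nonneg: "dual_density (sneg n) \<ge> 0"
  using sneg_neg[of n] b_pos q_pos
  by (intro less_imp_le dual_density_pos) (auto intro: order.strict_trans[OF mult_pos_neg])

text \<open>The Pearson equation bounds the quotient of consecutive values by 1/b, so the density
  grows at most geometrically, which the decay of \<open>phi\<close> outweighs.\<close>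

lemma dual_density_sneg_bound: "dual_density (sneg n) * b ^ n \<le> dual_density (sneg 0)"
proof (induction n)
  case (Suc n)
  let ?s = "sneg (Suc n)"
  have neg: "b * ?s < 0" "?s < 0" using sneg_neg b_pos by (auto intro: mult_pos_neg)
  have s: "q * ?s = sneg n"
    unfolding sneg_def using q_nz by simp
  have "(1 - b * ?s) * (dual_density ?s * b) = (1 - sneg n) * dual_density (sneg n) * b"
    using dual_density_scale[of ?s] neg unfolding s by simp
  also have "\<dots> = (b * (1 - sneg n)) * dual_density (sneg n)"
    by simp
  also have "\<dots> \<le> (1 - b * ?s) * dual_density (sneg n)"
  proof (rule mult_right_mono)
    have "b * ?s \<le> b * (q * ?s)"
      using q_pos q_less_1 neg b_pos by (intro mult_left_mono) auto
    then show "b * (1 - sneg n) \<le> 1 - b * ?s"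
      unfolding s using b_less_1 by (simp add: algebra_simps)
  qed (rule dual_density_sneg_nonneg)
  finally have "dual_density ?s * b \<le> dual_density (sneg n)"
    using neg by simp
  then have "dual_density ?s * b * b ^ n \<le> dual_density (sneg n) * b ^ n"
    using b_pos by (intro mult_right_mono) auto
  then show ?case using Suc by (simp add: mult_ac)
qed simp

text \<open>The growth of the density and \<open>R ^ n\<close> are both charged to the first
  \<open>phi\<close>, by \<open>phi_decay\<close> with \<open>R / b\<close>. The offset
  \<open>m\<close> admits the neighbouring points that meet in
  \<open>dual_wronskian\<close>.\<close>

lemma dual_density_phi_phi_decay:
  assumes "b * R \<noteq> 0"
  shows "(\<lambda>n. dual_density (sneg n) * phi (xk k) (sneg n) * phi (xk l) (sneg (n + m)) * R ^ n) \<longlonglongrightarrow> 0"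
proof (rule Lim_null_comparison)
  let ?g = "\<lambda>n. dual_density (sneg 0) * \<bar>phi (xk k) (sneg n) * (R / b) ^ n\<bar> * \<bar>phi (xk l) (sneg (n
      + m)) * 1 ^ (n + m)\<bar>"
  show "\<forall>\<^sub>F n in sequentially. norm (dual_density (sneg n) * phi (xk k) (sneg n)
      * phi (xk l) (sneg (n + m)) * R ^ n) \<le> ?g n"
  proof (rule always_eventually, rule allI)
    fix n
    have "dual_density (sneg n) * b ^ n * (\<bar>phi (xk k) (sneg n) * (R / b) ^ n\<bar>
        * \<bar>phi (xk l) (sneg (n + m))\<bar>) \<le>
        dual_density (sneg 0) * (\<bar>phi (xk k) (sneg n) * (R / b) ^ n\<bar> * \<bar>phi (xk l) (sneg (n + m))\<bar>)"
      by (intro mult_right_mono dual_density_sneg_bound) auto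
    moreover have "norm (dual_density (sneg n) * phi (xk k) (sneg n) * phi (xk l) (sneg (n + m)) * R ^ n) =
        dual_density (sneg n) * b ^ n * (\<bar>phi (xk k) (sneg n) * (R / b) ^ n\<bar>
            * \<bar>phi (xk l) (sneg (n + m))\<bar>)"
      using b_pos dual_density_sneg_nonneg[of n] by (simp add: abs_mult power_divide power_abs)
    ultimately show "norm (dual_density (sneg n) * phi (xk k) (sneg n) * phi (xk l) (sneg (n + m))
        * R ^ n) \<le> ?g n"
      by (simp add: mult_ac)
  qed
  have "?g \<longlonglongrightarrow> dual_density (sneg 0) * \<bar>0\<bar> * \<bar>0\<bar>"
    using phi_decay[of l 1, folded sneg_def] phi_decay[of k, folded sneg_def]
    by (intro tendsto_intros LIMSEQ_ignore_initial_segment[of "\<lambda>n. phi (xk l) (sneg n)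
        * 1 ^ n"]) auto
  then show "?g \<longlonglongrightarrow> 0" by simp
qed

lemma dual_term_summable_neg: "summable (\<lambda>n. \<bar>dual_term (xk k) (xk l) (sneg n)\<bar>)"
proof -
  \<comment> \<open>In the rate \<open>2 / q\<close>, the \<open>1 / q\<close> accounts for the
    factor \<open>s = s0 / q ^ n\<close> of \<open>dual_term\<close>, and the 2 leaves a geometric
    majorant.\<close>
  have "(\<lambda>n. s0 * (dual_density (sneg n) * phi (xk k) (sneg n) * phi (xk l) (sneg (n + 0))
      * (2 / q) ^ n)) \<longlonglongrightarrow> s0 * 0"
    using q_pos b_pos by (intro tendsto_mult tendsto_const dual_density_phi_phi_decay) auto
  moreover have "s0 * (dual_density (sneg n) * phi (xk k) (sneg n) * phi (xk l) (sneg (n + 0))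
      * (2 / q) ^ n)
      = dual_term (xk k) (xk l) (sneg n) * 2 ^ n" for n
    unfolding dual_term_def by (subst (4) sneg_def) (simp add: power_divide)
  ultimately have "Bseq (\<lambda>n. dual_term (xk k) (xk l) (sneg n) * 2 ^ n)"
    by (intro convergent_imp_Bseq convergentI) auto
  then obtain K where K: "\<And>n. \<bar>dual_term (xk k) (xk l) (sneg n) * 2 ^ n\<bar> \<le> K"
    by (auto simp: Bseq_def)
  show ?thesis
  proof (rule summable_comparison_test')
    show "summable (\<lambda>n. K * (1 / 2) ^ n)"
      by (intro summable_mult summable_geometric) auto
    show "norm \<bar>dual_term (xk k) (xk l) (sneg n)\<bar> \<le> K * (1 / 2) ^ n" for n
      using mult_right_mono[OF K[of n], of "(1 / 2) ^ n"] by (simp add: abs_mult power_divide)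
  qed
qed

text \<open>After \<open>dphi\<close> is rewritten as a difference of values, products taken at one
  and the same point cancel; the prefactor (1 - s) q / s stays bounded.\<close>

lemma dual_wronskian_neg_tendsto_0: "(\<lambda>n. dual_wronskian (xk k) (xk l) (sneg n)) \<longlonglongrightarrow> 0"
proof -
  let ?A = "\<lambda>k l n. dual_density (sneg n) * phi (xk k) (sneg n) * phi (xk l) (sneg (n + 1)) * 1 ^ n"
  have eq: "dual_wronskian (xk k) (xk l) (sneg n)
      = (q / s0 * q ^ n - q) * (?A l k n - ?A k l n)" for n
  proof -
    have s: "sneg n \<noteq> 0" using sneg_neg[of n] by simp
    have s1: "sneg n / q = sneg (n + 1)" "q * sneg (n + 1) = sneg n"
      unfolding sneg_def using q_nz by auto
    have dphi_eq: "dphi x (sneg (n + 1)) = q * (phi x (sneg (n + 1))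
        - phi x (sneg n)) / sneg n" for x
    proof -
      have "q * (phi x (sneg (n + 1)) - phi x (sneg n))
          = q * (sneg (n + 1) * dphi x (sneg (n + 1)))"
        using phi_diff[of x "sneg (n + 1)"] unfolding s1 by (simp only:)
      also have "\<dots> = sneg n * dphi x (sneg (n + 1))"
        by (simp only: mult.assoc[symmetric] s1)
      finally show ?thesis using s by simp
    qed
    have "dual_wronskian (xk k) (xk l) (sneg n)
        = (1 - sneg n) * (q / sneg n) * (?A l k n - ?A k l n)"
      unfolding dual_wronskian_def s1 dphi_eq using s by (simp add: field_simps)
    moreover have "(1 - sneg n) * (q / sneg n) = q / s0 * q ^ n - q"
      using s unfolding sneg_def using s0_neg q_nz by (simp add: field_simps)
    ultimately show ?thesis by (simp only:)
  qed
  have "(\<lambda>n. (q / s0 * q ^ n - q) * (?A l k n - ?A k l n)) \<longlonglongrightarrow> (q / s0 * 0 - q) * (0 - 0)"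
    using b_pos by (intro tendsto_mult tendsto_diff tendsto_const q_power_tendsto_0 dual_density_phi_phi_decay) auto
  then show ?thesis
    by (simp add: eq)
qed

text \<open>\<open>Inl p\<close> is the spectral value of \<open>qM\<close> with index \<open>p\<close>, \<open>Inr n\<close> that of \<open>qLaguerre\<close> with index \<open>n\<close>.\<close>

definition spec :: "int + nat \<Rightarrow> real" where
  "spec = case_sum (\<lambda>p. s0 * q powi p) (\<lambda>n. q ^ n)"

text \<open>The absolute value gives a positive weight. As \<open>dual_term\<close> carries
  \<open>s\<close> itself, the negative branch enters the telescoping sums with the opposite
  sign.\<close>

definition dual_weight :: "int + nat \<Rightarrow> real" where
  "dual_weight i = \<bar>spec i\<bar> * dual_density (spec i)"

definition psi :: "int \<Rightarrow> int + nat \<Rightarrow> real" where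
  "psi k i = phi (xk k) (spec i)"

lemma spec_Inl_neg: "spec (Inl p) < 0"
  unfolding spec_def using s0_neg q_pos by (simp add: mult_neg_pos)

lemma spec_Inr_pos: "spec (Inr n) > 0"
  unfolding spec_def using q_pos by simp

lemma spec_nz: "spec i \<noteq> 0"
  using spec_Inl_neg spec_Inr_pos by (cases i) (auto simp: less_le)

lemma dual_weight_psi_Inl: "dual_weight (Inl p) * psi k (Inl p) * psi l (Inl p)
    = - dual_term (xk k) (xk l) (s0 * q powi p)"
  unfolding dual_weight_def dual_term_def psi_def using spec_Inl_neg[of p] by (simp add: spec_def)

lemma dual_weight_psi_Inr: "dual_weight (Inr n) * psi k (Inr n) * psi l (Inr n)
    = dual_term (xk k) (xk l) (1 * q ^ n)"
  unfolding dual_weight_def dual_term_def psi_def using spec_Inr_pos[of n] by (simp add: spec_def)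

lemma s0_powi: "s0 * q powi int n = s0 * q ^ n" "s0 * q powi (- int n) = sneg n"
  by (simp_all add: sneg_def power_int_minus divide_inverse)

lemma b_spec_less_1: "b * spec i < 1" "q * spec (Inl p) < 1"
proof -
  show "b * spec i < 1"
  proof (cases i)
    case (Inl p)
    then show ?thesis using spec_Inl_neg[of p] b_pos mult_pos_neg[of b "spec i"] by auto
  next
    case (Inr n)
    then show ?thesis using one_minus_bq_pos[of n] by (simp add: spec_def)
  qed
  show "q * spec (Inl p) < 1"
    using spec_Inl_neg[of p] q_pos mult_pos_neg[of q "spec (Inl p)"] by auto
qed

lemma dual_weight_pos: "dual_weight i > 0"
proof -
  have "q * spec i < 1"
  proof (cases i)
    case (Inr n)
    have "q ^ n \<le> 1" using q_pos q_less_1 by (simp add: power_le_one)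
    then have "q * q ^ n \<le> q" using q_pos by simp
    then show ?thesis using q_less_1 Inr by (simp add: spec_def)
  qed (use b_spec_less_1 in auto)
  then show ?thesis
    unfolding dual_weight_def using dual_density_pos[OF b_spec_less_1(1)] spec_nz[of i] by simp
qed

lemma dual_term_summable_int: "(\<lambda>p. dual_term (xk k) (xk l) (s0 * q powi p)) summable_on UNIV"
  unfolding summable_on_int_iff s0_powi
  using dual_term_summable_near_0 summable_Suc_iff[of "\<lambda>n. \<bar>dual_term (xk k) (xk l) (sneg n)\<bar>"]
      dual_term_summable_neg by auto

lemma dual_term_summable_nat: "(\<lambda>n. dual_term (xk k) (xk l) (1 * q ^ n)) summable_on UNIV"
  unfolding summable_on_nat_iff_abs by (rule dual_term_summable_near_0)

lemma dual_summable: "(\<lambda>i. dual_weight i * psi k i * psi l i) summable_on UNIV"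
proof -
  have "((\<lambda>p. dual_weight (Inl p) * psi k (Inl p) * psi l (Inl p)) has_sum
      - infsum (\<lambda>p. dual_term (xk k) (xk l) (s0 * q powi p)) UNIV) UNIV"
    unfolding dual_weight_psi_Inl using dual_term_summable_int by (simp add: has_sum_uminus)
  moreover have "((\<lambda>p. dual_weight (Inr p) * psi k (Inr p) * psi l (Inr p)) has_sum
      infsum (\<lambda>n. dual_term (xk k) (xk l) (1 * q ^ n)) UNIV) UNIV"
    unfolding dual_weight_psi_Inr using dual_term_summable_nat by (intro has_sum_infsum)
  ultimately show ?thesis
    using has_sum_Plus_UNIV[of "\<lambda>i. dual_weight i * psi k i * psi l i"] has_sum_imp_summable by blast
qed

lemma xk_inj: "xk k = xk l \<longleftrightarrow> k = l"
proof -
  have "xk m < xk n" if "n < m" for m n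
    unfolding xk_def using power_int_strict_decreasing[OF that q_pos q_less_1] c_pos by simp
  then show ?thesis
    by (cases k l rule: linorder_cases) force+
qed

lemma dual_orthogonal:
  assumes "k \<noteq> l"
  shows "((\<lambda>i. dual_weight i * psi k i * psi l i) has_sum 0) UNIV"
proof -
  define B where "B = b * (xk k - xk l)"
  have B: "B \<noteq> 0" using b_pos xk_inj[of k l] assms by (simp add: B_def)
  define G where "G p = dual_wronskian (xk k) (xk l) (s0 * q powi p)" for p
  have step: "G (p + 1) - G p = B * dual_term (xk k) (xk l) (s0 * q powi p)" for p
  proof -
    have eq: "s0 * q powi (p + 1) = q * (s0 * q powi p)"
      using q_nz by (simp add: power_int_add)
    have "b * (s0 * q powi p) < 1"
      using b_spec_less_1(1)[of "Inl p"] by (simp add: spec_def)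
    then show ?thesis
      unfolding G_def eq B_def using dual_wronskian_step[of "s0 * q powi p" "xk k" "xk l"] by simp
  qed
  have lim: "(\<lambda>n. dual_wronskian (xk k) (xk l) (t * q ^ n)) \<longlonglongrightarrow> dual_wronskian (xk k) (xk l) 0" for t
  proof (rule isCont_tendsto_compose[OF isCont_dual_wronskian_0])
    have "(\<lambda>n. t * q ^ n) \<longlonglongrightarrow> t * 0"
      by (intro tendsto_intros q_power_tendsto_0)
    then show "(\<lambda>n. t * q ^ n) \<longlonglongrightarrow> 0" by simp
  qed
  have "((\<lambda>p. G (p + 1) - G p) has_sum (dual_wronskian (xk k) (xk l) 0 - 0)) UNIV"
  proof (rule has_sum_telescope_int)
    show "(\<lambda>p. G (p + 1) - G p) summable_on UNIV"
      unfolding step by (intro summable_on_cmult_right dual_term_summable_int)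
    show "(\<lambda>n. G (int n)) \<longlonglongrightarrow> dual_wronskian (xk k) (xk l) 0"
      unfolding G_def s0_powi by (rule lim)
    show "(\<lambda>n. G (- int n)) \<longlonglongrightarrow> 0"
      unfolding G_def s0_powi by (rule dual_wronskian_neg_tendsto_0)
  qed
  then have 1: "((\<lambda>p. B * dual_term (xk k) (xk l) (s0 * q powi p))
      has_sum dual_wronskian (xk k) (xk l) 0) UNIV"
    unfolding step by simp
  have "(\<lambda>n. dual_wronskian (xk k) (xk l) (1 * q ^ Suc n) - dual_wronskian (xk k) (xk l) (1
      * q ^ n)) sums
     (dual_wronskian (xk k) (xk l) 0 - dual_wronskian (xk k) (xk l) (1 * q ^ 0))"
    by (rule telescope_sums[OF lim])
  moreover have "dual_wronskian (xk k) (xk l) (1 * q ^ Suc n) - dual_wronskian (xk k) (xk l) (1 * q ^ n) =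
      B * dual_term (xk k) (xk l) (1 * q ^ n)" for n
    using dual_wronskian_step[of "q ^ n" "xk k" "xk l"] one_minus_bq_pos[of n] by (simp add: B_def)
  ultimately have "(\<lambda>n. B * dual_term (xk k) (xk l) (1 * q ^ n))
      sums dual_wronskian (xk k) (xk l) 0"
    by simp
  then have 2: "((\<lambda>n. B * dual_term (xk k) (xk l) (1 * q ^ n))
      has_sum dual_wronskian (xk k) (xk l) 0) UNIV"
    using summable_mult[OF dual_term_summable_near_0[of "xk k" "xk l" 1], of "\<bar>B\<bar>"]
    by (intro norm_summable_imp_has_sum) (auto simp: abs_mult)
  \<comment> \<open>The boundary terms at \<open>s = 0\<close> from the two branches of the spectrum cancel.\<close>
  have "((\<lambda>i. B * (dual_weight i * psi k i * psi l i))
      has_sum (- dual_wronskian (xk k) (xk l) 0 + dual_wronskian (xk k) (xk l) 0)) UNIV"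
    by (rule has_sum_Plus_UNIV) (use 1 2 in \<open>simp_all only: dual_weight_psi_Inl
        dual_weight_psi_Inr mult_minus_right has_sum_uminus minus_minus\<close>)
  from has_sum_cmult_right[OF this, of "1 / B"] show ?thesis
    using B by simp
qed

section \<open>Squared norms of the dual functions\<close>

definition dual_gram :: "int \<Rightarrow> int \<Rightarrow> real" where
  "dual_gram k l = infsum (\<lambda>i. dual_weight i * psi k i * psi l i) UNIV"

lemma dual_gram_has_sum: "((\<lambda>i. dual_weight i * psi k i * psi l i) has_sum dual_gram k l) UNIV"
  unfolding dual_gram_def by (intro has_sum_infsum dual_summable)

lemma dual_gram_offdiag: "k \<noteq> l \<Longrightarrow> dual_gram k l = 0"
  using dual_orthogonal infsumI unfolding dual_gram_def by blast

lemma psi_recurrence: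
  "psi (k - 1) i - psi k i + b / q * (1 + xk k) * (psi (k + 1) i - psi k i) =
    - (b / q) * (1 - spec i) * xk k * psi k i"
proof -
  have "xk k / q = xk (k - 1)" "q * xk k = xk (k + 1)"
    using xk_Suc[of k] xk_Suc[of "k - 1"] q_nz by (auto simp: field_simps)
  then show ?thesis
    using phi_recurrence[of "xk k" "spec i"] by (simp add: psi_def)
qed

text \<open>
  Multiplication by \<open>s\<close> acts on \<open>psi k\<close> by the three-term recurrence in \<open>k\<close>; comparing the two ways
  of pairing \<open>s * psi k\<close> with \<open>psi (k + 1)\<close> relates neighbouring diagonal entries.
\<close>

lemma dual_gram_step: "dual_gram k k = b * (1 + xk k) * dual_gram (k + 1) (k + 1)"
proof -
  let ?B = "b / q"
  define L where "L k i = (psi (k - 1) i - psi k i + ?B * (1 + xk k) * (psi (k + 1) i - psi k i)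
      + ?B * xk k * psi k i) / xk k" for k i
  have L: "L k i = ?B * spec i * psi k i" for k i
  proof -
    have "psi (k - 1) i - psi k i + ?B * (1 + xk k) * (psi (k + 1) i - psi k i) + ?B * xk k
        * psi k i =
       ?B * spec i * psi k i * xk k"
      unfolding psi_recurrence by (simp add: algebra_simps diff_divide_distrib)
    then show ?thesis
      unfolding L_def using xk_pos[of k] by simp
  qed
  have S: "((\<lambda>i. dual_weight i * L k i * psi l i) has_sum
     ((dual_gram (k - 1) l - dual_gram k l + ?B * (1 + xk k) * (dual_gram (k + 1) l
         - dual_gram k l) + ?B * xk k * dual_gram k l) / xk k)) UNIV" for k l
  proof -
    have "((\<lambda>i. 1 / xk k * (dual_weight i * psi (k - 1) i * psi l i - dual_weight i * psi k i
        * psi l i +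
        ?B * (1 + xk k) * (dual_weight i * psi (k + 1) i * psi l i - dual_weight i * psi k i
            * psi l i) +
        ?B * xk k * (dual_weight i * psi k i * psi l i))) has_sum
        1 / xk k * (dual_gram (k - 1) l - dual_gram k l + ?B * (1 + xk k) * (dual_gram (k + 1) l
            - dual_gram k l) + ?B * xk k * dual_gram k l)) UNIV"
      by (intro has_sum_cmult_right has_sum_add has_sum_diff dual_gram_has_sum)
    moreover have "1 / xk k * (dual_weight i * psi (k - 1) i * psi l i - dual_weight i * psi k i
        * psi l i +
        ?B * (1 + xk k) * (dual_weight i * psi (k + 1) i * psi l i - dual_weight i * psi k i
            * psi l i) +
        ?B * xk k * (dual_weight i * psi k i * psi l i)) = dual_weight i * L k i * psi l i" for i
    proof -
      have "1 / X * (R * p1 * l - R * p2 * l + B * X1 * (R * p3 * l - R * p2 * l) + B * X * (R * p2 * l))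
         = R * ((p1 - p2 + B * X1 * (p3 - p2) + B * X * p2) / X)
             * l" for X R p1 p2 p3 l B X1 :: real
        by (simp add: algebra_simps add_divide_distrib diff_divide_distrib)
      then show ?thesis unfolding L_def .
    qed
    ultimately show ?thesis by simp
  qed
  have *: "(\<lambda>i. dual_weight i * L k i * psi (k + 1) i)
      = (\<lambda>i. dual_weight i * L (k + 1) i * psi k i)"
    unfolding L by (simp add: mult_ac)
  have "((\<lambda>i. dual_weight i * L k i * psi (k + 1) i) has_sum
     ((dual_gram (k + 1 - 1) k - dual_gram (k + 1) k + ?B * (1 + xk (k + 1)) * (dual_gram (k + 1
         + 1) k - dual_gram (k + 1) k) +
       ?B * xk (k + 1) * dual_gram (k + 1) k) / xk (k + 1))) UNIV"
    unfolding * by (rule S)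
  \<comment> \<open>By orthogonality each expansion keeps a single diagonal entry: that of
    \<open>k + 1\<close> from \<open>L k\<close>, that of \<open>k\<close> from
    \<open>L (k + 1)\<close>.\<close>
  from has_sum_unique[OF this S] have "dual_gram k k / xk (k + 1)
      = ?B * (1 + xk k) * dual_gram (k + 1) (k + 1) / xk k"
    by (simp add: dual_gram_offdiag)
  then have "dual_gram k k = q * xk k * (?B * (1 + xk k) * dual_gram (k + 1) (k + 1) / xk k)"
    using xk_pos[of k] q_pos unfolding xk_Suc by (simp add: field_simps)
  then show ?thesis
    using xk_pos[of k] q_nz by simp
qed

definition mass :: "int \<Rightarrow> real" where
  "mass k = b powi k / qpoch_inf (- xk k) q"

lemma mass_pos: "mass k > 0"
  unfolding mass_def using b_pos xk_pos[of k] by (intro divide_pos_pos qpoch_inf_pos') auto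

text \<open>The reverse of \<open>dual_gram_step\<close>, so the product of both quantities is
  constant in \<open>k\<close>: this is how the measure emerges from the dual side.\<close>

lemma mass_Suc: "mass (k + 1) = b * (1 + xk k) * mass k"
proof -
  have "qpoch_inf (- xk k) q = (1 + xk k) * qpoch_inf (- xk (k + 1)) q"
    using qpoch_inf_rec[of "- xk k"] by (simp add: xk_Suc mult.commute)
  then show ?thesis
    unfolding mass_def using xk_pos[of k] b_pos by (simp add: power_int_add)
qed

lemma dual_gram_w_const: "dual_gram k k * mass k = dual_gram 0 0 * mass 0"
proof (induction k rule: int_induct[where k = 0])
  case (step1 i)
  then show ?case
    using dual_gram_step[of i] by (simp add: mass_Suc mult_ac)
next
  case (step2 i)
  then show ?case
    using dual_gram_step[of "i - 1"] mass_Suc[of "i - 1"] by (simp add: mult_ac)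
qed simp

end

section \<open>Orthonormal infinite matrices\<close>

definition orthonormal_sums :: "('i \<Rightarrow> 'k \<Rightarrow> real) \<Rightarrow> bool" where
  "orthonormal_sums V \<longleftrightarrow>
     (\<forall>i j. ((\<lambda>k. V i k * V j k) has_sum (if i = j then 1 else 0)) UNIV)"

lemma has_sum_finite_sum:
  fixes f :: "'i \<Rightarrow> 'k \<Rightarrow> real"
  assumes "\<And>i. i \<in> F \<Longrightarrow> (f i has_sum S i) A"
  shows "((\<lambda>x. \<Sum>i\<in>F. f i x) has_sum (\<Sum>i\<in>F. S i)) A"
  using assms by (induction F rule: infinite_finite_induct) (auto intro: has_sum_add)

lemma orthonormal_sums_lincomb:
  assumes "orthonormal_sums V" "finite F"
  shows "((\<lambda>k. (\<Sum>i\<in>F. a i * V i k)\<^sup>2) has_sum (\<Sum>i\<in>F. (a i)\<^sup>2)) UNIV"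
proof -
  have "((\<lambda>k. \<Sum>i\<in>F. \<Sum>j\<in>F. a i * a j * (V i k * V j k)) has_sum
     (\<Sum>i\<in>F. \<Sum>j\<in>F. a i * a j * (if i = j then 1 else 0))) UNIV"
    using assms by (intro has_sum_finite_sum has_sum_cmult_right) (auto simp: orthonormal_sums_def)
  moreover have "(\<Sum>i\<in>F. \<Sum>j\<in>F. a i * a j * (V i k * V j k)) = (\<Sum>i\<in>F. a i * V i k)\<^sup>2" for k
    by (simp add: power2_eq_square sum_product mult_ac)
  moreover have "(\<Sum>i\<in>F. \<Sum>j\<in>F. a i * a j * (if i = j then 1 else 0)) = (\<Sum>i\<in>F. (a i)\<^sup>2)"
    using assms(2) by (simp add: power2_eq_square if_distrib sum.delta cong: if_cong)
  ultimately show ?thesis by simp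
qed

text \<open>Take the combination with coefficients \<open>V i k\<close> and keep only its entry at
  \<open>k\<close>. That entry is the sum T in question, while the squared norm of the combination
  is T as well, so T^2 is at most T.\<close>

lemma orthonormal_sums_bessel:
  assumes "orthonormal_sums V" "finite F"
  shows "(\<Sum>i\<in>F. (V i k)\<^sup>2) \<le> 1"
proof -
  let ?T = "\<Sum>i\<in>F. (V i k)\<^sup>2"
  have "(\<Sum>k'\<in>{k}. (\<Sum>i\<in>F. V i k * V i k')\<^sup>2) \<le> ?T"
    by (rule finite_sum_le_has_sum[OF orthonormal_sums_lincomb[OF assms, of "\<lambda>i. V i k"]]) auto
  then have "?T * ?T \<le> 1 * ?T"
    by (simp add: power2_eq_square)
  moreover have "?T \<ge> 0" by (simp add: sum_nonneg)
  ultimately show ?thesis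
    by (cases "?T = 0") (auto simp: mult_le_cancel_right)
qed

lemma orthonormal_sums_transpose_summable:
  assumes "orthonormal_sums V"
  shows "(\<lambda>i. (V i k)\<^sup>2) summable_on UNIV" "infsum (\<lambda>i. (V i k)\<^sup>2) UNIV \<le> 1"
proof -
  show s: "(\<lambda>i. (V i k)\<^sup>2) summable_on UNIV"
    using orthonormal_sums_bessel[OF assms]
    by (intro nonneg_bdd_above_summable_on bdd_aboveI2[where M = 1]) auto
  show "infsum (\<lambda>i. (V i k)\<^sup>2) UNIV \<le> 1"
    using orthonormal_sums_bessel[OF assms] by (intro infsum_le_finite_sums s)
qed

lemma summable_on_mult_of_squares:
  fixes f g :: "'a \<Rightarrow> real"
  assumes "(\<lambda>x. (f x)\<^sup>2) summable_on A" "(\<lambda>x. (g x)\<^sup>2) summable_on A"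
  shows "(\<lambda>x. f x * g x) summable_on A"
proof -
  have "(\<lambda>x. norm (f x * g x)) summable_on A"
    by (rule Infinite_Sum.abs_summable_product) (use assms in \<open>simp_all add: power2_eq_square abs_mult\<close>)
  then show ?thesis by (rule Infinite_Sum.abs_summable_summable)
qed

text \<open>
  Bessel for the normalised rows gives \<open>\<Sum>\<^sub>i U\<^sub>i\<^sub>k\<^sup>2 / T\<^sub>i \<le> 1 = \<Sum>\<^sub>i U\<^sub>i\<^sub>k\<^sup>2\<close> with \<open>T\<^sub>i \<le> 1\<close>
  the squared norm of row \<open>i\<close>, which forces \<open>T\<^sub>i = 1\<close>.
\<close>

lemma orthonormal_sums_transpose:
  fixes U :: "'i \<Rightarrow> 'k \<Rightarrow> real"
  assumes cols: "orthonormal_sums (\<lambda>k i. U i k)"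
    and orth: "\<And>i j. i \<noteq> j \<Longrightarrow> ((\<lambda>k. U i k * U j k) has_sum 0) UNIV"
    and nz: "\<And>i. \<exists>k. U i k \<noteq> 0"
  shows "orthonormal_sums U"
proof -
  define T where "T i = infsum (\<lambda>k. (U i k)\<^sup>2) UNIV" for i
  have T: "((\<lambda>k. (U i k)\<^sup>2) has_sum T i) UNIV" "T i \<le> 1" for i
    unfolding T_def using orthonormal_sums_transpose_summable[OF cols] by auto
  have Tpos: "T i > 0" for i
  proof -
    obtain k where "U i k \<noteq> 0" using nz by blast
    moreover have "(\<Sum>k\<in>{k}. (U i k)\<^sup>2) \<le> T i"
      by (rule finite_sum_le_has_sum[OF T(1)]) auto
    ultimately show ?thesis
      by (smt (verit, best) finite.intros sum_power2_eq_zero_iff sum.insert sum.empty empty_iff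
          zero_less_power2)
  qed
  have "orthonormal_sums (\<lambda>i k. U i k / sqrt (T i))"
    unfolding orthonormal_sums_def
  proof (intro allI)
    fix i j
    show "((\<lambda>k. U i k / sqrt (T i) * (U j k / sqrt (T j))) has_sum (if i = j then 1 else 0)) UNIV"
    proof (cases "i = j")
      case True
      then show ?thesis
        using has_sum_cmult_right[OF T(1)[of i], of "1 / T i"] Tpos[of i]
        by (simp add: power2_eq_square)
    next
      case False
      then show ?thesis
        using has_sum_cmult_right[OF orth[OF False], of "1 / (sqrt (T i) * sqrt (T j))"] by simp
    qed
  qed
  note bessel = orthonormal_sums_bessel[OF this]
  have "T i = 1" for i
  proof (rule ccontr)
    assume "T i \<noteq> 1"
    then have "T i < 1" using T(2)[of i] by simp
    obtain k where k: "U i k \<noteq> 0" using nz by blast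
    \<comment> \<open>The gain of row \<open>i\<close> at entry \<open>k\<close> under
      normalisation. The normalised rows still obey Bessel, so the original sum over column
      \<open>k\<close> remains at least \<open>\<delta>\<close> below 1.\<close>
    define \<delta> where "\<delta> = (U i k)\<^sup>2 * (1 / T i - 1)"
    have \<delta>: "\<delta> > 0"
      unfolding \<delta>_def using k \<open>T i < 1\<close> Tpos[of i] by simp
    have "(1::real) \<le> 1 - \<delta>"
    proof (rule has_sum_le_finite_sums)
      show "((\<lambda>i. (U i k)\<^sup>2) has_sum 1) UNIV"
        using cols unfolding orthonormal_sums_def power2_eq_square by (metis (full_types))
      fix F :: "'i set" assume "finite F"
      have le: "(U j k)\<^sup>2 \<le> (U j k / sqrt (T j))\<^sup>2" for j
        using T(2)[of j] Tpos[of j] by (simp add: power_divide divide_simps mult_left_le)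
      have "(\<Sum>j\<in>F. (U j k)\<^sup>2) \<le> (\<Sum>j\<in>insert i F. (U j k)\<^sup>2)"
        using \<open>finite F\<close> by (intro sum_mono2) auto
      also have "\<dots> = (U i k)\<^sup>2 + (\<Sum>j\<in>F - {i}. (U j k)\<^sup>2)"
        using \<open>finite F\<close> by (rule sum.insert_remove)
      also have "\<dots> \<le> (U i k)\<^sup>2 + (\<Sum>j\<in>F - {i}. (U j k / sqrt (T j))\<^sup>2)"
        by (intro add_left_mono sum_mono le)
      also have "\<dots> = (\<Sum>j\<in>insert i F. (U j k / sqrt (T j))\<^sup>2) - \<delta>"
        using \<open>finite F\<close> Tpos[of i]
        by (simp add: sum.insert_remove \<delta>_def power_divide algebra_simps)
      also have "\<dots> \<le> 1 - \<delta>"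
        using bessel[of "insert i F" k] \<open>finite F\<close> by simp
      finally show "(\<Sum>j\<in>F. (U j k)\<^sup>2) \<le> 1 - \<delta>" .
    qed
    then show False using \<delta> by simp
  qed
  then show ?thesis
    unfolding orthonormal_sums_def using orth T(1) by (auto simp: power2_eq_square)
qed

lemma has_sum_finite_support:
  fixes f :: "'a \<Rightarrow> real"
  assumes "finite F"
  shows "((\<lambda>x. if x \<in> F then f x else 0) has_sum sum f F) UNIV"
  by (rule has_sum_finite_neutralI[of F]) (use assms in auto)

lemma has_sum_nonneg_finite_approx:
  fixes f :: "'a \<Rightarrow> real"
  assumes "(f has_sum S) UNIV" "\<epsilon> > 0"
  shows "\<exists>F. finite F \<and> S - sum f F < \<epsilon>"
proof (rule ccontr)
  assume *: "\<not> ?thesis"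
  have "S \<le> S - \<epsilon>"
  proof (rule has_sum_le_finite_sums[OF assms(1)])
    fix F :: "'a set"
    assume "finite F"
    then have "\<not> S - sum f F < \<epsilon>"
      using * by blast
    then show "sum f F \<le> S - \<epsilon>" by simp
  qed
  then show False using assms(2) by simp
qed

text \<open>Columns of norm 1 mean that each unit vector satisfies Parseval's identity for the rows.
  So \<open>f\<close> is cut down to a finite set \<open>K\<close>, and its unit vectors are
  projected onto the rows in one common finite set \<open>J\<close>.\<close>

lemma orthonormal_sums_complete:
  fixes U :: "'i \<Rightarrow> 'k \<Rightarrow> real" and f :: "'k \<Rightarrow> complex"
  assumes rows: "orthonormal_sums U"
    and cols: "\<And>k. ((\<lambda>i. (U i k)\<^sup>2) has_sum 1) UNIV"
    and f: "(\<lambda>k. (cmod (f k))\<^sup>2) summable_on UNIV" and "\<epsilon> > 0"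
  shows "\<exists>J a. finite J \<and> (\<lambda>k. (cmod (f k - (\<Sum>i\<in>J. a i * complex_of_real (U i k))))\<^sup>2)
      summable_on UNIV \<and>
    infsum (\<lambda>k. (cmod (f k - (\<Sum>i\<in>J. a i * complex_of_real (U i k))))\<^sup>2) UNIV < \<epsilon>"
proof -
  define S where "S = infsum (\<lambda>k. (cmod (f k))\<^sup>2) UNIV"
  have S: "((\<lambda>k. (cmod (f k))\<^sup>2) has_sum S) UNIV"
    unfolding S_def using f by simp
  obtain K where K: "finite K" "S - (\<Sum>k\<in>K. (cmod (f k))\<^sup>2) < \<epsilon> / 4"
    using has_sum_nonneg_finite_approx[OF S, of "\<epsilon> / 4"] \<open>\<epsilon> > 0\<close> by auto
  define C where "C = (\<Sum>k\<in>K. (cmod (f k))\<^sup>2)"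
  have "C \<ge> 0" unfolding C_def by (simp add: sum_nonneg)
  \<comment> \<open>Chosen so that the residuals of all unit vectors in \<open>K\<close>, weighted
    by \<open>2 * C\<close>, cost at most \<open>\<epsilon> / 4\<close>; the added ones keep the
    denominator positive when \<open>C\<close> or \<open>K\<close> is trivial.\<close>
  define \<eta> where "\<eta> = \<epsilon> / (8 * (C + 1) * (real (card K) + 1))"
  have \<eta>: "\<eta> > 0" unfolding \<eta>_def using \<open>\<epsilon> > 0\<close> \<open>C \<ge> 0\<close> by simp
  have "\<forall>k. \<exists>F. finite F \<and> 1 - (\<Sum>i\<in>F. (U i k)\<^sup>2) < \<eta>"
    using has_sum_nonneg_finite_approx[OF cols \<eta>] by blast
  then obtain Jk where Jk: "\<And>k. finite (Jk k)" "\<And>k. 1 - (\<Sum>i\<in>Jk k. (U i k)\<^sup>2) < \<eta>"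
    by metis
  define J where "J = (\<Union>k\<in>K. Jk k)"
  have J: "finite J" unfolding J_def using K Jk by auto
  have Jsmall: "1 - (\<Sum>i\<in>J. (U i k)\<^sup>2) \<le> \<eta>" if "k \<in> K" for k
  proof -
    have "(\<Sum>i\<in>Jk k. (U i k)\<^sup>2) \<le> (\<Sum>i\<in>J. (U i k)\<^sup>2)"
      using that by (intro sum_mono2 J) (auto simp: J_def)
    then show ?thesis using Jk(2)[of k] by simp
  qed
  \<comment> \<open>The expansion coefficients of \<open>f\<close> truncated to
    \<open>K\<close>.\<close>
  define a where "a i = (\<Sum>k\<in>K. f k * complex_of_real (U i k))" for i
  \<comment> \<open>The \<open>k\<close>-th unit vector minus its projection onto the rows in
    \<open>J\<close>; its squared norm is the Parseval defect of that vector.\<close>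
  define R where "R k l = (if l = k then 1 else 0) - (\<Sum>i\<in>J. U i k * U i l)" for k l
  have R: "((\<lambda>l. (R k l)\<^sup>2) has_sum (1 - (\<Sum>i\<in>J. (U i k)\<^sup>2))) UNIV" for k
  proof -
    have "((\<lambda>l. (if l \<in> {k} then 1 - 2 * (\<Sum>i\<in>J. U i k * U i l) else 0) + (\<Sum>i\<in>J. U i k
        * U i l)\<^sup>2) has_sum
       ((\<Sum>l\<in>{k}. 1 - 2 * (\<Sum>i\<in>J. U i k * U i l)) + (\<Sum>i\<in>J. (U i k)\<^sup>2))) UNIV"
      by (intro has_sum_add has_sum_finite_support orthonormal_sums_lincomb rows J) simp
    moreover have "(if l \<in> {k} then 1 - 2 * (\<Sum>i\<in>J. U i k * U i l) else 0) + (\<Sum>i\<in>J. U i k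
        * U i l)\<^sup>2 = (R k l)\<^sup>2" for l
      unfolding R_def by (simp add: power2_diff)
    ultimately show ?thesis by (simp add: power2_eq_square)
  qed
  define g where "g l = (if l \<in> K then 0 else f l)" for l
  have "((\<lambda>l. (cmod (f l))\<^sup>2 - (if l \<in> K then (cmod (f l))\<^sup>2 else 0)) has_sum (S - C)) UNIV"
    unfolding C_def by (intro has_sum_diff S has_sum_finite_support K)
  moreover have "(cmod (f l))\<^sup>2 - (if l \<in> K then (cmod (f l))\<^sup>2 else 0) = (cmod (g l))\<^sup>2" for l
    by (simp add: g_def)
  ultimately have g: "((\<lambda>l. (cmod (g l))\<^sup>2) has_sum (S - C)) UNIV"
    by simp
  have res: "f l - (\<Sum>i\<in>J. a i * complex_of_real (U i l))
      = g l + (\<Sum>k\<in>K. f k * complex_of_real (R k l))" for l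
  proof -
    have "(\<Sum>i\<in>J. a i * complex_of_real (U i l))
        = (\<Sum>k\<in>K. f k * complex_of_real (\<Sum>i\<in>J. U i k * U i l))"
      unfolding a_def by (simp add: sum_distrib_left sum_distrib_right mult.assoc) (rule sum.swap)
    moreover have "(\<Sum>k\<in>K. f k * complex_of_real (R k l)) =
        (\<Sum>k\<in>K. if l = k then f k else 0) - (\<Sum>k\<in>K. f k * complex_of_real (\<Sum>i\<in>J. U i k * U i l))"
      unfolding R_def sum_subtractf[symmetric]
      by (intro sum.cong refl) (simp add: algebra_simps)
    ultimately show ?thesis
      using K(1) by (simp add: g_def)
  qed
  define H where "H l = 2 * (cmod (g l))\<^sup>2 + 2 * C * (\<Sum>k\<in>K. (R k l)\<^sup>2)" for l
  have bound: "(cmod (f l - (\<Sum>i\<in>J. a i * complex_of_real (U i l))))\<^sup>2 \<le> H l" for l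
  proof -
    let ?t = "\<Sum>k\<in>K. f k * complex_of_real (R k l)"
    have "cmod ?t \<le> (\<Sum>k\<in>K. cmod (f k) * \<bar>R k l\<bar>)"
      by (rule order.trans[OF norm_sum]) (simp add: norm_mult)
    then have "(cmod ?t)\<^sup>2 \<le> (\<Sum>k\<in>K. cmod (f k) * \<bar>R k l\<bar>)\<^sup>2"
      by (intro power_mono) auto
    also have "\<dots> \<le> (\<Sum>k\<in>K. (cmod (f k))\<^sup>2) * (\<Sum>k\<in>K. \<bar>R k l\<bar>\<^sup>2)"
      by (rule Cauchy_Schwarz_ineq_sum)
    finally have t: "(cmod ?t)\<^sup>2 \<le> C * (\<Sum>k\<in>K. (R k l)\<^sup>2)"
      by (simp add: C_def)
    have "(cmod (g l + ?t))\<^sup>2 \<le> (cmod (g l) + cmod ?t)\<^sup>2"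
      by (intro power_mono norm_triangle_ineq) auto
    also have "\<dots> \<le> 2 * (cmod (g l))\<^sup>2 + 2 * (cmod ?t)\<^sup>2"
      using sum_squares_bound[of "cmod (g l)" "cmod ?t"] by (simp add: power2_sum)
    also have "\<dots> \<le> H l"
      unfolding H_def using t by simp
    finally show ?thesis unfolding res .
  qed
  have H: "(H has_sum (2 * (S - C) + 2 * C * (\<Sum>k\<in>K. 1 - (\<Sum>i\<in>J. (U i k)\<^sup>2)))) UNIV"
    unfolding H_def by (intro has_sum_add has_sum_cmult_right g has_sum_finite_sum R)
  have s: "(\<lambda>k. (cmod (f k - (\<Sum>i\<in>J. a i * complex_of_real (U i k))))\<^sup>2) summable_on UNIV"
    by (rule summable_on_comparison_test[OF has_sum_imp_summable[OF H] bound]) auto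
  have "infsum (\<lambda>k. (cmod (f k - (\<Sum>i\<in>J. a i * complex_of_real (U i k))))\<^sup>2) UNIV \<le>
      2 * (S - C) + 2 * C * (\<Sum>k\<in>K. 1 - (\<Sum>i\<in>J. (U i k)\<^sup>2))"
    by (rule has_sum_mono[OF has_sum_infsum[OF s] H bound])
  also have "\<dots> \<le> 2 * (S - C) + 2 * C * (\<Sum>k\<in>K. \<eta>)"
    using \<open>C \<ge> 0\<close> Jsmall by (intro add_left_mono mult_left_mono sum_mono) auto
  also have "2 * C * (\<Sum>k\<in>K. \<eta>) \<le> 2 * (C + 1) * (real (card K) + 1) * \<eta>"
  proof -
    have "C * real (card K) \<le> (C + 1) * (real (card K) + 1)"
      using \<open>C \<ge> 0\<close> by (intro mult_mono) auto
    then have "C * real (card K) * (2 * \<eta>) \<le> (C + 1) * (real (card K) + 1) * (2 * \<eta>)"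
      using \<eta> by (intro mult_right_mono) auto
    then show ?thesis by (simp only: sum_constant mult_ac)
  qed
  also have "2 * (C + 1) * (real (card K) + 1) * \<eta> = \<epsilon> / 4"
  proof -
    have "2 * X * Y * (\<epsilon> / (8 * X * Y)) = \<epsilon> / 4" if "X > 0" "Y > 0" for X Y
      using that by (simp add: field_simps)
    from this[of "C + 1" "real (card K) + 1"] show ?thesis
      unfolding \<eta>_def using \<open>C \<ge> 0\<close> by (simp only:)
  qed
  also have "2 * (S - C) + \<epsilon> / 4 < \<epsilon>"
    using K(2) \<open>\<epsilon> > 0\<close> unfolding C_def[symmetric] by simp
  finally show ?thesis
    using J s by (intro exI[of _ J] exI[of _ a]) simp
qed

section \<open>Orthogonality and completeness over the lattice\<close>

context qlag_param
begin

text \<open>The quotient of the prefactors at \<open>k + 1\<close> and \<open>k\<close> is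
  \<open>b / q * (1 + xk k)\<close>, the coefficient of \<open>psi (k + 1)\<close> in the
  recurrence; this makes the determinant telescope.\<close>

definition casoratian :: "int + nat \<Rightarrow> int + nat \<Rightarrow> int \<Rightarrow> real" where
  "casoratian i j k = mass k / xk k * (psi k i * psi (k - 1) j - psi (k - 1) i * psi k j)"

lemma casoratian_step:
  "casoratian i j (k + 1) - casoratian i j k = b / q * (spec i - spec j) * (mass k * (psi k i
      * psi k j))"
proof -
  have A: "mass (k + 1) / xk (k + 1) = b / q * (1 + xk k) * (mass k / xk k)"
    unfolding mass_Suc xk_Suc using q_nz by simp
  have rec: "psi (k - 1) i + b / q * (1 + xk k) * psi (k + 1) i =
      psi k i + b / q * (1 + xk k) * psi k i - b / q * (1 - spec i) * xk k * psi k i" for i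
    using psi_recurrence[of k i] by (simp add: algebra_simps)
  have "casoratian i j (k + 1) - casoratian i j k = mass k / xk k *
      ((psi (k - 1) i + b / q * (1 + xk k) * psi (k + 1) i) * psi k j -
       (psi (k - 1) j + b / q * (1 + xk k) * psi (k + 1) j) * psi k i)"
  proof -
    have aux: "B * A * (z1 * y - x1 * z2) - A * (x1 * y0 - z0 * y)
        = A * ((z0 + B * z1) * y - (y0 + B * z2) * x1)"
      for A B x1 y y0 z0 z1 z2 :: real
      by (simp add: algebra_simps)
    show ?thesis
      unfolding casoratian_def A add_diff_cancel_right' by (rule aux)
  qed
  also have "\<dots> = mass k / xk k * (b / q * (spec i - spec j) * xk k * (psi k i * psi k j))"
    unfolding rec by (simp add: algebra_simps diff_divide_distrib)
  finally show ?thesis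
    using xk_pos[of k] by simp
qed

definition norm_const :: real where "norm_const = dual_gram 0 0 * mass 0"

lemma newton_1: "newton j 1 = (if j = 0 then 1 else 0)"
  by (induction j) (auto simp: newton_Suc)

text \<open>At \<open>s = 1\<close> the first node annihilates every Newton polynomial of positive
  degree.\<close>

lemma psi_Inr_0 [simp]: "psi k (Inr 0) = 1"
proof -
  have "(\<lambda>j. phi_coeff j * xk k ^ j * newton j 1) sums (phi_coeff 0 * xk k ^ 0 * newton 0 1)"
    by (rule sums_single[of 0, THEN sums_cong[THEN iffD1, rotated]]) (auto simp: newton_1)
  with phi_sums[of "xk k" 1] have "phi (xk k) 1 = 1"
    using sums_unique2 by fastforce
  then show ?thesis by (simp add: psi_def spec_def)
qed

lemma norm_const_pos: "norm_const > 0"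
proof -
  have "(\<Sum>i\<in>{Inr 0}. dual_weight i * psi 0 i * psi 0 i) \<le> dual_gram 0 0"
    by (rule finite_sum_le_has_sum[OF dual_gram_has_sum]) (simp_all add: mult.assoc less_imp_le
        dual_weight_pos)
  then have "dual_gram 0 0 > 0"
    using dual_weight_pos[of "Inr 0"] by simp
  then show ?thesis
    unfolding norm_const_def using mass_pos by simp
qed

section \<open>The normalised matrix of values and its rows\<close>

definition unitary :: "int + nat \<Rightarrow> int \<Rightarrow> real" where
  "unitary i k = sqrt (mass k * dual_weight i / norm_const) * psi k i"

lemma unitary_cols: "orthonormal_sums (\<lambda>k i. unitary i k)"
  unfolding orthonormal_sums_def
proof (intro allI)
  fix k l
  have nn: "mass k \<ge> 0" "dual_weight i \<ge> 0" "norm_const \<ge> 0" for k i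
    using mass_pos dual_weight_pos norm_const_pos by (auto intro: less_imp_le)
  have "unitary i k * unitary i l = sqrt (mass k * mass l) / norm_const * (dual_weight i * psi k i
      * psi l i)" for i
  proof -
    have "sqrt (mass k * dual_weight i / norm_const) * sqrt (mass l * dual_weight i / norm_const)
        = sqrt (mass k * mass l) * (dual_weight i / norm_const)"
      using nn(1)[of k] nn(1)[of l] nn(2)[of i] nn(3) by (simp add: real_sqrt_mult real_sqrt_divide)
    then show ?thesis
      unfolding unitary_def by (simp add: mult_ac)
  qed
  moreover have "sqrt (mass k * mass l) / norm_const * dual_gram k l = (if k = l then 1 else 0)"
    using dual_gram_offdiag[of k l] dual_gram_w_const[of k] norm_const_pos mass_pos[of k]
        by (auto simp: norm_const_def mult.commute)
  ultimately show "((\<lambda>i. unitary i k * unitary i l) has_sum (if k = l then 1 else 0)) UNIV"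
    using has_sum_cmult_right[OF dual_gram_has_sum[of k l], of "sqrt (mass k
        * mass l) / norm_const"] by simp
qed

text \<open>Up to a constant this is a row of \<open>unitary\<close>, so Bessel's inequality for its
  orthonormal columns applies; no growth estimate in \<open>k\<close> enters.\<close>

lemma sqrt_w_psi_summable: "(\<lambda>k. (sqrt (mass k) * psi k i)\<^sup>2) summable_on UNIV"
proof -
  have "(sqrt (mass k) * psi k i)\<^sup>2 = norm_const / dual_weight i * (unitary i k)\<^sup>2" for k
    unfolding unitary_def power_mult_distrib
    using mass_pos[of k] dual_weight_pos[of i] norm_const_pos by (simp add: field_simps)
  then show ?thesis
    by (simp only: summable_on_cmult_right orthonormal_sums_transpose_summable(1)[OF unitary_cols])
qed

lemma mass_psi_psi_summable: "(\<lambda>k. mass k * (psi k i * psi k j)) summable_on UNIV"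
proof -
  have "(\<lambda>k. (sqrt (mass k) * psi k i) * (sqrt (mass k) * psi k j)) summable_on UNIV"
    by (intro summable_on_mult_of_squares sqrt_w_psi_summable)
  moreover have "(sqrt (mass k) * psi k i) * (sqrt (mass k) * psi k j)
      = mass k * (psi k i * psi k j)" for k
    using mass_pos[of k] by simp
  ultimately show ?thesis by simp
qed

lemma xk_tendsto_0: "(\<lambda>n. xk (int n)) \<longlonglongrightarrow> 0"
proof -
  have "(\<lambda>n. c * q ^ n) \<longlonglongrightarrow> c * 0"
    by (intro tendsto_intros q_power_tendsto_0)
  then show ?thesis by (simp add: xk_def)
qed

lemma mass_tendsto_0: "(\<lambda>n. mass (int n)) \<longlonglongrightarrow> 0"
proof -
  have "(\<lambda>n. b ^ n / qpoch_inf (- xk (int n)) q) \<longlonglongrightarrow> 0 / qpoch_inf (- 0) q"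
    using b_pos b_less_1 by (intro tendsto_intros xk_tendsto_0 LIMSEQ_realpow_zero) auto
  then show ?thesis by (simp add: mass_def)
qed

lemma psi_quotient_tendsto: "(\<lambda>n. (psi (int n) i - 1) / xk (int n))
    \<longlonglongrightarrow> phi_coeff 1 * newton 1 (spec i)"
proof -
  have "((\<lambda>x. (phi x (spec i) - 1) / x) \<longlongrightarrow> phi_coeff 1 * newton 1 (spec i)) (at 0)"
    using phi_deriv_0[of "spec i"] by (simp add: has_field_derivative_iff)
  moreover have "filterlim (\<lambda>n. xk (int n)) (at 0) sequentially"
    using xk_tendsto_0 xk_pos by (auto simp: filterlim_at less_le)
  ultimately show ?thesis
    unfolding psi_def by (rule filterlim_compose)
qed

text \<open>The prefactor behaves like (b/q)^k and may grow. Since every \<open>psi k i\<close> is 1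
  up to an error of order \<open>xk k\<close>, the determinant itself has order \<open>xk k\<close>,
  and a multiple of \<open>mass k\<close> remains.\<close>

lemma casoratian_pos_tendsto: "(\<lambda>n. casoratian i j (int n)) \<longlonglongrightarrow> 0"
proof -
  define Y where "Y i n = (psi (int n) i - 1) / xk (int n)" for i n
  have Y: "Y i \<longlonglongrightarrow> phi_coeff 1 * newton 1 (spec i)" for i
    unfolding Y_def by (rule psi_quotient_tendsto)
  have psi: "psi (int n) i = 1 + xk (int n) * Y i n" for i n
    unfolding Y_def using xk_pos[of "int n"] by simp
  have "casoratian i j (int (Suc n)) = mass (int (Suc n)) *
     (Y i (Suc n) - Y j (Suc n) + (Y j n - Y i n) / q + xk (int n) * (Y i (Suc n) * Y j n - Y i n
         * Y j (Suc n)))" for n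
  proof -
    have k1: "int (Suc n) - 1 = int n" by simp
    have x: "xk (int (Suc n)) = q * xk (int n)"
      using xk_Suc[of "int n"] by (simp add: add.commute)
    have "W / (q * X) * ((1 + q * X * a) * (1 + X * bb) - (1 + X * cc) * (1 + q * X * dd)) =
       W * (a - dd + (bb - cc) / q + X * (a * bb - cc * dd))" if "X > 0" for W X a bb cc dd :: real
      using that q_nz by (simp add: field_simps)
    from this[OF xk_pos[of "int n"]] show ?thesis
      unfolding casoratian_def k1 psi x by simp
  qed
  moreover have "(\<lambda>n. mass (int (Suc n)) *
     (Y i (Suc n) - Y j (Suc n) + (Y j n - Y i n) / q + xk (int n) * (Y i (Suc n) * Y j n - Y i n
         * Y j (Suc n))))
     \<longlonglongrightarrow> 0 * (phi_coeff 1 * newton 1 (spec i) - phi_coeff 1 * newton 1 (spec j) + (phi_coeff 1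
         * newton 1 (spec j) - phi_coeff 1 * newton 1 (spec i)) / q +
       0 * (phi_coeff 1 * newton 1 (spec i) * (phi_coeff 1 * newton 1 (spec j)) - phi_coeff 1
           * newton 1 (spec i) * (phi_coeff 1 * newton 1 (spec j))))"
    using q_nz by (intro tendsto_mult tendsto_add tendsto_diff tendsto_divide tendsto_const
        LIMSEQ_Suc[OF mass_tendsto_0] LIMSEQ_Suc[OF Y] Y xk_tendsto_0)
  ultimately have "(\<lambda>n. casoratian i j (int (Suc n))) \<longlonglongrightarrow> 0"
    by simp
  then show ?thesis by (rule LIMSEQ_imp_Suc)
qed

text \<open>Distributing square roots of the masses over the determinant leaves entries that tend to
  0 by square summability, and a factor \<open>\<gamma>\<close> that is bounded because
  \<open>xk k \<ge> c\<close> for \<open>k \<le> 0\<close>.\<close>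

lemma casoratian_neg_tendsto: "(\<lambda>n. casoratian i j (- int n)) \<longlonglongrightarrow> 0"
proof -
  define h where "h i k = sqrt (mass k) * psi k i" for i k
  have h: "(\<lambda>n. h i (- int n)) \<longlonglongrightarrow> 0" for i
  proof -
    have "(\<lambda>n. (h i (- int n))\<^sup>2) \<longlonglongrightarrow> 0"
      unfolding h_def by (rule summable_on_int_tendsto_0(2)[OF sqrt_w_psi_summable])
    from tendsto_real_sqrt[OF this] show ?thesis
      by (simp add: tendsto_rabs_zero_iff)
  qed
  have h': "(\<lambda>n. h i (- int n - 1)) \<longlonglongrightarrow> 0" for i
  proof -
    have "- int n - 1 = - int (Suc n)" for n by simp
    then show ?thesis
      using LIMSEQ_Suc[OF h[of i]] by (simp only:)
  qed
  define \<gamma> where "\<gamma> k = mass k / xk k / (sqrt (mass k) * sqrt (mass (k - 1)))" for k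
  have casoratian: "casoratian i j k = \<gamma> k * (h i k * h j (k - 1) - h i (k - 1) * h j k)" for k
  proof -
    have aux: "A * (y * z - y' * z') = A / (P * Q) * (P * y * (Q * z) - Q * y' * (P * z'))"
      if "P > 0" "Q > 0" for A P Q y y' z z' :: real
      using that by (simp add: field_simps)
    show ?thesis
      unfolding casoratian_def \<gamma>_def h_def by (rule aux) (use mass_pos in simp_all)
  qed
  have \<gamma>: "(\<gamma> k)\<^sup>2 = b * (1 / (xk k)\<^sup>2 + 1 / (q * xk k))" for k
  proof -
    have xk: "xk (k - 1) = xk k / q"
      using xk_Suc[of "k - 1"] q_nz by simp
    have "mass k = b * (1 + xk k / q) * mass (k - 1)"
      using mass_Suc[of "k - 1"] unfolding xk by simp
    moreover have "(\<gamma> k)\<^sup>2 = mass k / ((xk k)\<^sup>2 * mass (k - 1))"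
      unfolding \<gamma>_def power_divide power_mult_distrib
      using mass_pos[of k] mass_pos[of "k - 1"] by (simp add: field_simps power2_eq_square)
    moreover have "b * (1 + X / q) * W / (X\<^sup>2 * W) = b * (1 / X\<^sup>2 + 1 / (q * X))"
      if "X > 0" "W > 0" for X W
      using that q_nz by (simp add: field_simps power2_eq_square)
    ultimately show ?thesis
      using mass_pos[of "k - 1"] xk_pos[of k] by simp
  qed
  have xk1: "xk (- int n) \<ge> c" for n
  proof -
    have "q ^ n \<le> 1" "q ^ n > 0" using q_pos q_less_1 by (auto intro: power_le_one)
    then show ?thesis
      unfolding xk_def using c_pos by (simp add: power_int_minus field_simps)
  qed
  define K where "K = sqrt (b * (1 / c\<^sup>2 + 1 / (q * c)))"
  have K: "\<bar>\<gamma> (- int n)\<bar> \<le> K" for n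
  proof -
    have "1 / (xk (- int n))\<^sup>2 \<le> 1 / c\<^sup>2" "1 / (q * xk (- int n)) \<le> 1 / (q * c)"
      using xk1[of n] c_pos q_pos by (auto intro!: divide_left_mono power_mono mult_pos_pos)
    then have "(\<gamma> (- int n))\<^sup>2 \<le> b * (1 / c\<^sup>2 + 1 / (q * c))"
      unfolding \<gamma> using b_pos by (intro mult_left_mono add_mono) auto
    then have "sqrt ((\<gamma> (- int n))\<^sup>2) \<le> sqrt (b * (1 / c\<^sup>2 + 1 / (q * c)))"
      by (rule real_sqrt_le_mono)
    then show ?thesis
      by (simp add: K_def)
  qed
  let ?H = "\<lambda>n. h i (- int n) * h j (- int n - 1) - h i (- int n - 1) * h j (- int n)"
  have "(\<lambda>n. h i (- int n) * h j (- int n - 1) - h i (- int n - 1) * h j (- int n)) \<longlonglongrightarrow> 0 * 0 - 0 * 0"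
    by (intro tendsto_mult tendsto_diff h h')
  then have lim: "(\<lambda>n. K * \<bar>?H n\<bar>) \<longlonglongrightarrow> K * \<bar>0 * 0 - 0 * 0\<bar>"
    by (intro tendsto_mult tendsto_const tendsto_rabs)
  have le: "norm (casoratian i j (- int n)) \<le> K * \<bar>?H n\<bar>" for n
    unfolding casoratian using mult_right_mono[OF K, of "\<bar>?H n\<bar>" n] by (simp add: abs_mult)
  show ?thesis
  proof (rule Lim_null_comparison)
    show "\<forall>\<^sub>F n in sequentially. norm (casoratian i j (- int n)) \<le> K * \<bar>?H n\<bar>"
      by (intro always_eventually allI le)
    show "(\<lambda>n. K * \<bar>?H n\<bar>) \<longlonglongrightarrow> 0"
      using lim by simp
  qed
qed

lemma spec_inj: "spec i = spec j \<longleftrightarrow> i = j"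
proof
  assume eq: "spec i = spec j"
  have 1: "p = p'" if "s0 * q powi p = s0 * q powi p'" for p p'
  proof (rule ccontr)
    assume "p \<noteq> p'"
    then consider "p < p'" | "p' < p" by linarith
    then show False
      using that s0_neg power_int_strict_decreasing[OF _ q_pos q_less_1, of p p']
        power_int_strict_decreasing[OF _ q_pos q_less_1, of p' p] by cases auto
  qed
  have 2: "n = n'" if "q ^ n = q ^ n'" for n n'
  proof (rule ccontr)
    assume "n \<noteq> n'"
    then consider "n < n'" | "n' < n" by linarith
    then show False
      using that power_strict_decreasing[OF _ q_pos q_less_1, of n n']
        power_strict_decreasing[OF _ q_pos q_less_1, of n' n] by cases auto
  qed
  show "i = j"
  proof (cases i; cases j)
    fix p p' assume "i = Inl p" "j = Inl p'"
    then show ?thesis using eq 1 by (simp add: spec_def)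
  next
    fix n n' assume "i = Inr n" "j = Inr n'"
    then show ?thesis using eq 2 by (simp add: spec_def)
  next
    fix p n assume "i = Inl p" "j = Inr n"
    then show ?thesis using eq spec_Inl_neg[of p] spec_Inr_pos[of n] by simp
  next
    fix p n assume "i = Inr n" "j = Inl p"
    then show ?thesis using eq spec_Inl_neg[of p] spec_Inr_pos[of n] by simp
  qed
qed simp

lemma row_orthogonal:
  assumes "i \<noteq> j"
  shows "((\<lambda>k. mass k * (psi k i * psi k j)) has_sum 0) UNIV"
proof -
  define B where "B = b / q * (spec i - spec j)"
  have B: "B \<noteq> 0"
    unfolding B_def using assms b_pos q_nz spec_inj[of i j] by simp
  have "((\<lambda>k. casoratian i j (k + 1) - casoratian i j k) has_sum (0 - 0)) UNIV"
    by (intro has_sum_telescope_int casoratian_pos_tendsto casoratian_neg_tendsto)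
       (simp only: casoratian_step summable_on_cmult_right mass_psi_psi_summable)
  then have "((\<lambda>k. B * (mass k * (psi k i * psi k j))) has_sum 0) UNIV"
    by (simp only: casoratian_step B_def diff_self)
  from has_sum_cmult_right[OF this, of "1 / B"] show ?thesis
    using B by simp
qed

lemma unitary_rows: "orthonormal_sums unitary"
proof (rule orthonormal_sums_transpose[OF unitary_cols])
  fix i j :: "int + nat" assume "i \<noteq> j"
  have "unitary i k * unitary j k = sqrt (dual_weight i * dual_weight j) / norm_const * (mass k
      * (psi k i * psi k j))" for k
  proof -
    have "sqrt (mass k * dual_weight i / norm_const) * sqrt (mass k * dual_weight j / norm_const)
        = sqrt (dual_weight i * dual_weight j) * (mass k / norm_const)"
      using mass_pos[of k] norm_const_pos by (simp add: real_sqrt_mult real_sqrt_divide)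
    then show ?thesis
      unfolding unitary_def by (simp add: mult_ac)
  qed
  then show "((\<lambda>k. unitary i k * unitary j k) has_sum 0) UNIV"
    using has_sum_cmult_right[OF row_orthogonal[OF \<open>i \<noteq> j\<close>], of "sqrt (dual_weight i
        * dual_weight j) / norm_const"] by simp
next
  fix i
  \<comment> \<open>Multiplying the difference quotient back by \<open>xk\<close> shows that
    \<open>psi (int n) i\<close> tends to 1, so no row vanishes identically.\<close>
  have "(\<lambda>n. (psi (int n) i - 1) / xk (int n) * xk (int n) + 1)
      \<longlonglongrightarrow> phi_coeff 1 * newton 1 (spec i) * 0 + 1"
    by (intro tendsto_intros psi_quotient_tendsto xk_tendsto_0)
  then have "(\<lambda>n. psi (int n) i) \<longlonglongrightarrow> 1"
    using xk_pos by (simp add: less_le)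
  then have "\<forall>\<^sub>F n in sequentially. psi (int n) i > 0"
    by (rule order_tendstoD) simp
  then obtain n where "psi (int n) i > 0"
    by (auto simp: eventually_sequentially)
  then have "unitary i (int n) \<noteq> 0"
    unfolding unitary_def using mass_pos[of "int n"] dual_weight_pos[of i] norm_const_pos by simp
  then show "\<exists>k. unitary i k \<noteq> 0" ..
qed

lemma row_has_sum:
  "((\<lambda>k. mass k * (psi k i * psi k j)) has_sum (if i
      = j then norm_const / dual_weight i else 0)) UNIV"
proof (cases "i = j")
  case True
  have "((\<lambda>k. unitary i k * unitary i k) has_sum 1) UNIV"
    using unitary_rows unfolding orthonormal_sums_def by (metis (full_types))
  moreover have "norm_const / dual_weight i * (unitary i k * unitary i k)
      = mass k * (psi k i * psi k i)" for k
    unfolding unitary_def using mass_pos[of k] dual_weight_pos[of i] norm_const_pos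
        by (simp add: field_simps flip: power2_eq_square)
  ultimately show ?thesis
    using has_sum_cmult_right[of "\<lambda>k. unitary i k
        * unitary i k" UNIV 1 "norm_const / dual_weight i"] True by simp
qed (simp add: row_orthogonal)

text \<open>The row of \<open>Inr 0\<close> is constantly 1, so its squared norm is the total mass,
  which is Ramanujan's sum at \<open>z = b\<close>; the weight at \<open>s = 1\<close> converts it
  into the constant.\<close>

lemma norm_const_eq:
  "norm_const = qpoch_inf q q * qpoch_inf (- c * b) q * qpoch_inf (- (q / (c * b))) q /
     (qpoch_inf b q * qpoch_inf (- c) q * qpoch_inf (- (q / c)) q)
         * (qpoch_inf q q / qpoch_inf b q)"
proof -
  have "(mass has_sum norm_const / dual_weight (Inr 0)) UNIV"
    using row_has_sum[of "Inr 0" "Inr 0"] by simp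
  moreover have "mass = (\<lambda>k. b powi k / qpoch_inf (- c * q powi k) q)"
    by (simp add: mass_def xk_def fun_eq_iff)
  then have "(mass has_sum (qpoch_inf q q * qpoch_inf (- c * b) q * qpoch_inf (- (q / (c * b))) q /
     (qpoch_inf b q * qpoch_inf (- c) q * qpoch_inf (- (q / c)) q))) UNIV"
    using ramanujan_1psi1[OF c_pos b_pos b_less_1] by simp
  ultimately have "norm_const / dual_weight (Inr 0)
      = qpoch_inf q q * qpoch_inf (- c * b) q * qpoch_inf (- (q / (c * b))) q /
     (qpoch_inf b q * qpoch_inf (- c) q * qpoch_inf (- (q / c)) q)"
    by (rule has_sum_unique)
  moreover have "dual_weight (Inr 0) = qpoch_inf q q / qpoch_inf b q"
    by (simp add: dual_weight_def spec_def dual_density_def)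
  ultimately show ?thesis
    using dual_weight_pos[of "Inr 0"] by (metis less_irrefl nonzero_divide_eq_eq)
qed

text \<open>Multiplication by \<open>sqrt (mass k)\<close> is an isometry onto the unweighted space;
  it turns \<open>psi\<close> into \<open>unitary\<close> up to factors that depend only on the
  row.\<close>

lemma psi_complete:
  fixes f :: "int \<Rightarrow> complex"
  assumes "(\<lambda>k. mass k * (cmod (f k))\<^sup>2) summable_on UNIV" "\<epsilon> > 0"
  shows "\<exists>J a. finite J \<and>
    (\<lambda>k. mass k * (cmod (f k - (\<Sum>i\<in>J. a i * complex_of_real (psi k i))))\<^sup>2) summable_on UNIV \<and>
    infsum (\<lambda>k. mass k * (cmod (f k - (\<Sum>i\<in>J. a i * complex_of_real (psi k i))))\<^sup>2) UNIV < \<epsilon>"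
proof -
  define g where "g k = complex_of_real (sqrt (mass k)) * f k" for k
  have wn: "\<bar>mass k\<bar> = mass k" "(sqrt (mass k))\<^sup>2 = mass k" for k using mass_pos[of k] by auto
  have "(\<lambda>k. (cmod (g k))\<^sup>2) summable_on UNIV"
    using assms(1) by (simp add: g_def norm_mult power_mult_distrib wn)
  moreover have "((\<lambda>i. (unitary i k)\<^sup>2) has_sum 1) UNIV" for k
    using unitary_cols unfolding orthonormal_sums_def power2_eq_square by (metis (full_types))
  ultimately obtain J a where J: "finite J"
    "(\<lambda>k. (cmod (g k - (\<Sum>i\<in>J. a i * complex_of_real (unitary i k))))\<^sup>2) summable_on UNIV"
    "infsum (\<lambda>k. (cmod (g k - (\<Sum>i\<in>J. a i * complex_of_real (unitary i k))))\<^sup>2) UNIV < \<epsilon>"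
    using orthonormal_sums_complete[OF unitary_rows] assms(2) by blast
  define a' where "a' i = a i * complex_of_real (sqrt (dual_weight i / norm_const))" for i
  have eq: "(cmod (g k - (\<Sum>i\<in>J. a i * complex_of_real (unitary i k))))\<^sup>2 =
      mass k * (cmod (f k - (\<Sum>i\<in>J. a' i * complex_of_real (psi k i))))\<^sup>2" for k
  proof -
    have "unitary i k = sqrt (mass k) * (sqrt (dual_weight i / norm_const) * psi k i)" for i
      unfolding unitary_def by (simp add: real_sqrt_mult real_sqrt_divide)
    then have "g k - (\<Sum>i\<in>J. a i * complex_of_real (unitary i k)) =
        complex_of_real (sqrt (mass k)) * (f k - (\<Sum>i\<in>J. a' i * complex_of_real (psi k i)))"
      unfolding g_def a'_def by (simp add: right_diff_distrib sum_distrib_left mult_ac)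
    then show ?thesis
      by (simp add: norm_mult power_mult_distrib wn)
  qed
  show ?thesis
    using J unfolding eq by blast
qed

end

section \<open>The orthogonal basis\<close>

locale qlag_basis = q_param +
  fixes \<alpha> c :: real
  assumes alpha: "-1 < \<alpha>" and c_positive: "0 < c"

sublocale qlag_basis \<subseteq> qlag_param q "q powr (\<alpha> + 1)" c
proof
  show "0 < q powr (\<alpha> + 1)" using q_pos by simp
  have "q powr (\<alpha> + 1) < q powr 0"
    using alpha q_pos q_less_1 by (intro powr_less_mono') auto
  then show "q powr (\<alpha> + 1) < 1" using q_pos by simp
qed (rule c_positive)

context qlag_basis
begin

lemma q_powi_powr: "q powi k = q powr of_int k"
  using powr_real_of_int'[of q k] q_pos by simp

lemma mass_eq_mass: "mass k = qlag_mass q \<alpha> c k"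
proof -
  have "(q powr (\<alpha> + 1)) powi k = q powr (of_int k * (\<alpha> + 1))"
    using q_pos by (subst powr_real_of_int'[symmetric]) (auto simp: powr_powr mult.commute)
  then show ?thesis
    by (simp add: mass_def qlag_mass_def xk_def)
qed

lemma functional_has_sum:
  fixes f :: "real \<Rightarrow> real"
  assumes "((\<lambda>k. mass k * f (xk k)) has_sum S) UNIV"
  shows "integrable (qlag_measure q \<alpha> c) f" "qlag_functional q \<alpha> c f = S"
proof -
  have *: "((\<lambda>k. qlag_mass q \<alpha> c k *\<^sub>R f (c * q powi k)) has_sum S) UNIV"
    using assms by (simp add: mass_eq_mass xk_def)
  show int: "integrable (qlag_measure q \<alpha> c) f"
    unfolding integrable_qlag_measure_iff[OF q_pos q_less_1 c_pos]
    using has_sum_imp_summable[OF *] by (rule summable_on_iff_abs_summable_on_real[THEN iffD1])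
  show "qlag_functional q \<alpha> c f = S"
    unfolding qlag_functional_eq_infsum[OF q_pos q_less_1 c_pos int] using * by (rule infsumI)
qed

section \<open>The basis functions on the lattice and their norms\<close>

definition basis_fun :: "int + nat \<Rightarrow> real \<Rightarrow> real" where
  "basis_fun = case_sum (\<lambda>p. qM q \<alpha> c p) (\<lambda>n. qLaguerre q \<alpha> n)"

definition basis_scale :: "int + nat \<Rightarrow> real" where
  "basis_scale = case_sum
     (\<lambda>_. qpoch_inf (q powr (\<alpha> + 1)) q / (qpoch_inf q q * qpoch_inf (- c * q powr (\<alpha> + 1)) q))
     (\<lambda>n. qpoch (q powr (\<alpha> + 1)) q n / qpoch q q n)"

lemma qpoch_inf_cb_pos: "qpoch_inf (- c * q powr (\<alpha> + 1)) q > 0"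
  using mult_pos_pos[OF c_pos b_pos] by (intro qpoch_inf_pos') linarith

lemma kappa_nz: "basis_scale i \<noteq> 0"
  unfolding basis_scale_def
  using qpoch_inf_pos'[OF b_less_1] qpoch_inf_pos'[OF q_less_1] qpoch_inf_cb_pos
    qpoch_pos[OF b_less_1] qpoch_pos[OF q_less_1]
  by (auto split: sum.split simp: less_imp_neq[symmetric] less_imp_neq)

text \<open>The spectral points are the reciprocals of the upper parameters, -c q^(\<alpha>-p) for
  \<open>qM\<close> and q^(-n) for \<open>qLaguerre\<close>. Equality at the lattice points
  suffices, as the measure lives there.\<close>

lemma basis_fun_eq: "basis_fun i (xk k) = basis_scale i * psi k i"
proof (cases i)
  case (Inl p)
  have 1: "1 / spec i = - c * q powr (\<alpha> - of_int p)"
    using q_pos c_pos unfolding Inl spec_def s0_def q_powi_powr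
    by (simp add: powr_add powr_diff)
  have 2: "- (xk k * q powr (\<alpha> + 1) * spec i) = xk k * q powi (p + 1) / c"
    using q_pos c_pos unfolding Inl spec_def s0_def
    by (simp add: power_int_add)
  show ?thesis
    using phi11_eq_phi[OF spec_nz[of i], of "xk k"] unfolding 1 2 psi_def
    by (simp add: Inl basis_fun_def basis_scale_def qM_def)
next
  case (Inr n)
  have 1: "1 / spec i = q powi (- int n)"
    unfolding Inr spec_def by (simp add: power_int_minus divide_inverse)
  have 2: "xk k * q powr (\<alpha> + 1) * spec i = xk k * q powr (real n + \<alpha> + 1)"
    unfolding Inr spec_def using q_pos by (simp add: powr_add powr_realpow)
  show ?thesis
    using phi11_eq_phi[OF spec_nz[of i], of "xk k"] unfolding 1 2 psi_def
    by (simp add: Inr basis_fun_def basis_scale_def qLaguerre_def)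
qed

lemma basis_fun_has_sum:
  "((\<lambda>k. mass k * (basis_fun i (xk k) * basis_fun j (xk k))) has_sum (if i
      = j then (basis_scale i)\<^sup>2 * norm_const / dual_weight i else 0)) UNIV"
proof -
  have "(\<lambda>k. mass k * (basis_fun i (xk k) * basis_fun j (xk k)))
      = (\<lambda>k. basis_scale i * basis_scale j * (mass k * (psi k i * psi k j)))"
    by (simp add: basis_fun_eq mult_ac)
  moreover have "basis_scale i * basis_scale j * (if i = j then norm_const / dual_weight i else 0)
      = (if i = j then (basis_scale i)\<^sup>2 * norm_const / dual_weight i else 0)"
    by (simp add: power2_eq_square)
  ultimately show ?thesis
    using has_sum_cmult_right[OF row_has_sum[of i j], of "basis_scale i * basis_scale j"]
        by (simp only:)
qed

lemmas basis_fun_functional = functional_has_sum(2)[OF basis_fun_has_sum]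

lemma norm_const_eq':
  "norm_const = qpoch_inf q q * qpoch_inf (- c * q powr (\<alpha> + 1)) q
      * qpoch_inf (- (q powr (- \<alpha>)) / c) q /
     (qpoch_inf (q powr (\<alpha> + 1)) q * qpoch_inf (- c) q * qpoch_inf (- q / c) q) *
     (qpoch_inf q q / qpoch_inf (q powr (\<alpha> + 1)) q)"
proof -
  have "- (q / (c * q powr (\<alpha> + 1))) = - (q powr (- \<alpha>)) / c"
    using q_pos c_pos by (simp add: powr_add powr_minus field_simps)
  then show ?thesis
    using norm_const_eq by simp
qed

lemma norm_qLaguerre:
  "(basis_scale (Inr n))\<^sup>2 * norm_const / dual_weight (Inr n) = q powi (- int n)
        * (qpoch (q powr (\<alpha> + 1)) q n / qpoch q q n)
        * ((qpoch_inf q q * qpoch_inf (- c * q powr (\<alpha> + 1)) q * qpoch_inf (- (q powr (- \<alpha>)) / c) q)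
           / (qpoch_inf (q powr (\<alpha> + 1)) q * qpoch_inf (- c) q * qpoch_inf (- q / c) q))"
proof -
  have q: "qpoch_inf (q * q ^ n) q = qpoch_inf q q / qpoch q q n"
    using qpoch_inf_split[of q n] qpoch_q_nz[of n] by simp
  have b: "qpoch_inf (q powr (\<alpha> + 1) * q ^ n) q
      = qpoch_inf (q powr (\<alpha> + 1)) q / qpoch (q powr (\<alpha> + 1)) q n"
    using qpoch_inf_split[of "q powr (\<alpha> + 1)" n] qpoch_pos[OF b_less_1, of n] by simp
  have dual_weight: "dual_weight (Inr n) = q ^ n
      * (qpoch_inf q q / qpoch q q n / (qpoch_inf (q powr (\<alpha> + 1)) q / qpoch (q powr (\<alpha> + 1)) q n))"
    unfolding dual_weight_def dual_density_def spec_def using q_pos by (simp add: q b)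
  have basis_scale: "basis_scale (Inr n) = qpoch (q powr (\<alpha> + 1)) q n / qpoch q q n"
    by (simp add: basis_scale_def)
  \<comment> \<open>Positive letters in place of the products reduce the norm formula to an identity
    of rational functions.\<close>
  have aux: "(B / Q)\<^sup>2 * (X * (Qi / Bi)) / (T * (Qi / Q / (Bi / B))) = inverse T * (B / Q) * X"
    if "B > 0" "Q > 0" "Qi > 0" "Bi > 0" "T > 0" for B Q X Qi Bi T :: real
    using that by (simp add: field_simps power2_eq_square)
  show ?thesis
    unfolding basis_scale dual_weight norm_const_eq' power_int_minus power_int_of_nat
    by (rule aux) (intro qpoch_pos qpoch_inf_pos' zero_less_power b_less_1 q_less_1 q_pos)+
qed

lemma norm_qM:
  "(basis_scale (Inl p))\<^sup>2 * norm_const / dual_weight (Inl p) = c * q powr \<alpha> * q powi (- p)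
        * ((qpoch_inf (- (q powi (p + 1)) / c) q * qpoch_inf (- (q powr (- \<alpha>)) / c) q)
           / (qpoch_inf (- (q powr (of_int p + 1 - \<alpha>)) / c) q * qpoch_inf (- c * q powr (\<alpha> + 1)) q))
        * (1 / (qpoch_inf (- c) q * qpoch_inf (- q / c) q))"
proof -
  have s: "\<bar>spec (Inl p)\<bar> = 1 / (c * q powr \<alpha> * q powi (- p))"
    using q_pos c_pos unfolding spec_def s0_def
    by (simp add: powr_add power_int_minus field_simps abs_mult)
  have qs: "q * spec (Inl p) = - (q powr (of_int p + 1 - \<alpha>)) / c"
    using q_pos c_pos unfolding spec_def s0_def q_powi_powr
    by (simp add: powr_add powr_diff field_simps)
  have bs: "q powr (\<alpha> + 1) * spec (Inl p) = - (q powi (p + 1)) / c"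
    using q_pos c_pos unfolding spec_def s0_def by (simp add: power_int_add)
  have dual_weight: "dual_weight (Inl p) = 1 / (c * q powr \<alpha> * q powi (- p)) *
      (qpoch_inf (- (q powr (of_int p + 1 - \<alpha>)) / c) q / qpoch_inf (- (q powi (p + 1)) / c) q)"
    unfolding dual_weight_def dual_density_def s qs bs ..
  have pos: "qpoch_inf (- y / c) q > 0" if "y > 0" for y
    using that c_pos by (intro qpoch_inf_pos') (simp add: field_simps)
  have "(B / (Q * Y))\<^sup>2 * (Q * Y * A / (B * X1 * X2) * (Q / B)) / (1 / T * (V / W))
      = T * (W * A / (V * Y)) * (1 / (X1 * X2))"
    if "B > 0" "Q > 0" "Y > 0" "T > 0" "V > 0" "W > 0" "X1 > 0" "X2 > 0" for A B Q Y X1 X2 T V W :: real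
    using that by (simp add: field_simps power2_eq_square)
  moreover have "c * q powr \<alpha> * q powi (- p) > 0" "qpoch_inf (- c) q > 0"
    using c_pos q_pos by (auto intro: qpoch_inf_pos')
  ultimately show ?thesis
    unfolding dual_weight norm_const_eq' basis_scale_def
    using qpoch_inf_pos'[OF q_less_1] qpoch_inf_pos'[OF b_less_1] qpoch_inf_cb_pos pos q_pos by simp
qed

section \<open>Passage from weighted sums to the L2 space\<close>

lemma sq_integrable_iff:
  "f \<in> sq_integrable (qlag_measure q \<alpha> c) \<longleftrightarrow> (\<lambda>k. mass k * (cmod (f (xk k)))\<^sup>2) summable_on UNIV"
proof -
  have "f \<in> borel_measurable (qlag_measure q \<alpha> c)"
    unfolding qlag_measure_def by simp
  moreover have "norm (qlag_mass q \<alpha> c k *\<^sub>R (cmod (f (c * q powi k)))\<^sup>2)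
      = mass k * (cmod (f (xk k)))\<^sup>2" for k
    using mass_pos[of k] by (simp add: mass_eq_mass xk_def)
  ultimately show ?thesis
    unfolding sq_integrable_def integrable_qlag_measure_iff[OF q_pos q_less_1 c_pos] by simp
qed

lemma l2_norm_eq:
  assumes "(\<lambda>k. mass k * (cmod (f (xk k)))\<^sup>2) summable_on UNIV"
  shows "l2_norm (qlag_measure q \<alpha> c) f = sqrt (infsum (\<lambda>k. mass k * (cmod (f (xk k)))\<^sup>2) UNIV)"
  unfolding l2_norm_def using functional_has_sum(2)[OF has_sum_infsum[OF assms]]
  by (simp add: qlag_functional_def)

lemma basis_fun_norm_has_sum:
  "((\<lambda>k. mass k * (cmod (complex_of_real (basis_fun i (xk k))))\<^sup>2)
      has_sum ((basis_scale i)\<^sup>2 * norm_const / dual_weight i)) UNIV"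
  using basis_fun_has_sum[of i i] by (simp add: power2_eq_square)

lemma basis_fun_orthogonal_basis:
  "l2_orthogonal_basis (qlag_measure q \<alpha> c) (\<lambda>i x. complex_of_real (basis_fun i x))"
  unfolding l2_orthogonal_basis_def
proof (intro conjI allI ballI impI)
  fix i
  show "(\<lambda>x. complex_of_real (basis_fun i x)) \<in> sq_integrable (qlag_measure q \<alpha> c)"
    unfolding sq_integrable_iff using basis_fun_norm_has_sum by (rule has_sum_imp_summable)
  have "l2_norm (qlag_measure q \<alpha> c) (\<lambda>x. complex_of_real (basis_fun i x))
      = sqrt ((basis_scale i)\<^sup>2 * norm_const / dual_weight i)"
    using l2_norm_eq[OF has_sum_imp_summable[OF basis_fun_norm_has_sum]] infsumI[OF
        basis_fun_norm_has_sum] by simp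
  then show "l2_norm (qlag_measure q \<alpha> c) (\<lambda>x. complex_of_real (basis_fun i x)) \<noteq> 0"
    using kappa_nz[of i] norm_const_pos dual_weight_pos[of i] by simp
next
  fix i j :: "int + nat" assume "i \<noteq> j"
  then have "(LINT x|qlag_measure q \<alpha> c. basis_fun i x * basis_fun j x) = 0"
    using basis_fun_functional[of i j] by (simp add: qlag_functional_def)
  moreover have "complex_of_real (basis_fun i x) * cnj (complex_of_real (basis_fun j x))
      = complex_of_real (basis_fun i x * basis_fun j x)" for x
    by simp
  ultimately show "l2_inner (qlag_measure q \<alpha> c) (\<lambda>x. complex_of_real (basis_fun i x)) (\<lambda>x.
      complex_of_real (basis_fun j x)) = 0"
    unfolding l2_inner_def by (simp only: integral_complex_of_real of_real_0)
next
  fix f and \<epsilon> :: real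
  assume f: "f \<in> sq_integrable (qlag_measure q \<alpha> c)" and "\<epsilon> > 0"
  then have "\<epsilon>\<^sup>2 > 0" by simp
  from psi_complete[OF f[unfolded sq_integrable_iff] this] obtain J a where J: "finite J"
    "(\<lambda>k. mass k * (cmod (f (xk k) - (\<Sum>i\<in>J. a i * complex_of_real (psi k i))))\<^sup>2) summable_on UNIV"
    "infsum (\<lambda>k. mass k * (cmod (f (xk k) - (\<Sum>i\<in>J. a i * complex_of_real (psi k i))))\<^sup>2) UNIV < \<epsilon>\<^sup>2"
    by blast
  define a' where "a' i = a i / complex_of_real (basis_scale i)" for i
  have eq: "a i * complex_of_real (psi k i) = a' i * complex_of_real (basis_fun i (xk k))" for i k
    unfolding a'_def basis_fun_eq using kappa_nz[of i] by simp
  let ?g = "\<lambda>x. f x - (\<Sum>j\<in>J. a' j * complex_of_real (basis_fun j x))"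
  have "l2_norm (qlag_measure q \<alpha> c) ?g < \<epsilon>"
    using l2_norm_eq[of ?g] J(2,3) \<open>\<epsilon> > 0\<close> unfolding eq by (simp add: real_less_lsqrt)
  then show "\<exists>J a. finite J \<and>
      l2_norm (qlag_measure q \<alpha> c) (\<lambda>x. f x - (\<Sum>j\<in>J. a j * complex_of_real (basis_fun j x))) < \<epsilon>"
    using J(1) by blast
qed

end

theorem theorem4p1:
  fixes q c \<alpha> :: real
  assumes "0 < q" "q < 1" "c > 0" "\<alpha> > -1"
  shows "l2_orthogonal_basis (qlag_measure q \<alpha> c)
      (case_sum (\<lambda>(p::int) x. complex_of_real (qM q \<alpha> c p x))
                (\<lambda>(n::nat) x. complex_of_real (qLaguerre q \<alpha> n x)))
    \<and> (\<forall>n m :: nat. qlag_functional q \<alpha> c (\<lambda>x. qLaguerre q \<alpha> n x * qLaguerre q \<alpha> m x) =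
      (if n = m then 1 else 0) * q powi (- int n)
        * (qpoch (q powr (\<alpha> + 1)) q n / qpoch q q n)
        * ((qpoch_inf q q * qpoch_inf (- c * q powr (\<alpha> + 1)) q * qpoch_inf (- (q powr (- \<alpha>)) / c) q)
           / (qpoch_inf (q powr (\<alpha> + 1)) q * qpoch_inf (- c) q * qpoch_inf (- q / c) q)))
    \<and> (\<forall>p r :: int. qlag_functional q \<alpha> c (\<lambda>x. qM q \<alpha> c p x * qM q \<alpha> c r x) =
      (if p = r then 1 else 0) * c * q powr \<alpha> * q powi (- p)
        * ((qpoch_inf (- (q powi (p + 1)) / c) q * qpoch_inf (- (q powr (- \<alpha>)) / c) q)
           / (qpoch_inf (- (q powr (of_int p + 1 - \<alpha>)) / c) q * qpoch_inf (- c * q powr (\<alpha> + 1)) q))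
        * (1 / (qpoch_inf (- c) q * qpoch_inf (- q / c) q)))
    \<and> (\<forall>(p::int) (n::nat). qlag_functional q \<alpha> c (\<lambda>x. qM q \<alpha> c p x * qLaguerre q \<alpha> n x) = 0)"
proof -
  interpret qlag_basis q \<alpha> c
    using assms by unfold_locales auto
  have "(\<lambda>i x. complex_of_real (basis_fun i x)) =
      case_sum (\<lambda>p x. complex_of_real (qM q \<alpha> c p x)) (\<lambda>n x. complex_of_real (qLaguerre q \<alpha> n x))"
    by (auto simp: basis_fun_def fun_eq_iff split: sum.split)
  then have basis: "l2_orthogonal_basis (qlag_measure q \<alpha> c)
      (case_sum (\<lambda>p x. complex_of_real (qM q \<alpha> c p x)) (\<lambda>n x. complex_of_real (qLaguerre q \<alpha> n x)))"
    using basis_fun_orthogonal_basis by simp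
  have LL: "qlag_functional q \<alpha> c (\<lambda>x. qLaguerre q \<alpha> n x * qLaguerre q \<alpha> m x) =
      (if n = m then (basis_scale (Inr n))\<^sup>2 * norm_const / dual_weight (Inr n) else 0)" for n m
    using basis_fun_functional[of "Inr n" "Inr m"] by (simp add: basis_fun_def)
  have MM: "qlag_functional q \<alpha> c (\<lambda>x. qM q \<alpha> c p x * qM q \<alpha> c p' x) =
      (if p = p' then (basis_scale (Inl p))\<^sup>2 * norm_const / dual_weight (Inl p) else 0)" for p p'
    using basis_fun_functional[of "Inl p" "Inl p'"] by (simp add: basis_fun_def)
  have mixed: "qlag_functional q \<alpha> c (\<lambda>x. qM q \<alpha> c p x * qLaguerre q \<alpha> n x) = 0" for p n
    using basis_fun_functional[of "Inl p" "Inr n"] by (simp add: basis_fun_def)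
  show ?thesis
    using basis mixed unfolding LL MM norm_qLaguerre norm_qM by simp
qed

end
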